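(* Let $n\ge 3$ and let $M$ be an $n$-dimensional $C$-totally real submanifold of a $(2m+1)$-dimensional generalized $(\kappa,\mu)$-contact space form $\tilde M(f_1,\ldots,f_6)$ satisfying $f_3=f_1-1$. Then, at each point of $M$, $$\delta_M\le\frac{n^{2}(n-2)}{2(n-1)}\|H\|^{2}+\frac{(n+1)(n-2)}{2}f_{1}.$$ Equality holds at $p\in M$ if and only if there exist a plane section $\pi\subset T_pM$, an orthonormal basis $\{e_1,\dots,e_n\}$ of $T_pM$ and an orthonormal basis $\{e_{n+1},\dots,e_{2m+1}=\xi\}$ of the normal space $T_p^\perp M$ such that (a) $\pi=\operatorname{Span}\{e_1,e_2\}$ and (b) the shape operators $A_r\equiv A_{e_r}$, $r=n+1,\dots,2m+1$, have the matrix forms (with respect to $\{e_1,\dots,e_n\}$) $$A_{n+1}=\begin{bmatrix}a&0&0\\0&b&0\\0&0&(a+b)I_{n-2}\end{bmatrix},\qquad A_r=\begin{bmatrix}c_r&d_r&0\\d_r&-c_r&0\\0&0&0_{n-2}\end{bmatrix},\quad r=n+2,\dots,2m,$$ for some real numbers $a,b,c_r,d_r$, and $A_\xi=0$.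
   Context: An almost contact metric manifold $(\tilde M,\phi,\xi,\eta,\langle,\rangle)$ is a manifold with a $(1,1)$-tensor field $\phi$, a vector field $\xi$, a 1-form $\eta$ and a Riemannian metric $\langle,\rangle$ satisfying $\phi^2=-I+\eta\otimes\xi$, $\eta(\xi)=1$, $\eta\circ\phi=0$, $\phi\xi=0$, $\langle X,Y\rangle=\langle\phi X,\phi Y\rangle+\eta(X)\eta(Y)$, $\langle X,\xi\rangle=\eta(X)$, $\langle X,\phi Y\rangle=-\langle\phi X,Y\rangle$. It is a contact metric manifold if $d\eta(X,Y)=\langle X,\phi Y\rangle$. Put $2h=\mathcal L_\xi\phi$ (Lie derivative). On a contact metric manifold $h$ is symmetric, $h\xi=0$, $h\phi+\phi h=0$, $\operatorname{trace}h=\operatorname{trace}(\phi h)=0$, and $\tilde\nabla_X\xi=-\phi X-\phi hX$ (this fixes the normalization of $d\eta$). A generalized $(\kappa,\mu)$-space form, denoted $\tilde M(f_1,\dots,f_6)$, is an almost contact metric manifold with differentiable functions $f_1,\dots,f_6$ on $\tilde M$ such that its curvature tensor is $\tilde R=\sum_{i=1}^6f_iR_i$, where $R_1(X,Y)Z=\langle Y,Z\rangle X-\langle X,Z\rangle Y$; $R_2(X,Y)Z=\langle X,\phi Z\rangle\phi Y-\langle Y,\phi Z\rangle\phi X+2\langle X,\phi Y\rangle\phi Z$; $R_3(X,Y)Z=\eta(X)\eta(Z)Y-\eta(Y)\eta(Z)X+\langle X,Z\rangle\eta(Y)\xi-\langle Y,Z\rangle\eta(X)\xi$; $R_4(X,Y)Z=\langle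 Y,Z\rangle hX-\langle X,Z\rangle hY+\langle hY,Z\rangle X-\langle hX,Z\rangle Y$; $R_5(X,Y)Z=\langle hY,Z\rangle hX-\langle hX,Z\rangle hY+\langle\phi hX,Z\rangle\phi hY-\langle\phi hY,Z\rangle\phi hX$; $R_6(X,Y)Z=\eta(X)\eta(Z)hY-\eta(Y)\eta(Z)hX+\langle hX,Z\rangle\eta(Y)\xi-\langle hY,Z\rangle\eta(X)\xi$. It is called a generalized $(\kappa,\mu)$-contact space form when the structure is contact metric. Curvature convention: $\tilde R(X,Y,Z,W)=\langle\tilde R(X,Y)Z,W\rangle$, and the sectional curvature of the plane spanned by orthonormal $X,Y$ is $\tilde R(X,Y,Y,X)$ (similarly for $M$). A submanifold $M$ of a contact metric manifold $\tilde M$ is $C$-totally real if $\xi$ is normal to $M$ (every tangent vector lies in the contact distribution $\ker\eta$). $M$ carries the induced metric; $\sigma$ is its second fundamental form, $A_N$ the shape operator, $\langle A_NX,Y\rangle=\langle\sigma(X,Y),N\rangle$, and $H=\frac1n\operatorname{trace}(\sigma)$ is the mean curvature vector. $K(\pi)$ is the sectional curvature of $M$ on a plane section (2-dimensional subspace) $\pi\subset T_pM$; $\tau(p)=\sum_{1\le i<j\le n}K(e_i\wedge e_j)$ is the scalar curvature for any orthonormal basis $\{e_i\}$ of $T_pM$; $(\inf K)(p)=\inf\{K(\pi):\pi\subset T_pM,\dim\pi=2\}$; and $\delta_M(p)=\tau(p)-(\inf K)(p)$. *)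

theory Defs
  imports "HOL-Analysis.Analysis"
begin

section \<open>Smooth manifolds\<close>

text \<open>Smooth means \<open>C\<^sup>\<infinity>\<close>. For an open subset \<open>S\<close> of a Euclidean space, the following is the
  usual notion: all iterated directional derivatives exist and are continuous.\<close>

abbreviation deriv_at :: "('a::real_normed_vector \<Rightarrow> 'b::real_normed_vector) \<Rightarrow> 'a \<Rightarrow> 'a \<Rightarrow> 'b"
  where "deriv_at f x \<equiv> frechet_derivative f (at x)"

primrec Ck_on :: "nat \<Rightarrow> 'a::real_normed_vector set \<Rightarrow> ('a \<Rightarrow> 'b::real_normed_vector) \<Rightarrow> bool"
  where
    "Ck_on 0 S f \<longleftrightarrow> continuous_on S f"
  | "Ck_on (Suc k) S f \<longleftrightarrow>
       (\<forall>x\<in>S. f differentiable (at x)) \<and> (\<forall>v. Ck_on k S (\<lambda>x. deriv_at f x v))"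

definition smooth_on :: "'a::real_normed_vector set \<Rightarrow> ('a \<Rightarrow> 'b::real_normed_vector) \<Rightarrow> bool"
  where "smooth_on S f \<longleftrightarrow> (\<forall>k. Ck_on k S f)"

text \<open>The underlying topological space of a manifold is a whole (Hausdorff, second countable) type
  \<open>'p\<close>; a chart is a pair of an open set and a coordinate map into the model space \<open>'e\<close>, so the
  dimension of the manifold is \<open>DIM('e)\<close>.\<close>

type_synonym ('p, 'e) chart = "'p set \<times> ('p \<Rightarrow> 'e)"

abbreviation chart_dom :: "('p, 'e) chart \<Rightarrow> 'p set" where "chart_dom c \<equiv> fst c"

abbreviation coord :: "('p, 'e) chart \<Rightarrow> 'p \<Rightarrow> 'e" where "coord c \<equiv> snd c"

abbreviation uncoord :: "('p, 'e) chart \<Rightarrow> 'e \<Rightarrow> 'p"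
  where "uncoord c \<equiv> inv_into (chart_dom c) (coord c)"

definition is_chart :: "('p::topological_space, 'e::euclidean_space) chart \<Rightarrow> bool"
  where "is_chart c \<longleftrightarrow> open (chart_dom c) \<and> open (coord c ` chart_dom c) \<and>
    homeomorphism (chart_dom c) (coord c ` chart_dom c) (coord c) (uncoord c)"

definition smooth_atlas ::
    "('p::{t2_space, second_countable_topology}, 'e::euclidean_space) chart set \<Rightarrow> bool"
  where "smooth_atlas A \<longleftrightarrow> (\<forall>c\<in>A. is_chart c) \<and> (\<Union>c\<in>A. chart_dom c) = UNIV \<and>
    (\<forall>c\<in>A. \<forall>d\<in>A. smooth_on (coord c ` (chart_dom c \<inter> chart_dom d)) (coord d \<circ> uncoord c))"

definition chart_at :: "('p, 'e) chart set \<Rightarrow> 'p \<Rightarrow> ('p, 'e) chart"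
  where "chart_at A p = (SOME c. c \<in> A \<and> p \<in> chart_dom c)"

text \<open>The tangent space at \<open>p\<close> is identified with the model space \<open>'e\<close> by means of the chart
  \<open>chart_at A p\<close>: a vector of \<open>'e\<close>, regarded as a tangent vector at \<open>p\<close>, lists components in that
  chart. Hence a vector field is a function \<open>'p \<Rightarrow> 'e\<close>, a \<open>(1,1)\<close>-tensor field is a function
  \<open>'p \<Rightarrow> 'e \<Rightarrow> 'e\<close>, and so on. For a chart \<open>c\<close> around \<open>p\<close>, \<open>to_chart A c p\<close> converts a tangent
  vector at \<open>p\<close> to its components in \<open>c\<close>, and \<open>from_chart A c p\<close> is the inverse conversion; both
  are the identity if \<open>c = chart_at A p\<close>. The inner product which \<open>'e\<close> has as a Euclidean space is
  not used as a metric.\<close>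

definition to_chart ::
    "('p, 'e::euclidean_space) chart set \<Rightarrow> ('p, 'e) chart \<Rightarrow> 'p \<Rightarrow> 'e \<Rightarrow> 'e"
  where "to_chart A c p =
    deriv_at (coord c \<circ> uncoord (chart_at A p)) (coord (chart_at A p) p)"

definition from_chart ::
    "('p, 'e::euclidean_space) chart set \<Rightarrow> ('p, 'e) chart \<Rightarrow> 'p \<Rightarrow> 'e \<Rightarrow> 'e"
  where "from_chart A c p = deriv_at (coord (chart_at A p) \<circ> uncoord c) (coord c p)"

text \<open>Local expressions, in a chart, of a function, a vector field, a 1-form, a
  \<open>(1,1)\<close>-tensor field and a \<open>(0,2)\<close>-tensor field.\<close>

definition fun_rep :: "('p, 'e) chart \<Rightarrow> ('p \<Rightarrow> real) \<Rightarrow> 'e \<Rightarrow> real"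
  where "fun_rep c f x = f (uncoord c x)"

definition vec_rep ::
    "('p, 'e::euclidean_space) chart set \<Rightarrow> ('p, 'e) chart \<Rightarrow> ('p \<Rightarrow> 'e) \<Rightarrow> 'e \<Rightarrow> 'e"
  where "vec_rep A c X x = (let p = uncoord c x in to_chart A c p (X p))"

definition form_rep ::
    "('p, 'e::euclidean_space) chart set \<Rightarrow> ('p, 'e) chart \<Rightarrow> ('p \<Rightarrow> 'e \<Rightarrow> real) \<Rightarrow> 'e \<Rightarrow> 'e \<Rightarrow> real"
  where "form_rep A c \<eta> x u = (let p = uncoord c x in \<eta> p (from_chart A c p u))"

definition endo_rep ::
    "('p, 'e::euclidean_space) chart set \<Rightarrow> ('p, 'e) chart \<Rightarrow> ('p \<Rightarrow> 'e \<Rightarrow> 'e) \<Rightarrow> 'e \<Rightarrow> 'e \<Rightarrow> 'e"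
  where "endo_rep A c \<phi> x u =
    (let p = uncoord c x in to_chart A c p (\<phi> p (from_chart A c p u)))"

definition metric_rep ::
    "('p, 'e::euclidean_space) chart set \<Rightarrow> ('p, 'e) chart \<Rightarrow> ('p \<Rightarrow> 'e \<Rightarrow> 'e \<Rightarrow> real) \<Rightarrow>
     'e \<Rightarrow> 'e \<Rightarrow> 'e \<Rightarrow> real"
  where "metric_rep A c g x u v =
    (let p = uncoord c x in g p (from_chart A c p u) (from_chart A c p v))"

definition smooth_function ::
    "('p, 'e::euclidean_space) chart set \<Rightarrow> ('p \<Rightarrow> real) \<Rightarrow> bool"
  where "smooth_function A f \<longleftrightarrow> (\<forall>c\<in>A. smooth_on (coord c ` chart_dom c) (fun_rep c f))"

definition vector_field ::
    "('p, 'e::euclidean_space) chart set \<Rightarrow> ('p \<Rightarrow> 'e) \<Rightarrow> bool"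
  where "vector_field A X \<longleftrightarrow> (\<forall>c\<in>A. smooth_on (coord c ` chart_dom c) (vec_rep A c X))"

definition one_form ::
    "('p, 'e::euclidean_space) chart set \<Rightarrow> ('p \<Rightarrow> 'e \<Rightarrow> real) \<Rightarrow> bool"
  where "one_form A \<eta> \<longleftrightarrow> (\<forall>p. linear (\<eta> p)) \<and>
    (\<forall>c\<in>A. \<forall>u. smooth_on (coord c ` chart_dom c) (\<lambda>x. form_rep A c \<eta> x u))"

definition endo_field ::
    "('p, 'e::euclidean_space) chart set \<Rightarrow> ('p \<Rightarrow> 'e \<Rightarrow> 'e) \<Rightarrow> bool"
  where "endo_field A \<phi> \<longleftrightarrow> (\<forall>p. linear (\<phi> p)) \<and>
    (\<forall>c\<in>A. \<forall>u. smooth_on (coord c ` chart_dom c) (\<lambda>x. endo_rep A c \<phi> x u))"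

definition riemannian_metric ::
    "('p, 'e::euclidean_space) chart set \<Rightarrow> ('p \<Rightarrow> 'e \<Rightarrow> 'e \<Rightarrow> real) \<Rightarrow> bool"
  where "riemannian_metric A g \<longleftrightarrow>
    (\<forall>p. bilinear (g p) \<and> (\<forall>u v. g p u v = g p v u) \<and> (\<forall>u. u \<noteq> 0 \<longrightarrow> 0 < g p u u)) \<and>
    (\<forall>c\<in>A. \<forall>u v. smooth_on (coord c ` chart_dom c) (\<lambda>x. metric_rep A c g x u v))"


section \<open>Tensor calculus on an open subset of the model space\<close>

definition lie_bracket ::
    "('e::euclidean_space \<Rightarrow> 'e) \<Rightarrow> ('e \<Rightarrow> 'e) \<Rightarrow> 'e \<Rightarrow> 'e"
  where "lie_bracket X Y x = deriv_at Y x (X x) - deriv_at X x (Y x)"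

text \<open>The exterior derivative is normalized by
  \<open>2 d\<eta>(X,Y) = X(\<eta>(Y)) - Y(\<eta>(X)) - \<eta>([X,Y])\<close>; with this factor the condition
  \<open>d\<eta>(X,Y) = \<langle>X,\<phi>Y\<rangle>\<close> gives \<open>\<nabla>\<^sub>X\<xi> = -\<phi>X - \<phi>hX\<close>.\<close>

definition ext_deriv ::
    "('e::euclidean_space \<Rightarrow> 'e \<Rightarrow> real) \<Rightarrow> ('e \<Rightarrow> 'e) \<Rightarrow> ('e \<Rightarrow> 'e) \<Rightarrow> 'e \<Rightarrow> real"
  where "ext_deriv \<eta> X Y x =
    (deriv_at (\<lambda>y. \<eta> y (Y y)) x (X x) - deriv_at (\<lambda>y. \<eta> y (X y)) x (Y x)
      - \<eta> x (lie_bracket X Y x)) / 2"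

definition lie_deriv_endo ::
    "('e::euclidean_space \<Rightarrow> 'e) \<Rightarrow> ('e \<Rightarrow> 'e \<Rightarrow> 'e) \<Rightarrow> ('e \<Rightarrow> 'e) \<Rightarrow> 'e \<Rightarrow> 'e"
  where "lie_deriv_endo \<xi> \<phi> Y x =
    lie_bracket \<xi> (\<lambda>y. \<phi> y (Y y)) x - \<phi> x (lie_bracket \<xi> Y x)"

text \<open>\<open>christoffel g x u v\<close> is the Levi-Civita derivative at \<open>x\<close> of the constant field \<open>v\<close> in
  direction \<open>u\<close>, given by the Koszul formula (constant fields commute).\<close>

definition christoffel ::
    "('e::euclidean_space \<Rightarrow> 'e \<Rightarrow> 'e \<Rightarrow> real) \<Rightarrow> 'e \<Rightarrow> 'e \<Rightarrow> 'e \<Rightarrow> 'e"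
  where "christoffel g x u v = (THE w. \<forall>z. 2 * g x w z =
    deriv_at (\<lambda>y. g y v z) x u + deriv_at (\<lambda>y. g y u z) x v - deriv_at (\<lambda>y. g y u v) x z)"

definition levi_civita ::
    "('e::euclidean_space \<Rightarrow> 'e \<Rightarrow> 'e \<Rightarrow> real) \<Rightarrow> ('e \<Rightarrow> 'e) \<Rightarrow> ('e \<Rightarrow> 'e) \<Rightarrow> 'e \<Rightarrow> 'e"
  where "levi_civita g X Y x = deriv_at Y x (X x) + christoffel g x (X x) (Y x)"

definition curvature ::
    "('e::euclidean_space \<Rightarrow> 'e \<Rightarrow> 'e \<Rightarrow> real) \<Rightarrow> ('e \<Rightarrow> 'e) \<Rightarrow> ('e \<Rightarrow> 'e) \<Rightarrow> ('e \<Rightarrow> 'e) \<Rightarrow> 'e \<Rightarrow> 'e"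
  where "curvature g X Y Z x =
    levi_civita g X (levi_civita g Y Z) x - levi_civita g Y (levi_civita g X Z) x
      - levi_civita g (lie_bracket X Y) Z x"


section \<open>Tensors at a point of a manifold\<close>

text \<open>The tensors below are evaluated on tangent vectors at \<open>p\<close> by extending these to fields that are
  constant in the chart \<open>chart_at A p\<close>; by tensoriality neither the extension nor the chart
  matters.\<close>

definition ext_deriv_at ::
    "('p, 'e::euclidean_space) chart set \<Rightarrow> ('p \<Rightarrow> 'e \<Rightarrow> real) \<Rightarrow> 'p \<Rightarrow> 'e \<Rightarrow> 'e \<Rightarrow> real"
  where "ext_deriv_at A \<eta> p u v = (let c = chart_at A p in
    ext_deriv (form_rep A c \<eta>) (\<lambda>_. u) (\<lambda>_. v) (coord c p))"

definition lie_deriv_endo_at ::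
    "('p, 'e::euclidean_space) chart set \<Rightarrow> ('p \<Rightarrow> 'e) \<Rightarrow> ('p \<Rightarrow> 'e \<Rightarrow> 'e) \<Rightarrow> 'p \<Rightarrow> 'e \<Rightarrow> 'e"
  where "lie_deriv_endo_at A \<xi> \<phi> p u = (let c = chart_at A p in
    lie_deriv_endo (vec_rep A c \<xi>) (endo_rep A c \<phi>) (\<lambda>_. u) (coord c p))"

definition riemann_at ::
    "('p, 'e::euclidean_space) chart set \<Rightarrow> ('p \<Rightarrow> 'e \<Rightarrow> 'e \<Rightarrow> real) \<Rightarrow> 'p \<Rightarrow> 'e \<Rightarrow> 'e \<Rightarrow> 'e \<Rightarrow> 'e"
  where "riemann_at A g p u v w = (let c = chart_at A p in
    curvature (metric_rep A c g) (\<lambda>_. u) (\<lambda>_. v) (\<lambda>_. w) (coord c p))"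

text \<open>\<open>e\<close> is an orthonormal basis, indexed by \<open>I\<close>, of the subspace \<open>V\<close> with respect to the inner
  product \<open>G\<close>.\<close>

definition onb :: "('v::real_vector \<Rightarrow> 'v \<Rightarrow> real) \<Rightarrow> 'v set \<Rightarrow> nat set \<Rightarrow> (nat \<Rightarrow> 'v) \<Rightarrow> bool"
  where "onb G V I e \<longleftrightarrow>
    (\<forall>i\<in>I. \<forall>j\<in>I. G (e i) (e j) = (if i = j then 1 else 0)) \<and> span (e ` I) = V"

definition plane_section :: "'v::real_vector set \<Rightarrow> bool"
  where "plane_section \<pi> \<longleftrightarrow> subspace \<pi> \<and> dim \<pi> = 2"

definition sectional_curvature ::
    "('p, 'e::euclidean_space) chart set \<Rightarrow> ('p \<Rightarrow> 'e \<Rightarrow> 'e \<Rightarrow> real) \<Rightarrow> 'p \<Rightarrow> 'e set \<Rightarrow> real"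
  where "sectional_curvature A g p \<pi> = (THE k. \<forall>u\<in>\<pi>. \<forall>v\<in>\<pi>.
    g p u u = 1 \<longrightarrow> g p v v = 1 \<longrightarrow> g p u v = 0 \<longrightarrow> k = g p (riemann_at A g p u v v) u)"

definition inf_K ::
    "('p, 'e::euclidean_space) chart set \<Rightarrow> ('p \<Rightarrow> 'e \<Rightarrow> 'e \<Rightarrow> real) \<Rightarrow> 'p \<Rightarrow> real"
  where "inf_K A g p = Inf {sectional_curvature A g p \<pi> | \<pi>. plane_section \<pi>}"

text \<open>The choice of orthonormal basis here, and in \<open>mean_curvature\<close> below, is immaterial.\<close>

definition scalar_curvature ::
    "('p, 'e::euclidean_space) chart set \<Rightarrow> ('p \<Rightarrow> 'e \<Rightarrow> 'e \<Rightarrow> real) \<Rightarrow> 'p \<Rightarrow> real"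
  where "scalar_curvature A g p = (let e = (SOME e. onb (g p) UNIV {1..DIM('e)} e) in
    \<Sum>j\<in>{1..DIM('e)}. \<Sum>i\<in>{1..<j}. sectional_curvature A g p (span {e i, e j}))"

definition delta_invariant ::
    "('p, 'e::euclidean_space) chart set \<Rightarrow> ('p \<Rightarrow> 'e \<Rightarrow> 'e \<Rightarrow> real) \<Rightarrow> 'p \<Rightarrow> real"
  where "delta_invariant A g p = scalar_curvature A g p - inf_K A g p"


section \<open>Contact metric manifolds and generalized \<open>(\<kappa>,\<mu>)\<close>-contact space forms\<close>

definition almost_contact_metric ::
    "('p, 'e::euclidean_space) chart set \<Rightarrow> ('p \<Rightarrow> 'e \<Rightarrow> 'e) \<Rightarrow> ('p \<Rightarrow> 'e) \<Rightarrow> ('p \<Rightarrow> 'e \<Rightarrow> real) \<Rightarrow>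
     ('p \<Rightarrow> 'e \<Rightarrow> 'e \<Rightarrow> real) \<Rightarrow> bool"
  where "almost_contact_metric A \<phi> \<xi> \<eta> g \<longleftrightarrow>
    endo_field A \<phi> \<and> vector_field A \<xi> \<and> one_form A \<eta> \<and> riemannian_metric A g \<and>
    (\<forall>p. (\<forall>u. \<phi> p (\<phi> p u) = - u + \<eta> p u *\<^sub>R \<xi> p) \<and>
         \<eta> p (\<xi> p) = 1 \<and>
         (\<forall>u. \<eta> p (\<phi> p u) = 0) \<and>
         \<phi> p (\<xi> p) = 0 \<and>
         (\<forall>u v. g p u v = g p (\<phi> p u) (\<phi> p v) + \<eta> p u * \<eta> p v) \<and>
         (\<forall>u. g p u (\<xi> p) = \<eta> p u) \<and>
         (\<forall>u v. g p u (\<phi> p v) = - g p (\<phi> p u) v))"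

definition contact_metric ::
    "('p, 'e::euclidean_space) chart set \<Rightarrow> ('p \<Rightarrow> 'e \<Rightarrow> 'e) \<Rightarrow> ('p \<Rightarrow> 'e) \<Rightarrow> ('p \<Rightarrow> 'e \<Rightarrow> real) \<Rightarrow>
     ('p \<Rightarrow> 'e \<Rightarrow> 'e \<Rightarrow> real) \<Rightarrow> bool"
  where "contact_metric A \<phi> \<xi> \<eta> g \<longleftrightarrow> almost_contact_metric A \<phi> \<xi> \<eta> g \<and>
    (\<forall>p u v. ext_deriv_at A \<eta> p u v = g p u (\<phi> p v))"

definition h_tensor ::
    "('p, 'e::euclidean_space) chart set \<Rightarrow> ('p \<Rightarrow> 'e) \<Rightarrow> ('p \<Rightarrow> 'e \<Rightarrow> 'e) \<Rightarrow> 'p \<Rightarrow> 'e \<Rightarrow> 'e"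
  where "h_tensor A \<xi> \<phi> p u = (1/2) *\<^sub>R lie_deriv_endo_at A \<xi> \<phi> p u"

text \<open>The six basic curvature-like tensors on a single tangent space.\<close>

definition R1 :: "('v::real_vector \<Rightarrow> 'v \<Rightarrow> real) \<Rightarrow> 'v \<Rightarrow> 'v \<Rightarrow> 'v \<Rightarrow> 'v"
  where "R1 G X Y Z = G Y Z *\<^sub>R X - G X Z *\<^sub>R Y"

definition R2 :: "('v::real_vector \<Rightarrow> 'v \<Rightarrow> real) \<Rightarrow> ('v \<Rightarrow> 'v) \<Rightarrow> 'v \<Rightarrow> 'v \<Rightarrow> 'v \<Rightarrow> 'v"
  where "R2 G \<phi> X Y Z =
    G X (\<phi> Z) *\<^sub>R \<phi> Y - G Y (\<phi> Z) *\<^sub>R \<phi> X + (2 * G X (\<phi> Y)) *\<^sub>R \<phi> Z"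

definition R3 :: "('v::real_vector \<Rightarrow> 'v \<Rightarrow> real) \<Rightarrow> ('v \<Rightarrow> real) \<Rightarrow> 'v \<Rightarrow> 'v \<Rightarrow> 'v \<Rightarrow> 'v \<Rightarrow> 'v"
  where "R3 G \<eta> \<xi> X Y Z =
    (\<eta> X * \<eta> Z) *\<^sub>R Y - (\<eta> Y * \<eta> Z) *\<^sub>R X + (G X Z * \<eta> Y) *\<^sub>R \<xi> - (G Y Z * \<eta> X) *\<^sub>R \<xi>"

definition R4 :: "('v::real_vector \<Rightarrow> 'v \<Rightarrow> real) \<Rightarrow> ('v \<Rightarrow> 'v) \<Rightarrow> 'v \<Rightarrow> 'v \<Rightarrow> 'v \<Rightarrow> 'v"
  where "R4 G h X Y Z =
    G Y Z *\<^sub>R h X - G X Z *\<^sub>R h Y + G (h Y) Z *\<^sub>R X - G (h X) Z *\<^sub>R Y"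

definition R5 ::
    "('v::real_vector \<Rightarrow> 'v \<Rightarrow> real) \<Rightarrow> ('v \<Rightarrow> 'v) \<Rightarrow> ('v \<Rightarrow> 'v) \<Rightarrow> 'v \<Rightarrow> 'v \<Rightarrow> 'v \<Rightarrow> 'v"
  where "R5 G \<phi> h X Y Z =
    G (h Y) Z *\<^sub>R h X - G (h X) Z *\<^sub>R h Y
      + G (\<phi> (h X)) Z *\<^sub>R \<phi> (h Y) - G (\<phi> (h Y)) Z *\<^sub>R \<phi> (h X)"

definition R6 ::
    "('v::real_vector \<Rightarrow> 'v \<Rightarrow> real) \<Rightarrow> ('v \<Rightarrow> real) \<Rightarrow> 'v \<Rightarrow> ('v \<Rightarrow> 'v) \<Rightarrow> 'v \<Rightarrow> 'v \<Rightarrow> 'v \<Rightarrow> 'v"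
  where "R6 G \<eta> \<xi> h X Y Z =
    (\<eta> X * \<eta> Z) *\<^sub>R h Y - (\<eta> Y * \<eta> Z) *\<^sub>R h X
      + (G (h X) Z * \<eta> Y) *\<^sub>R \<xi> - (G (h Y) Z * \<eta> X) *\<^sub>R \<xi>"

definition gen_km_space_form ::
    "('p, 'e::euclidean_space) chart set \<Rightarrow> ('p \<Rightarrow> 'e \<Rightarrow> 'e) \<Rightarrow> ('p \<Rightarrow> 'e) \<Rightarrow> ('p \<Rightarrow> 'e \<Rightarrow> real) \<Rightarrow>
     ('p \<Rightarrow> 'e \<Rightarrow> 'e \<Rightarrow> real) \<Rightarrow> ('p \<Rightarrow> real) \<Rightarrow> ('p \<Rightarrow> real) \<Rightarrow> ('p \<Rightarrow> real) \<Rightarrow> ('p \<Rightarrow> real) \<Rightarrow>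
     ('p \<Rightarrow> real) \<Rightarrow> ('p \<Rightarrow> real) \<Rightarrow> bool"
  where "gen_km_space_form A \<phi> \<xi> \<eta> g f1 f2 f3 f4 f5 f6 \<longleftrightarrow>
    almost_contact_metric A \<phi> \<xi> \<eta> g \<and>
    smooth_function A f1 \<and> smooth_function A f2 \<and> smooth_function A f3 \<and>
    smooth_function A f4 \<and> smooth_function A f5 \<and> smooth_function A f6 \<and>
    (\<forall>p X Y Z. let h = h_tensor A \<xi> \<phi> p in
       riemann_at A g p X Y Z =
         f1 p *\<^sub>R R1 (g p) X Y Z + f2 p *\<^sub>R R2 (g p) (\<phi> p) X Y Z
         + f3 p *\<^sub>R R3 (g p) (\<eta> p) (\<xi> p) X Y Z + f4 p *\<^sub>R R4 (g p) h X Y Z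
         + f5 p *\<^sub>R R5 (g p) (\<phi> p) h X Y Z + f6 p *\<^sub>R R6 (g p) (\<eta> p) (\<xi> p) h X Y Z)"

definition gen_km_contact_space_form ::
    "('p, 'e::euclidean_space) chart set \<Rightarrow> ('p \<Rightarrow> 'e \<Rightarrow> 'e) \<Rightarrow> ('p \<Rightarrow> 'e) \<Rightarrow> ('p \<Rightarrow> 'e \<Rightarrow> real) \<Rightarrow>
     ('p \<Rightarrow> 'e \<Rightarrow> 'e \<Rightarrow> real) \<Rightarrow> ('p \<Rightarrow> real) \<Rightarrow> ('p \<Rightarrow> real) \<Rightarrow> ('p \<Rightarrow> real) \<Rightarrow> ('p \<Rightarrow> real) \<Rightarrow>
     ('p \<Rightarrow> real) \<Rightarrow> ('p \<Rightarrow> real) \<Rightarrow> bool"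
  where "gen_km_contact_space_form A \<phi> \<xi> \<eta> g f1 f2 f3 f4 f5 f6 \<longleftrightarrow>
    contact_metric A \<phi> \<xi> \<eta> g \<and> gen_km_space_form A \<phi> \<xi> \<eta> g f1 f2 f3 f4 f5 f6"


section \<open>Submanifolds\<close>

text \<open>A submanifold is a manifold \<open>M\<close> (with atlas \<open>B\<close>) together with an immersion \<open>\<iota>\<close> into the
  ambient manifold (with atlas \<open>A\<close>); embedded submanifolds are a special case. A tangent vector \<open>a\<close>
  of \<open>M\<close> at \<open>q\<close> corresponds to the ambient vector \<open>differential B A \<iota> q a\<close> at \<open>\<iota> q\<close>.\<close>

definition smooth_map ::
    "('q::topological_space, 'f::euclidean_space) chart set \<Rightarrow>
     ('p::topological_space, 'e::euclidean_space) chart set \<Rightarrow> ('q \<Rightarrow> 'p) \<Rightarrow> bool"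
  where "smooth_map B A \<iota> \<longleftrightarrow> continuous_on UNIV \<iota> \<and>
    (\<forall>c\<in>B. \<forall>d\<in>A.
      smooth_on (coord c ` (chart_dom c \<inter> \<iota> -` chart_dom d)) (coord d \<circ> \<iota> \<circ> uncoord c))"

definition local_map ::
    "('q, 'f) chart set \<Rightarrow> ('p, 'e) chart set \<Rightarrow> ('q \<Rightarrow> 'p) \<Rightarrow> 'q \<Rightarrow> 'f \<Rightarrow> 'e"
  where "local_map B A \<iota> q = coord (chart_at A (\<iota> q)) \<circ> \<iota> \<circ> uncoord (chart_at B q)"

definition differential ::
    "('q, 'f::euclidean_space) chart set \<Rightarrow> ('p, 'e::euclidean_space) chart set \<Rightarrow>
     ('q \<Rightarrow> 'p) \<Rightarrow> 'q \<Rightarrow> 'f \<Rightarrow> 'e"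
  where "differential B A \<iota> q = deriv_at (local_map B A \<iota> q) (coord (chart_at B q) q)"

definition immersion ::
    "('q::topological_space, 'f::euclidean_space) chart set \<Rightarrow>
     ('p::topological_space, 'e::euclidean_space) chart set \<Rightarrow> ('q \<Rightarrow> 'p) \<Rightarrow> bool"
  where "immersion B A \<iota> \<longleftrightarrow> smooth_map B A \<iota> \<and> (\<forall>q. inj (differential B A \<iota> q))"

definition induced_metric ::
    "('q, 'f::euclidean_space) chart set \<Rightarrow> ('p, 'e::euclidean_space) chart set \<Rightarrow> ('q \<Rightarrow> 'p) \<Rightarrow>
     ('p \<Rightarrow> 'e \<Rightarrow> 'e \<Rightarrow> real) \<Rightarrow> 'q \<Rightarrow> 'f \<Rightarrow> 'f \<Rightarrow> real"
  where "induced_metric B A \<iota> g q a b =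
    g (\<iota> q) (differential B A \<iota> q a) (differential B A \<iota> q b)"

definition normal_vectors ::
    "('q, 'f::euclidean_space) chart set \<Rightarrow> ('p, 'e::euclidean_space) chart set \<Rightarrow> ('q \<Rightarrow> 'p) \<Rightarrow>
     ('p \<Rightarrow> 'e \<Rightarrow> 'e \<Rightarrow> real) \<Rightarrow> 'q \<Rightarrow> 'e set"
  where "normal_vectors B A \<iota> g q = {N. \<forall>a. g (\<iota> q) N (differential B A \<iota> q a) = 0}"

definition normal_part ::
    "('q, 'f::euclidean_space) chart set \<Rightarrow> ('p, 'e::euclidean_space) chart set \<Rightarrow> ('q \<Rightarrow> 'p) \<Rightarrow>
     ('p \<Rightarrow> 'e \<Rightarrow> 'e \<Rightarrow> real) \<Rightarrow> 'q \<Rightarrow> 'e \<Rightarrow> 'e"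
  where "normal_part B A \<iota> g q w =
    (THE N. N \<in> normal_vectors B A \<iota> g q \<and> w - N \<in> range (differential B A \<iota> q))"

definition C_totally_real ::
    "('q, 'f::euclidean_space) chart set \<Rightarrow> ('p, 'e::euclidean_space) chart set \<Rightarrow> ('q \<Rightarrow> 'p) \<Rightarrow>
     ('p \<Rightarrow> 'e \<Rightarrow> 'e \<Rightarrow> real) \<Rightarrow> ('p \<Rightarrow> 'e) \<Rightarrow> bool"
  where "C_totally_real B A \<iota> g \<xi> \<longleftrightarrow> (\<forall>q. \<xi> (\<iota> q) \<in> normal_vectors B A \<iota> g q)"

text \<open>\<open>\<sigma>(X,Y)\<close> is the normal part of the ambient Levi-Civita derivative of \<open>Y\<close> in direction \<open>X\<close>. Here
  \<open>Y\<close> is extended to the field on \<open>M\<close> with constant components \<open>b\<close>; its image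
  \<open>y \<mapsto> deriv_at F y b\<close> is a vector field along the local expression \<open>F\<close> of the immersion, and
  \<open>ambient_deriv\<close> is its covariant derivative along \<open>F\<close>.\<close>

definition ambient_deriv ::
    "('q, 'f::euclidean_space) chart set \<Rightarrow> ('p, 'e::euclidean_space) chart set \<Rightarrow> ('q \<Rightarrow> 'p) \<Rightarrow>
     ('p \<Rightarrow> 'e \<Rightarrow> 'e \<Rightarrow> real) \<Rightarrow> 'q \<Rightarrow> 'f \<Rightarrow> 'f \<Rightarrow> 'e"
  where "ambient_deriv B A \<iota> g q a b =
    (let F = local_map B A \<iota> q; x = coord (chart_at B q) q in
       deriv_at (\<lambda>y. deriv_at F y b) x a
       + christoffel (metric_rep A (chart_at A (\<iota> q)) g) (F x) (deriv_at F x a) (deriv_at F x b))"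

definition second_fundamental_form ::
    "('q, 'f::euclidean_space) chart set \<Rightarrow> ('p, 'e::euclidean_space) chart set \<Rightarrow> ('q \<Rightarrow> 'p) \<Rightarrow>
     ('p \<Rightarrow> 'e \<Rightarrow> 'e \<Rightarrow> real) \<Rightarrow> 'q \<Rightarrow> 'f \<Rightarrow> 'f \<Rightarrow> 'e"
  where "second_fundamental_form B A \<iota> g q a b =
    normal_part B A \<iota> g q (ambient_deriv B A \<iota> g q a b)"

definition shape_operator ::
    "('q, 'f::euclidean_space) chart set \<Rightarrow> ('p, 'e::euclidean_space) chart set \<Rightarrow> ('q \<Rightarrow> 'p) \<Rightarrow>
     ('p \<Rightarrow> 'e \<Rightarrow> 'e \<Rightarrow> real) \<Rightarrow> 'q \<Rightarrow> 'e \<Rightarrow> 'f \<Rightarrow> 'f"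
  where "shape_operator B A \<iota> g q N a = (THE s. \<forall>b.
    induced_metric B A \<iota> g q s b = g (\<iota> q) (second_fundamental_form B A \<iota> g q a b) N)"

definition mean_curvature ::
    "('q, 'f::euclidean_space) chart set \<Rightarrow> ('p, 'e::euclidean_space) chart set \<Rightarrow> ('q \<Rightarrow> 'p) \<Rightarrow>
     ('p \<Rightarrow> 'e \<Rightarrow> 'e \<Rightarrow> real) \<Rightarrow> 'q \<Rightarrow> 'e"
  where "mean_curvature B A \<iota> g q =
    (let e = (SOME e. onb (induced_metric B A \<iota> g q) UNIV {1..DIM('f)} e) in
       (1 / real DIM('f)) *\<^sub>R (\<Sum>i\<in>{1..DIM('f)}. second_fundamental_form B A \<iota> g q (e i) (e i)))"

definition matrix_form :: "nat \<Rightarrow> (nat \<Rightarrow> 'v::real_vector) \<Rightarrow> ('v \<Rightarrow> 'v) \<Rightarrow> (nat \<Rightarrow> nat \<Rightarrow> real) \<Rightarrow> bool"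
  where "matrix_form n e T Q \<longleftrightarrow> (\<forall>j\<in>{1..n}. T (e j) = (\<Sum>i\<in>{1..n}. Q i j *\<^sub>R e i))"

definition matrix_ab :: "real \<Rightarrow> real \<Rightarrow> nat \<Rightarrow> nat \<Rightarrow> real"
  where "matrix_ab a b i j =
    (if i \<noteq> j then 0 else if i = 1 then a else if i = 2 then b else a + b)"

definition matrix_cd :: "real \<Rightarrow> real \<Rightarrow> nat \<Rightarrow> nat \<Rightarrow> real"
  where "matrix_cd c d i j =
    (if (i, j) = (1, 1) then c else if (i, j) = (2, 2) then - c
     else if (i, j) = (1, 2) \<or> (i, j) = (2, 1) then d else 0)"

end

theory Submission
  imports Defs
begin

text \<open>The hypothesis \<open>f\<^sub>3 = f\<^sub>1 - 1\<close> gives \<open>R(X,\<xi>)\<xi> = X - \<eta>(X)\<xi> + (f\<^sub>4 - f\<^sub>6)hX\<close>. The field \<open>\<xi>\<close> is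
  geodesic and \<open>\<nabla>\<xi> = -\<phi> + P\<close> with \<open>P\<close> self-adjoint, \<open>h = -P\<phi>\<close> and \<open>tr P = tr h = 0\<close>, so the trace
  of its Riccati equation (Raychaudhuri's equation) reads \<open>2m = 2m - tr P\<^sup>2\<close>. Hence \<open>P = 0\<close>, \<open>h = 0\<close> and
  \<open>\<nabla>\<xi> = -\<phi>\<close>. Since \<open>d\<eta>\<close> vanishes on \<open>M\<close>, tangent vectors satisfy \<open>\<langle>X,\<phi>Y\<rangle> = 0\<close>; therefore
  \<open>A\<^sub>\<xi> = 0\<close>, and of the ambient curvature only \<open>f\<^sub>1R\<^sub>1\<close> survives in the Gauss equation.

  For an orthonormal basis \<open>e\<close> of the tangent space, the bound minus \<open>\<tau> - K(e\<^sub>1 \<and> e\<^sub>2)\<close> is then a sum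
  of squares in the entries of the shape operators of an orthonormal normal frame, and it vanishes
  iff every shape operator is the sum of a \<open>2 \<times> 2\<close> block and of the trace of that block times the
  identity. Choosing \<open>e\<^sub>1, e\<^sub>2\<close> in a plane which minimizes \<open>K\<close> (it exists by compactness), \<open>e\<^sub>n\<^sub>+\<^sub>1\<close>
  parallel to \<open>H\<close>, and rotating \<open>e\<^sub>1, e\<^sub>2\<close> so as to diagonalize the block of \<open>A\<^sub>n\<^sub>+\<^sub>1\<close> gives the
  matrix forms.\<close>

section \<open>Inner products on a Euclidean space\<close>

text \<open>The terms with \<open>f4\<close>, \<open>f5\<close>, \<open>f6\<close> put
  \<open>h\<close> on tangent vectors into the Gauss equation, so \<open>h = 0\<close> has to be
  settled before any curvature of \<open>M\<close> is estimated. A trace can settle it because the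
  one uncontrolled coefficient, \<open>f4 - f6\<close>, multiplies the traceless \<open>h\<close>.
  Constants of the bound: \<open>(n+1)(n-2)/2 = n(n-1)/2 - 1\<close> counts the coordinate planes
  other than \<open>e\<^sub>1 \<and> e\<^sub>2\<close>. The factor \<open>(n-2)/(2(n-1))\<close>,
  which multiplies \<open>n\<^sup>2 |H|\<^sup>2\<close>, is the least \<open>c\<close> such that the
  sum of all \<open>a\<^sub>i a\<^sub>j\<close> with \<open>i < j\<close>, minus
  \<open>a\<^sub>1 a\<^sub>2\<close>, is at most \<open>c\<close> times the square of the sum of the
  \<open>a\<^sub>i\<close>; it is attained when \<open>a\<^sub>1 + a\<^sub>2\<close> equals each
  further \<open>a\<^sub>i\<close>. The obstacle is that a tangent space is identified with the
  model space by a chart that may change from point to point, whereas the arguments differentiate.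
  They therefore run in one fixed chart, with an abstract inner product at each point of an open
  set, and return to the manifold only at the point that selected the chart, where all conversions
  are the identity.\<close>

locale inner_prod =
  fixes G :: "'v::euclidean_space \<Rightarrow> 'v \<Rightarrow> real"
  assumes bil: "bilinear G"
    and commute: "G u v = G v u"
    and pos: "u \<noteq> 0 \<Longrightarrow> 0 < G u u"
begin

lemma lin_left: "linear (\<lambda>u. G u v)" and lin_right: "linear (G u)"
  using bil by (auto simp: bilinear_def)

lemma G_simps:
  "G (u + v) w = G u w + G v w" "G w (u + v) = G w u + G w v"
  "G (u - v) w = G u w - G v w" "G w (u - v) = G w u - G w v"
  "G (c *\<^sub>R u) w = c * G u w" "G w (c *\<^sub>R u) = c * G w u"
  "G (- u) w = - G u w" "G w (- u) = - G w u" "G 0 w = 0" "G w 0 = 0"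
  using linear_add[OF lin_left] linear_add[OF lin_right] linear_diff[OF lin_left]
    linear_diff[OF lin_right] linear_cmul[OF lin_left] linear_cmul[OF lin_right]
    linear_neg[OF lin_left] linear_neg[OF lin_right] linear_0[OF lin_left] linear_0[OF lin_right]
  by simp_all

lemma G_sum_left: "G (\<Sum>i\<in>I. f i) w = (\<Sum>i\<in>I. G (f i) w)"
  by (rule linear_sum[OF lin_left])

lemma G_sum_right: "G w (\<Sum>i\<in>I. f i) = (\<Sum>i\<in>I. G w (f i))"
  by (rule linear_sum[OF lin_right])

lemma nonneg: "0 \<le> G u u"
  using pos[of u] by (cases "u = 0") (auto simp: G_simps)

lemma eq_0_iff: "G u u = 0 \<longleftrightarrow> u = 0"
  using pos[of u] by (cases "u = 0") (auto simp: G_simps)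

lemma nondeg: "(\<And>z. G u z = G v z) \<Longrightarrow> u = v"
  by (metis G_simps(3) eq_0_iff right_minus_eq)

text \<open>Riesz representation: nondegeneracy makes the Gram map \<open>L\<close> injective, and
  equality of dimensions makes it surjective. Unique existence is what the definite descriptions in
  \<open>christoffel\<close> and \<open>shape_operator\<close> require.\<close>

lemma representable:
  assumes "linear f"
  shows "\<exists>!w. \<forall>z. G w z = f z"
proof (rule ex_ex1I)
  define L where "L w = (\<Sum>b\<in>Basis. G w b *\<^sub>R b)" for w
  have L: "linear L"
    by (rule linearI) (auto simp: L_def G_simps sum.distrib scaleR_add_left scaleR_sum_right)
  have Lb: "L w \<bullet> b = G w b" if "b \<in> Basis" for w b
    using that by (simp add: L_def)
  have eqI: "h = h'" if "linear h" "linear h'" "\<And>b. b \<in> Basis \<Longrightarrow> h b = h' b"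
    for h h' :: "'v \<Rightarrow> real"
    using linear_eq_stdbasis[OF that] .
  have "inj L"
  proof (rule injI)
    fix u v assume "L u = L v"
    then have "G u b = G v b" if "b \<in> Basis" for b using Lb[OF that] by metis
    then have "G u = G v" by (intro eqI lin_right) auto
    then show "u = v" by (intro nondeg) simp
  qed
  then have "surj L" using linear_injective_imp_surjective[OF L] by simp
  then obtain w where w: "L w = (\<Sum>b\<in>Basis. f b *\<^sub>R b)" by (metis surjD)
  have "G w b = f b" if "b \<in> Basis" for b
    using that Lb[OF that, of w] unfolding w by simp
  then have "G w = f" by (intro eqI lin_right assms) auto
  then show "\<exists>w. \<forall>z. G w z = f z" by auto
next
  fix v w assume "\<forall>z. G v z = f z" "\<forall>z. G w z = f z"
  then show "v = w" by (intro nondeg) simp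
qed

text \<open>\<open>onb\<close> without its spanning condition, so that partial frames can be handled
  before they are completed.\<close>

definition orthonormal_on :: "nat set \<Rightarrow> (nat \<Rightarrow> 'v) \<Rightarrow> bool"
  where "orthonormal_on I e \<longleftrightarrow> (\<forall>i\<in>I. \<forall>j\<in>I. G (e i) (e j) = (if i = j then 1 else 0))"

lemma onb_iff: "onb G V I e \<longleftrightarrow> orthonormal_on I e \<and> span (e ` I) = V"
  by (simp add: onb_def orthonormal_on_def)

lemma orthonormal_onD:
  "orthonormal_on I e \<Longrightarrow> i \<in> I \<Longrightarrow> j \<in> I \<Longrightarrow> G (e i) (e j) = (if i = j then 1 else 0)"
  by (simp add: orthonormal_on_def)

lemma orthonormal_on_subset: "orthonormal_on I e \<Longrightarrow> J \<subseteq> I \<Longrightarrow> orthonormal_on J e"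
  unfolding orthonormal_on_def by blast

lemma coeff_sum:
  assumes "orthonormal_on I e" "finite I" "k \<in> I"
  shows "G (\<Sum>i\<in>I. c i *\<^sub>R e i) (e k) = c k"
proof -
  have "G (\<Sum>i\<in>I. c i *\<^sub>R e i) (e k) = (\<Sum>i\<in>I. if k = i then c i else 0)"
    unfolding G_sum_left using assms by (intro sum.cong) (auto simp: G_simps orthonormal_on_def)
  then show ?thesis using assms by simp
qed

text \<open>The vectors fixed by the orthogonal projection \<open>P\<close> form a subspace that
  contains every \<open>e k\<close>.\<close>

lemma expand:
  assumes o: "orthonormal_on I e" and I: "finite I" and v: "v \<in> span (e ` I)"
  shows "v = (\<Sum>i\<in>I. G v (e i) *\<^sub>R e i)"
  using v
proof (induction rule: span_induct)
  case base
  define P where "P x = (\<Sum>i\<in>I. G x (e i) *\<^sub>R e i)" for x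
  have "linear P"
    by (rule linearI) (simp_all add: P_def G_simps scaleR_add_left sum.distrib scaleR_sum_right)
  then have "subspace {x. x = P x}"
    by (auto simp: subspace_def linear_0 linear_add linear_cmul)
  then show ?case by (simp add: P_def)
next
  case (step x)
  then obtain k where k: "k \<in> I" "x = e k" by auto
  have "(\<Sum>i\<in>I. G x (e i) *\<^sub>R e i) = (\<Sum>i\<in>I. if k = i then e i else 0)"
    using o k by (intro sum.cong) (auto simp: orthonormal_on_def)
  then show ?case using k I by simp
qed

lemma parseval:
  assumes "orthonormal_on I e" "finite I" "v \<in> span (e ` I)"
  shows "G v w = (\<Sum>i\<in>I. G v (e i) * G w (e i))"
  by (subst expand[OF assms]) (simp add: G_sum_left G_simps commute[of w])

lemma orthonormal_independent:
  assumes "orthonormal_on I e" "finite I"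
  shows "inj_on e I" "independent (e ` I)"
proof -
  show inj: "inj_on e I"
  proof (rule inj_onI)
    fix i j assume *: "i \<in> I" "j \<in> I" "e i = e j"
    show "i = j"
    proof (rule ccontr)
      assume "i \<noteq> j"
      then have "G (e i) (e j) = 0" "G (e i) (e i) = 1"
        using orthonormal_onD[OF assms(1) *(1) *(2)] orthonormal_onD[OF assms(1) *(1) *(1)] by auto
      then show False using * by simp
    qed
  qed
  show "independent (e ` I)"
  proof
    assume "dependent (e ` I)"
    then obtain k where k: "k \<in> I" "e k \<in> span (e ` I - {e k})" unfolding dependent_def by auto
    have "e ` I - {e k} = e ` (I - {k})" using inj k by (auto simp: inj_on_def)
    then have "e k \<in> span (e ` (I - {k}))" using k by simp
    then have "e k = (\<Sum>i\<in>I - {k}. G (e k) (e i) *\<^sub>R e i)"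
      using assms by (intro expand orthonormal_on_subset[OF assms(1)]) auto
    also have "\<dots> = 0" using k orthonormal_onD[OF assms(1)] by (intro sum.neutral) auto
    finally show False using orthonormal_onD[OF assms(1) k(1) k(1)] by (simp add: G_simps)
  qed
qed

lemma orthonormal_dim:
  assumes "orthonormal_on I e" "finite I"
  shows "dim (span (e ` I)) = card I"
  using orthonormal_independent[OF assms]
  by (metis dim_span card_image dim_eq_card_independent)

text \<open>Gram-Schmidt, by induction on the number of indices still unassigned. The prescribed
  indices may lie anywhere in \<open>I\<close>: tangent frames prescribe 1 and 2, normal frames the
  two ends of \<open>{n+1..2*m+1}\<close>.\<close>

lemma onb_extend:
  assumes "subspace V" "finite I" "card I = dim V" "J \<subseteq> I" "orthonormal_on J e" "e ` J \<subseteq> V"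
  shows "\<exists>e'. (\<forall>j\<in>J. e' j = e j) \<and> onb G V I e'"
  using assms
proof (induction "card (I - J)" arbitrary: J e)
  case 0
  then have J: "J = I" using finite_subset by auto
  have "span (e ` I) = V"
  proof (rule subspace_dim_equal)
    show "span (e ` I) \<subseteq> V" using 0 J by (simp add: span_minimal)
    show "dim V \<le> dim (span (e ` I))" using 0 J by (simp only: orthonormal_dim)
  qed (use 0 in auto)
  then show ?case using 0 J by (auto simp: onb_iff)
next
  case (Suc k)
  have fJ: "finite J" using Suc.prems finite_subset by blast
  obtain l where l: "l \<in> I" "l \<notin> J" using Suc.hyps(2)
    by (metis DiffE card.empty ex_in_conv nat.distinct(1))
  have "card J < card I" using l Suc.prems by (intro psubset_card_mono) auto
  then have "dim (span (e ` J)) < dim V" using orthonormal_dim Suc.prems fJ by simp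
  moreover have "dim V \<le> dim (span (e ` J))" if "V \<subseteq> span (e ` J)"
    using that by (rule dim_subset)
  ultimately obtain v where v: "v \<in> V" "v \<notin> span (e ` J)" by force
  define p where "p = (\<Sum>i\<in>J. G v (e i) *\<^sub>R e i)"
  have p: "p \<in> span (e ` J)" unfolding p_def by (intro span_sum span_scale span_base) auto
  have pV: "p \<in> V" using p Suc.prems span_minimal by blast
  have vp: "v - p \<noteq> 0" using p v by auto
  have ort: "G (v - p) (e j) = 0" if "j \<in> J" for j
    using coeff_sum[of J e j "\<lambda>i. G v (e i)"] that fJ Suc.prems unfolding p_def
    by (simp add: G_simps)
  define w where "w = (1 / sqrt (G (v - p) (v - p))) *\<^sub>R (v - p)"
  have w1: "G w w = 1" using pos[OF vp] by (simp add: w_def G_simps(5,6) del: G_simps(3,4))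
  have w0: "G w (e j) = 0" if "j \<in> J" for j
    using ort[OF that] by (simp add: w_def G_simps(5))
  have wV: "w \<in> V" unfolding w_def
    using Suc.prems v pV by (intro subspace_scale subspace_diff) auto
  define e1 where "e1 = e(l := w)"
  have "orthonormal_on (insert l J) e1"
    unfolding orthonormal_on_def
  proof (intro ballI)
    fix i j assume ij: "i \<in> insert l J" "j \<in> insert l J"
    show "G (e1 i) (e1 j) = (if i = j then 1 else 0)"
      using ij l orthonormal_onD[OF Suc.prems(5), of i j]
      by (cases "i = l"; cases "j = l") (auto simp: e1_def w0 w1 commute[of "e i" w])
  qed
  moreover have "e1 ` insert l J \<subseteq> V" using wV Suc.prems(6) l by (auto simp: e1_def)
  moreover have "k = card (I - insert l J)"
  proof -
    have "I - insert l J = (I - J) - {l}" by auto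
    then show ?thesis using Suc.hyps(2) l by simp
  qed
  ultimately obtain e' where e': "\<forall>j\<in>insert l J. e' j = e1 j" "onb G V I e'"
    using Suc.hyps(1)[of "insert l J" e1] Suc.prems l by auto
  then show ?case using l by (intro exI[of _ e']) (auto simp: e1_def)
qed

lemma onb_exists:
  assumes "subspace V" "finite I" "card I = dim V"
  shows "\<exists>e. onb G V I e"
  using onb_extend[OF assms, of "{}" undefined] by (auto simp: orthonormal_on_def)

lemma complement_span:
  assumes e: "onb G UNIV I e" and I: "finite I" and J: "J \<subseteq> I"
  shows "{v. \<forall>j\<in>J. G v (e j) = 0} = span (e ` (I - J))"
proof safe
  fix v assume v: "\<forall>j\<in>J. G v (e j) = 0"
  have "v = (\<Sum>i\<in>I. G v (e i) *\<^sub>R e i)"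
    using e I by (intro expand) (auto simp: onb_iff)
  also have "\<dots> = (\<Sum>i\<in>I - J. G v (e i) *\<^sub>R e i)"
    using v I by (intro sum.mono_neutral_right) auto
  finally show "v \<in> span (e ` (I - J))" by (metis (no_types, lifting) imageI span_base span_scale span_sum)
next
  fix v j assume v: "v \<in> span (e ` (I - J))" and j: "j \<in> J"
  show "G v (e j) = 0" using v
  proof (induction rule: span_induct)
    case base show ?case by (auto simp: subspace_def G_simps)
  next
    case (step x) then show ?case using e j J by (auto simp: onb_iff orthonormal_on_def)
  qed
qed

text \<open>Subtracting the projection gives existence; a difference of two candidates lies in
  \<open>V\<close> and is orthogonal to \<open>V\<close>. This justifies the definite description in
  \<open>normal_part\<close>.\<close>

lemma orthogonal_decomposition:
  assumes V: "subspace V"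
  shows "\<exists>!N. (\<forall>v\<in>V. G N v = 0) \<and> w - N \<in> V"
proof (rule ex_ex1I)
  obtain e where e: "onb G V {1..dim V} e" using onb_exists[OF V, of "{1..dim V}"] by auto
  define p where "p = (\<Sum>i\<in>{1..dim V}. G w (e i) *\<^sub>R e i)"
  have eV: "e i \<in> V" if "i \<in> {1..dim V}" for i using e that span_base[of "e i" "e ` {1..dim V}"] by (simp add: onb_iff)
  have p: "p \<in> V" unfolding p_def using V eV by (intro subspace_sum subspace_scale) auto
  have "G (w - p) v = 0" if "v \<in> V" for v
  proof -
    have "v = (\<Sum>i\<in>{1..dim V}. G v (e i) *\<^sub>R e i)"
      using e that by (intro expand) (auto simp: onb_iff)
    moreover have "G (w - p) (e i) = 0" if "i \<in> {1..dim V}" for i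
      using coeff_sum[of "{1..dim V}" e i "\<lambda>i. G w (e i)"] e that
      by (simp add: p_def G_simps onb_iff)
    ultimately show ?thesis by (metis (mono_tags, lifting) G_simps(6) G_sum_right mult_zero_right sum.neutral)
  qed
  then show "\<exists>N. (\<forall>v\<in>V. G N v = 0) \<and> w - N \<in> V"
    using p by (intro exI[of _ "w - p"]) auto
next
  fix N N' assume N: "(\<forall>v\<in>V. G N v = 0) \<and> w - N \<in> V" "(\<forall>v\<in>V. G N' v = 0) \<and> w - N' \<in> V"
  then have "(w - N') - (w - N) \<in> V" using V subspace_diff by blast
  then have "N - N' \<in> V" by simp
  then have "G (N - N') (N - N') = 0" using N by (simp add: G_simps(3))
  then show "N = N'" using eq_0_iff by simp
qed

text \<open>Expanding one argument in the other frame, from either side, leads to the same double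
  sum. Vector values are allowed so that the trace of the second fundamental form is
  covered.\<close>

lemma onb_trace_eq:
  fixes M :: "'v \<Rightarrow> 'v \<Rightarrow> 'w::real_vector"
  assumes e: "onb G UNIV I e" "finite I" and e': "onb G UNIV J e'" "finite J"
    and M1: "\<And>v. linear (\<lambda>u. M u v)" and M2: "\<And>u. linear (M u)"
  shows "(\<Sum>i\<in>I. M (e i) (e i)) = (\<Sum>j\<in>J. M (e' j) (e' j))"
proof -
  have ex: "v = (\<Sum>i\<in>I. G v (e i) *\<^sub>R e i)" for v
    using e by (intro expand) (auto simp: onb_iff)
  have ex': "v = (\<Sum>i\<in>J. G v (e' i) *\<^sub>R e' i)" for v
    using e' by (intro expand) (auto simp: onb_iff)
  have "(\<Sum>i\<in>I. M (e i) (e i)) = (\<Sum>i\<in>I. \<Sum>j\<in>J. G (e i) (e' j) *\<^sub>R M (e i) (e' j))"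
  proof (intro sum.cong refl)
    fix i
    have "M (e i) (e i) = M (e i) (\<Sum>j\<in>J. G (e i) (e' j) *\<^sub>R e' j)" using ex'[of "e i"] by simp
    then show "M (e i) (e i) = (\<Sum>j\<in>J. G (e i) (e' j) *\<^sub>R M (e i) (e' j))"
      by (simp add: linear_sum[OF M2] linear_cmul[OF M2])
  qed
  also have "\<dots> = (\<Sum>j\<in>J. \<Sum>i\<in>I. G (e' j) (e i) *\<^sub>R M (e i) (e' j))"
    by (subst sum.swap) (simp add: commute)
  also have "\<dots> = (\<Sum>j\<in>J. M (e' j) (e' j))"
  proof (intro sum.cong refl)
    fix j
    have "M (e' j) (e' j) = M (\<Sum>i\<in>I. G (e' j) (e i) *\<^sub>R e i) (e' j)" using ex[of "e' j"] by simp
    then show "(\<Sum>i\<in>I. G (e' j) (e i) *\<^sub>R M (e i) (e' j)) = M (e' j) (e' j)"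
      by (simp add: linear_sum[OF M1] linear_cmul[OF M1])
  qed
  finally show ?thesis .
qed

end

section \<open>Traces of endomorphisms\<close>

text \<open>A trace does not depend on the metric. Computing it in the fixed \<open>Basis\<close>
  lets traces of tensor fields be differentiated without any orthonormal frame field.\<close>

definition trace_on :: "('v::euclidean_space \<Rightarrow> 'v) \<Rightarrow> real"
  where "trace_on f = (\<Sum>b\<in>Basis. f b \<bullet> b)"

lemma trace_on_add: "trace_on (\<lambda>u. f u + f' u) = trace_on f + trace_on f'"
  and trace_on_diff: "trace_on (\<lambda>u. f u - f' u) = trace_on f - trace_on f'"
  and trace_on_scaleR: "trace_on (\<lambda>u. c *\<^sub>R f u) = c * trace_on f"
  and trace_on_minus: "trace_on (\<lambda>u. - f u) = - trace_on f"
  by (simp_all add: trace_on_def inner_add_left inner_diff_left sum.distrib sum_subtractf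
      sum_distrib_left sum_negf)

lemma trace_on_ident: "trace_on (\<lambda>u::'v::euclidean_space. u) = DIM('v)"
  by (simp add: trace_on_def)

lemma trace_on_rank_one: "linear f \<Longrightarrow> trace_on (\<lambda>u. f u *\<^sub>R v) = f v"
  by (subst (2) euclidean_representation[of v, symmetric])
    (simp only: linear_sum linear_cmul trace_on_def inner_scaleR_left real_scaleR_def mult.commute)

lemma trace_on_cyclic:
  fixes f f' :: "'v::euclidean_space \<Rightarrow> 'v"
  assumes "linear f" "linear f'"
  shows "trace_on (\<lambda>u. f (f' u)) = trace_on (\<lambda>u. f' (f u))"
proof -
  have *: "trace_on (\<lambda>u. f (f' u)) = (\<Sum>b\<in>Basis. \<Sum>c\<in>Basis. (f' b \<bullet> c) * (f c \<bullet> b))"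
    if "linear f" for f f' :: "'v \<Rightarrow> 'v"
    unfolding trace_on_def
  proof (intro sum.cong refl)
    fix b
    have "f (f' b) = f (\<Sum>c\<in>Basis. (f' b \<bullet> c) *\<^sub>R c)" by (simp add: euclidean_representation)
    also have "\<dots> = (\<Sum>c\<in>Basis. (f' b \<bullet> c) *\<^sub>R f c)" using that by (simp add: linear_sum linear_cmul)
    finally show "f (f' b) \<bullet> b = (\<Sum>c\<in>Basis. (f' b \<bullet> c) * (f c \<bullet> b))" by (simp add: inner_sum_left)
  qed
  show ?thesis unfolding *[OF assms(1)] *[OF assms(2)] by (subst sum.swap) (simp add: mult.commute)
qed

context inner_prod
begin

lemma trace_on_onb:
  assumes e: "onb G UNIV I e" "finite I" and f: "linear f"
  shows "trace_on f = (\<Sum>i\<in>I. G (f (e i)) (e i))"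
proof -
  have "f b \<bullet> b = (\<Sum>i\<in>I. G b (e i) * (f (e i) \<bullet> b))" for b
  proof -
    have "b = (\<Sum>i\<in>I. G b (e i) *\<^sub>R e i)"
      using e by (intro expand) (auto simp: onb_iff)
    then have "f b = f (\<Sum>i\<in>I. G b (e i) *\<^sub>R e i)" by (rule arg_cong)
    then show ?thesis using f by (simp add: linear_sum linear_cmul inner_sum_left)
  qed
  then have "trace_on f = (\<Sum>i\<in>I. \<Sum>b\<in>Basis. (f (e i) \<bullet> b) * G b (e i))"
    unfolding trace_on_def by (subst sum.swap) (simp add: mult.commute)
  also have "\<dots> = (\<Sum>i\<in>I. G (\<Sum>b\<in>Basis. (f (e i) \<bullet> b) *\<^sub>R b) (e i))"
    by (simp only: G_sum_left G_simps)
  finally show ?thesis by (simp add: euclidean_representation)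
qed

lemma onb_UNIV_exists: "\<exists>e. onb G UNIV {1..DIM('v)} e"
  by (intro onb_exists) auto

lemma trace_on_skew:
  assumes "linear f" "\<And>u v. G u (f v) = - G (f u) v"
  shows "trace_on f = 0"
proof -
  obtain e where e: "onb G UNIV {1..DIM('v)} e" using onb_UNIV_exists by auto
  have "G (f u) u = 0" for u using assms(2)[of u u] commute[of u "f u"] by simp
  then show ?thesis using trace_on_onb[OF e _ assms(1)] by simp
qed

text \<open>In an orthonormal frame the trace of the square is the sum of the
  \<open>|f (e i)|\<^sup>2\<close>. This is how a scalar equation can annihilate a whole
  tensor.\<close>

lemma trace_on_square_symmetric:
  assumes f: "linear f" "\<And>u v. G u (f v) = G (f u) v" and t: "trace_on (\<lambda>u. f (f u)) = 0"
  shows "f u = 0"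
proof -
  obtain e where e: "onb G UNIV {1..DIM('v)} e" using onb_UNIV_exists by auto
  have "trace_on (\<lambda>u. f (f u)) = (\<Sum>i\<in>{1..DIM('v)}. G (f (e i)) (f (e i)))"
    using trace_on_onb[OF e _ linear_compose[OF f(1) f(1), unfolded o_def]] by (simp add: f(2))
  then have "\<forall>i\<in>{1..DIM('v)}. G (f (e i)) (f (e i)) = 0"
    using t by (subst sum_nonneg_eq_0_iff[symmetric]) (auto simp: nonneg)
  then have z: "f (e i) = 0" if "i \<in> {1..DIM('v)}" for i using that eq_0_iff by blast
  have "u = (\<Sum>i\<in>{1..DIM('v)}. G u (e i) *\<^sub>R e i)"
    using e by (intro expand) (auto simp: onb_iff)
  then have "f u = f (\<Sum>i\<in>{1..DIM('v)}. G u (e i) *\<^sub>R e i)" by (rule arg_cong)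
  also have "\<dots> = 0" using z f by (simp add: linear_sum linear_cmul)
  finally show ?thesis .
qed

end

section \<open>Calculus on open sets\<close>

lemma smooth_on_differentiable: "smooth_on S f \<Longrightarrow> x \<in> S \<Longrightarrow> f differentiable (at x)"
  unfolding smooth_on_def using Ck_on.simps(2)[of 0 S f] by blast

lemma smooth_on_deriv: "smooth_on S f \<Longrightarrow> smooth_on S (\<lambda>x. deriv_at f x v)"
  unfolding smooth_on_def using Ck_on.simps(2)[of _ S f] by blast

lemma deriv_at_eqI: "(f has_derivative D) (at x) \<Longrightarrow> deriv_at f x = D"
  by (rule frechet_derivative_at[symmetric])

lemma has_derivative_deriv_at: "f differentiable (at x) \<Longrightarrow> (f has_derivative deriv_at f x) (at x)"
  by (simp add: frechet_derivative_works)

lemma has_derivative_transform_nhds: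
  assumes "eventually (\<lambda>y. f y = f' y) (nhds x)" "(f has_derivative D) (at x)"
  shows "(f' has_derivative D) (at x)"
proof -
  obtain T where T: "open T" "x \<in> T" "\<And>y. y \<in> T \<Longrightarrow> f y = f' y"
    using assms(1) unfolding eventually_nhds by blast
  show ?thesis by (rule has_derivative_transform_within_open[OF assms(2) T])
qed

lemma deriv_at_transform_eventually:
  assumes "eventually (\<lambda>y. f y = f' y) (nhds x)" "f differentiable (at x)"
  shows "deriv_at f x = deriv_at f' x"
  using has_derivative_transform_nhds[OF assms(1) has_derivative_deriv_at[OF assms(2)]]
  by (simp add: deriv_at_eqI)

lemma differentiable_transform_eventually:
  assumes "eventually (\<lambda>y. f y = f' y) (nhds x)" "f differentiable (at x)"
  shows "f' differentiable (at x)"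
  using has_derivative_transform_nhds[OF assms(1) has_derivative_deriv_at[OF assms(2)]]
  by (rule differentiableI)

lemma eventually_nhds_open: "open S \<Longrightarrow> x \<in> S \<Longrightarrow> eventually (\<lambda>y. y \<in> S) (nhds x)"
  by (auto simp: eventually_nhds)

lemma differentiable_eventually_in:
  assumes "F differentiable (at x)" "open S" "F x \<in> S"
  shows "eventually (\<lambda>y. F y \<in> S) (nhds x)"
proof -
  have "filterlim F (nhds (F x)) (at x)"
    using differentiable_imp_continuous_within[OF assms(1)] by (simp add: isCont_def)
  then have "filterlim F (nhds (F x)) (nhds x)" by (rule tendsto_at_iff_tendsto_nhds[THEN iffD1])
  then show ?thesis using assms(2,3) by (rule topological_tendstoD)
qed

lemma deriv_at_const_0: "eventually (\<lambda>y. f y = c) (nhds x) \<Longrightarrow> deriv_at f x w = 0"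
  using has_derivative_transform_nhds[of "\<lambda>_. c" f x "\<lambda>_. 0"] by (simp add: eq_commute[of c] deriv_at_eqI)

text \<open>Young's argument: the second difference, divided by \<open>t\<^sup>2\<close>, tends to the second derivative
  and is symmetric in \<open>u\<close> and \<open>v\<close>.\<close>

lemma second_difference:
  fixes f :: "'a::real_normed_vector \<Rightarrow> real"
  assumes S: "open S" "x \<in> S" and f: "\<And>y. y \<in> S \<Longrightarrow> f differentiable (at y)"
    and g: "(\<lambda>y. deriv_at f y u) differentiable (at x)" and e: "e > 0"
  shows "\<exists>d>0. \<forall>t. 0 < t \<and> t < d \<longrightarrow>
    \<bar>f (x + t *\<^sub>R u + t *\<^sub>R v) - f (x + t *\<^sub>R u) - f (x + t *\<^sub>R v) + f x
      - t\<^sup>2 * deriv_at (\<lambda>y. deriv_at f y u) x v\<bar> \<le> e * t\<^sup>2"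
proof -
  define g where "g y = deriv_at f y u" for y
  define D where "D = deriv_at g x"
  have D: "(g has_derivative D) (at x)"
    using g has_derivative_deriv_at unfolding g_def[abs_def] D_def by blast
  \<comment> \<open>The two remainders below add up to at most \<open>e / K\<close> times
    \<open>t * (2 * (norm u + norm v))\<close>; the extra 1 keeps \<open>K\<close> positive when
    both vectors vanish.\<close>
  define K where "K = 2 * (norm u + norm v) + 1"
  have K: "K > 0" unfolding K_def by (intro add_nonneg_pos) auto
  have "bounded_linear D" using D by (rule has_derivative_bounded_linear)
  then have linD: "linear D" by (rule bounded_linear.linear)
  obtain d1 where d1: "d1 > 0" "\<And>y. norm (y - x) < d1 \<Longrightarrow> norm (g y - g x - D (y - x)) \<le> e / K * norm (y - x)"
    using D e K unfolding has_derivative_at_alt by (metis divide_pos_pos)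
  obtain d2 where d2: "d2 > 0" "ball x d2 \<subseteq> S" using S open_contains_ball by blast
  define d where "d = min d1 d2 / K"
  have d: "d > 0" using d1 d2 K by (simp add: d_def)
  show ?thesis
  proof (intro exI[of _ d] conjI d allI impI)
    fix t assume t: "0 < t \<and> t < d"
    have tK: "t * K < min d1 d2" using t K by (simp add: d_def field_simps)
    have near: "norm (s *\<^sub>R u + r *\<^sub>R v) < min d1 d2"
      if "0 \<le> s" "s \<le> t" "0 \<le> r" "r \<le> t" for s r
    proof -
      have "norm (s *\<^sub>R u + r *\<^sub>R v) \<le> s * norm u + r * norm v"
        using norm_triangle_ineq[of "s *\<^sub>R u" "r *\<^sub>R v"] that by simp
      also have "\<dots> \<le> t * norm u + t * norm v" using that by (intro add_mono mult_right_mono) auto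
      also have "\<dots> \<le> t * K" using t unfolding K_def by (simp add: algebra_simps)
      finally show ?thesis using tK by simp
    qed
    have inS: "x + s *\<^sub>R u + r *\<^sub>R v \<in> S" if "0 \<le> s" "s \<le> t" "0 \<le> r" "r \<le> t" for s r
      using near[OF that] d2(2) by (auto simp: dist_norm subset_iff add.assoc norm_minus_commute)
    define p where "p s = f (x + s *\<^sub>R u + t *\<^sub>R v) - f (x + s *\<^sub>R u)" for s
    have der: "((\<lambda>s. f (x + s *\<^sub>R u + r *\<^sub>R v)) has_derivative (\<lambda>h. h * g (x + s *\<^sub>R u + r *\<^sub>R v))) (at s)"
      if "0 \<le> s" "s \<le> t" "0 \<le> r" "r \<le> t" for s r
    proof -
      have 1: "((\<lambda>s. x + s *\<^sub>R u + r *\<^sub>R v) has_derivative (\<lambda>h. h *\<^sub>R u)) (at s)"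
        by (auto intro!: derivative_eq_intros)
      have fd: "f differentiable (at (x + s *\<^sub>R u + r *\<^sub>R v))" using f inS[OF that] by blast
      show ?thesis
        using diff_chain_at[OF 1 has_derivative_deriv_at[OF fd]] linear_frechet_derivative[OF fd]
        by (simp add: o_def linear_cmul g_def)
    qed
    have pd: "(p has_derivative (\<lambda>h. h * (g (x + s *\<^sub>R u + t *\<^sub>R v) - g (x + s *\<^sub>R u)))) (at s)"
      if "0 \<le> s" "s \<le> t" for s
      using has_derivative_diff[OF der[of s t] der[of s 0]] that t unfolding p_def[abs_def]
      by (simp add: algebra_simps)
    have "\<exists>s\<in>{0<..<t}. p t - p 0 = (t - 0) * (g (x + s *\<^sub>R u + t *\<^sub>R v) - g (x + s *\<^sub>R u))"
      using t pd by (intro mvt_simple) (auto intro: has_derivative_at_withinI)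
    then obtain s where s: "0 < s" "s < t"
      "p t - p 0 = (t - 0) * (g (x + s *\<^sub>R u + t *\<^sub>R v) - g (x + s *\<^sub>R u))"
      by auto
    \<comment> \<open>First-order Taylor remainders of \<open>g\<close> at \<open>x\<close>, taken
      at the two points that the mean value theorem compares; \<open>A - B\<close> is the whole
      error.\<close>
    define A where "A = g (x + s *\<^sub>R u + t *\<^sub>R v) - g x - D (s *\<^sub>R u + t *\<^sub>R v)"
    define B where "B = g (x + s *\<^sub>R u) - g x - D (s *\<^sub>R u)"
    have nA: "norm (s *\<^sub>R u + t *\<^sub>R v) \<le> t * (norm u + norm v)"
      using norm_triangle_ineq[of "s *\<^sub>R u" "t *\<^sub>R v"] s t mult_right_mono[of s t "norm u"]
      by (simp add: algebra_simps)
    have nB: "norm (s *\<^sub>R u) \<le> t * (norm u + norm v)"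
      using s t mult_right_mono[of s t "norm u"] by (simp add: algebra_simps) (smt (verit) mult_nonneg_nonneg norm_ge_zero)
    have eK: "0 \<le> e / K" using e K by simp
    have "\<bar>A\<bar> \<le> e / K * norm (s *\<^sub>R u + t *\<^sub>R v)"
      using d1(2)[of "x + s *\<^sub>R u + t *\<^sub>R v"] near[of s t] s t by (simp add: A_def add.assoc)
    also have "\<dots> \<le> e / K * (t * (norm u + norm v))" by (rule mult_left_mono[OF nA eK])
    finally have A: "\<bar>A\<bar> \<le> e / K * (t * (norm u + norm v))" .
    have "\<bar>B\<bar> \<le> e / K * norm (s *\<^sub>R u)"
      using d1(2)[of "x + s *\<^sub>R u"] near[of s 0] s t by (simp add: B_def)
    also have "\<dots> \<le> e / K * (t * (norm u + norm v))" by (rule mult_left_mono[OF nB eK])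
    finally have B: "\<bar>B\<bar> \<le> e / K * (t * (norm u + norm v))" .
    have "\<bar>A - B\<bar> \<le> 2 * (e / K * (t * (norm u + norm v)))" using A B by linarith
    also have "\<dots> = e / K * (t * (2 * (norm u + norm v)))" by simp
    also have "\<dots> \<le> e / K * (t * K)"
      using e K t by (intro mult_left_mono) (auto simp: K_def)
    also have "\<dots> = e * t" using K by simp
    finally have AB: "\<bar>A - B\<bar> \<le> e * t" .
    have "p t - p 0 = t * (A - B + t * D v)"
      using s(3) linear_add[OF linD] linear_cmul[OF linD] by (simp add: A_def B_def)
    then have "p t - p 0 - t\<^sup>2 * D v = t * (A - B)" by (simp add: power2_eq_square algebra_simps)
    moreover have "\<bar>t * (A - B)\<bar> = t * \<bar>A - B\<bar>" using t by (simp only: abs_mult abs_of_pos)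
    moreover have "t * \<bar>A - B\<bar> \<le> t * (e * t)" using AB t by (intro mult_left_mono) auto
    moreover have "t * (e * t) = e * t\<^sup>2" by (simp add: power2_eq_square)
    ultimately have "\<bar>p t - p 0 - t\<^sup>2 * D v\<bar> \<le> e * t\<^sup>2" by metis
    moreover have "p t - p 0 = f (x + t *\<^sub>R u + t *\<^sub>R v) - f (x + t *\<^sub>R u) - f (x + t *\<^sub>R v) + f x"
      by (simp add: p_def)
    ultimately show "\<bar>f (x + t *\<^sub>R u + t *\<^sub>R v) - f (x + t *\<^sub>R u) - f (x + t *\<^sub>R v) + f x
      - t\<^sup>2 * deriv_at (\<lambda>y. deriv_at f y u) x v\<bar> \<le> e * t\<^sup>2"
      by (simp only: D_def g_def[abs_def])
  qed
qed

lemma symmetric_second_derivative_real: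
  fixes f :: "'a::real_normed_vector \<Rightarrow> real"
  assumes S: "open S" "x \<in> S" and f: "\<And>y. y \<in> S \<Longrightarrow> f differentiable (at y)"
    and g: "\<And>u. (\<lambda>y. deriv_at f y u) differentiable (at x)"
  shows "deriv_at (\<lambda>y. deriv_at f y u) x v = deriv_at (\<lambda>y. deriv_at f y v) x u" (is "?l = ?r")
proof (rule ccontr)
  assume ne: "?l \<noteq> ?r"
  \<comment> \<open>Both derivatives lie within \<open>e\<close> of the same difference quotient,
    hence within \<open>2 * e\<close> of each other, which is half of their supposed
    distance.\<close>
  define e where "e = \<bar>?l - ?r\<bar> / 4"
  have e: "e > 0" using ne by (simp add: e_def)
  obtain d1 where d1: "d1 > 0" "\<And>t. 0 < t \<and> t < d1 \<Longrightarrow>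
    \<bar>f (x + t *\<^sub>R u + t *\<^sub>R v) - f (x + t *\<^sub>R u) - f (x + t *\<^sub>R v) + f x - t\<^sup>2 * ?l\<bar> \<le> e * t\<^sup>2"
    using second_difference[OF S f g e, of u v] by blast
  obtain d2 where d2: "d2 > 0" "\<And>t. 0 < t \<and> t < d2 \<Longrightarrow>
    \<bar>f (x + t *\<^sub>R v + t *\<^sub>R u) - f (x + t *\<^sub>R v) - f (x + t *\<^sub>R u) + f x - t\<^sup>2 * ?r\<bar> \<le> e * t\<^sup>2"
    using second_difference[OF S f g e, of v u] by blast
  define t where "t = min d1 d2 / 2"
  have t: "0 < t" "t < d1" "t < d2" using d1 d2 by (auto simp: t_def)
  have sw: "x + t *\<^sub>R v + t *\<^sub>R u = x + t *\<^sub>R u + t *\<^sub>R v" by simp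
  have "\<bar>t\<^sup>2 * ?l - t\<^sup>2 * ?r\<bar> \<le> 2 * (e * t\<^sup>2)"
    using d1(2)[of t] d2(2)[of t] t unfolding sw by linarith
  moreover have "\<bar>t\<^sup>2 * ?l - t\<^sup>2 * ?r\<bar> = t\<^sup>2 * \<bar>?l - ?r\<bar>"
    by (simp add: abs_mult flip: right_diff_distrib)
  ultimately have "t\<^sup>2 * \<bar>?l - ?r\<bar> \<le> t\<^sup>2 * (2 * e)" by (simp only: mult.left_commute mult.commute)
  then have "\<bar>?l - ?r\<bar> \<le> 2 * e" using t by simp
  then show False using e by (simp add: e_def)
qed

lemma deriv_at_inner:
  assumes "f differentiable (at x)"
  shows "deriv_at (\<lambda>y. f y \<bullet> b) x w = deriv_at f x w \<bullet> b"
proof -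
  have "((\<lambda>y. f y \<bullet> b) has_derivative (\<lambda>w. deriv_at f x w \<bullet> b)) (at x)"
    using has_derivative_inner_left[OF has_derivative_deriv_at[OF assms]] .
  then show ?thesis by (simp add: deriv_at_eqI)
qed

lemma symmetric_second_derivative:
  fixes f :: "'a::real_normed_vector \<Rightarrow> 'b::euclidean_space"
  assumes S: "open S" "x \<in> S" and f: "smooth_on S f"
  shows "deriv_at (\<lambda>y. deriv_at f y u) x v = deriv_at (\<lambda>y. deriv_at f y v) x u"
proof (rule euclidean_eqI)
  fix b :: 'b
  have fd: "f differentiable (at y)" if "y \<in> S" for y using smooth_on_differentiable[OF f that] .
  have gd: "(\<lambda>y. deriv_at f y u) differentiable (at x)" for u
    using smooth_on_differentiable[OF smooth_on_deriv[OF f]] S by blast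
  have ev: "eventually (\<lambda>y. deriv_at f y u \<bullet> b = deriv_at (\<lambda>y. f y \<bullet> b) y u) (nhds x)" for u
    using eventually_nhds_open[OF S] by eventually_elim (simp add: deriv_at_inner fd)
  have gdb: "(\<lambda>y. deriv_at f y u \<bullet> b) differentiable (at x)" for u using gd by simp
  have *: "deriv_at (\<lambda>y. deriv_at f y u) x v \<bullet> b = deriv_at (\<lambda>y. deriv_at (\<lambda>y. f y \<bullet> b) y u) x v" for u v
    using deriv_at_inner[OF gd, of u b v] deriv_at_transform_eventually[OF ev gdb, of u] by simp
  show "deriv_at (\<lambda>y. deriv_at f y u) x v \<bullet> b = deriv_at (\<lambda>y. deriv_at f y v) x u \<bullet> b"
    unfolding * using S fd differentiable_transform_eventually[OF ev gdb]
    by (intro symmetric_second_derivative_real[of S]) auto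
qed

section \<open>Derivatives of fields of linear maps and of metric duals\<close>

text \<open>A product rule that asks only for differentiability of \<open>L y u\<close> at each
  fixed \<open>u\<close>: expanding the argument in \<open>Basis\<close> reduces it to finitely many
  scalar products. It serves 1-forms, endomorphisms, metrics and Christoffel symbols alike.\<close>

lemma has_derivative_linear_family:
  fixes L :: "'m::real_normed_vector \<Rightarrow> 'a::euclidean_space \<Rightarrow> 'b::real_normed_vector"
  assumes L: "eventually (\<lambda>y. linear (L y)) (nhds x)"
    and Ld: "\<And>u. (\<lambda>y. L y u) differentiable (at x)"
    and X: "(X has_derivative X') (at x)"
  shows "((\<lambda>y. L y (X y)) has_derivative (\<lambda>w. deriv_at (\<lambda>y. L y (X x)) x w + L x (X' w))) (at x)"
proof -
  have exp: "L y u = (\<Sum>b\<in>Basis. (u \<bullet> b) *\<^sub>R L y b)" if "linear (L y)" for y u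
    by (subst euclidean_representation[of u, symmetric]) (simp only: linear_sum[OF that] linear_cmul[OF that])
  have Lx: "linear (L x)" using L eventually_nhds_x_imp_x by blast
  have *: "((\<lambda>y. L y (Z y)) has_derivative
      (\<lambda>w. \<Sum>b\<in>Basis. (Z x \<bullet> b) *\<^sub>R deriv_at (\<lambda>y. L y b) x w + (Z' w \<bullet> b) *\<^sub>R L x b)) (at x)"
    if Z: "(Z has_derivative Z') (at x)" for Z Z'
  proof -
    have "((\<lambda>y. \<Sum>b\<in>Basis. (Z y \<bullet> b) *\<^sub>R L y b) has_derivative
      (\<lambda>w. \<Sum>b\<in>Basis. (Z x \<bullet> b) *\<^sub>R deriv_at (\<lambda>y. L y b) x w + (Z' w \<bullet> b) *\<^sub>R L x b)) (at x)"
      by (intro has_derivative_sum has_derivative_scaleR has_derivative_inner_left Z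
          has_derivative_deriv_at Ld)
    moreover have "eventually (\<lambda>y. (\<Sum>b\<in>Basis. (Z y \<bullet> b) *\<^sub>R L y b) = L y (Z y)) (nhds x)"
      using L by eventually_elim (simp add: exp)
    ultimately show ?thesis by (rule has_derivative_transform_nhds[rotated])
  qed
  have "deriv_at (\<lambda>y. L y (X x)) x w = (\<Sum>b\<in>Basis. (X x \<bullet> b) *\<^sub>R deriv_at (\<lambda>y. L y b) x w)" for w
    using deriv_at_eqI[OF *[OF has_derivative_const[of "X x"]]] by simp
  moreover have "L x (X' w) = (\<Sum>b\<in>Basis. (X' w \<bullet> b) *\<^sub>R L x b)" for w by (rule exp[OF Lx])
  ultimately show ?thesis using *[OF X] by (simp only: sum.distrib)
qed

lemma linear_deriv_at_family:
  fixes L :: "'m::real_normed_vector \<Rightarrow> 'a::real_vector \<Rightarrow> 'b::real_normed_vector"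
  assumes L: "eventually (\<lambda>y. linear (L y)) (nhds x)"
    and Ld: "\<And>u. (\<lambda>y. L y u) differentiable (at x)"
  shows "linear (\<lambda>u. deriv_at (\<lambda>y. L y u) x w)"
proof (rule linearI)
  fix u v
  have ev: "eventually (\<lambda>y. L y u + L y v = L y (u + v)) (nhds x)"
    using L by eventually_elim (simp add: linear_add)
  have "((\<lambda>y. L y u + L y v) has_derivative
      (\<lambda>w. deriv_at (\<lambda>y. L y u) x w + deriv_at (\<lambda>y. L y v) x w)) (at x)"
    by (intro has_derivative_add has_derivative_deriv_at Ld)
  from deriv_at_eqI[OF has_derivative_transform_nhds[OF ev this]]
  show "deriv_at (\<lambda>y. L y (u + v)) x w = deriv_at (\<lambda>y. L y u) x w + deriv_at (\<lambda>y. L y v) x w"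
    by simp
next
  fix u and c :: real
  have ev: "eventually (\<lambda>y. c *\<^sub>R L y u = L y (c *\<^sub>R u)) (nhds x)"
    using L by eventually_elim (simp add: linear_cmul)
  have "((\<lambda>y. c *\<^sub>R L y u) has_derivative (\<lambda>w. c *\<^sub>R deriv_at (\<lambda>y. L y u) x w)) (at x)"
    by (intro has_derivative_scaleR_right has_derivative_deriv_at Ld)
  from deriv_at_eqI[OF has_derivative_transform_nhds[OF ev this]]
  show "deriv_at (\<lambda>y. L y (c *\<^sub>R u)) x w = c *\<^sub>R deriv_at (\<lambda>y. L y u) x w"
    by simp
qed

text \<open>Since \<open>h\<close> is of first order at \<open>x\<close>, the product of
  \<open>h\<close> with \<open>c y - c x\<close>, which tends to 0, has zero derivative. Mere
  continuity of \<open>c\<close> thus suffices.\<close>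

lemma has_derivative_mult_zero:
  fixes h c :: "'a::real_normed_vector \<Rightarrow> real"
  assumes h: "(h has_derivative h') (at x)" "h x = 0" and c: "isCont c x"
  shows "((\<lambda>y. c y * h y) has_derivative (\<lambda>v. c x * h' v)) (at x)"
proof -
  obtain K where K: "K > 0" "\<And>v. norm (h' v) \<le> norm v * K"
    using bounded_linear.pos_bounded[OF has_derivative_bounded_linear[OF h(1)]] by blast
  have "((\<lambda>y. (c y - c x) * h y) has_derivative (\<lambda>v. 0)) (at x)"
    unfolding has_derivative_at_alt
  proof (intro conjI allI impI)
    fix e :: real assume e: "e > 0"
    obtain d1 where d1: "d1 > 0" "\<And>y. norm (y - x) < d1 \<Longrightarrow> norm (h y - h x - h' (y - x)) \<le> 1 * norm (y - x)"
      using h(1) unfolding has_derivative_at_alt by (meson zero_less_one)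
    have "e / (K + 1) > 0" using e K by simp
    then obtain d2 where d2: "d2 > 0" "\<And>y. dist y x < d2 \<Longrightarrow> dist (c y) (c x) < e / (K + 1)"
      using c unfolding continuous_at_eps_delta by metis
    show "\<exists>d>0. \<forall>y. norm (y - x) < d \<longrightarrow>
        norm ((c y - c x) * h y - (c x - c x) * h x - 0) \<le> e * norm (y - x)"
    proof (intro exI[of _ "min d1 d2"] conjI allI impI)
      fix y assume y: "norm (y - x) < min d1 d2"
      have "\<bar>h y\<bar> \<le> (K + 1) * norm (y - x)"
        using d1(2)[of y] K(2)[of "y - x"] y h(2) by (simp add: algebra_simps abs_le_iff)
      moreover have "\<bar>c y - c x\<bar> \<le> e / (K + 1)"
        using d2(2)[of y] y by (simp add: dist_norm)
      ultimately have "\<bar>c y - c x\<bar> * \<bar>h y\<bar> \<le> e / (K + 1) * ((K + 1) * norm (y - x))"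
        using e K by (intro mult_mono) auto
      then show "norm ((c y - c x) * h y - (c x - c x) * h x - 0) \<le> e * norm (y - x)"
        using K by (simp add: abs_mult)
    qed (use d1 d2 in auto)
  qed simp
  then have "((\<lambda>y. c x * h y + (c y - c x) * h y) has_derivative (\<lambda>v. c x * h' v + 0)) (at x)"
    by (intro has_derivative_add has_derivative_mult_right h)
  then show ?thesis by (simp add: algebra_simps)
qed

text \<open>The minimum over the Euclidean unit sphere is positive. Through this bound
  \<open>G\<close> controls the Euclidean norm, in which continuity and compactness are
  expressed.\<close>

lemma (in inner_prod) coercive: "\<exists>l>0. \<forall>u. l * (norm u)\<^sup>2 \<le> G u u"
proof -
  have "continuous_on (sphere 0 1) (\<lambda>u. G u u)"
    using bilinear_continuous_on_compose[OF continuous_on_id continuous_on_id bil] by simp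
  moreover obtain b :: 'v where "b \<in> Basis" using nonempty_Basis by blast
  then have "sphere (0::'v) 1 \<noteq> {}" by (auto simp: sphere_def dist_norm intro!: exI[of _ b])
  ultimately obtain u0 where u0: "u0 \<in> sphere 0 1" "\<And>u. u \<in> sphere 0 1 \<Longrightarrow> G u0 u0 \<le> G u u"
    using continuous_attains_inf[OF compact_sphere] by blast
  have "G u0 u0 * (norm u)\<^sup>2 \<le> G u u" for u
  proof (cases "u = 0")
    case False
    have "G u0 u0 \<le> G ((1 / norm u) *\<^sub>R u) ((1 / norm u) *\<^sub>R u)"
      using False by (intro u0(2)) simp
    also have "\<dots> = G u u / (norm u)\<^sup>2" by (simp add: G_simps power2_eq_square)
    finally show ?thesis using False by (simp add: field_simps)
  qed (simp add: G_simps)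
  moreover have "G u0 u0 > 0" using u0(1) by (intro pos) auto
  ultimately show ?thesis by blast
qed

lemma linear_bound_Basis:
  fixes f :: "'v::euclidean_space \<Rightarrow> real"
  assumes "linear f"
  shows "\<bar>f u\<bar> \<le> (\<Sum>b\<in>Basis. \<bar>f b\<bar>) * norm u"
proof -
  have "f u = (\<Sum>b\<in>Basis. (u \<bullet> b) * f b)"
    by (subst euclidean_representation[of u, symmetric])
      (simp only: linear_sum[OF assms] linear_cmul[OF assms] real_scaleR_def)
  then have "\<bar>f u\<bar> \<le> (\<Sum>b\<in>Basis. \<bar>u \<bullet> b\<bar> * \<bar>f b\<bar>)"
    by (metis (mono_tags, lifting) abs_mult sum.cong sum_abs)
  also have "\<dots> \<le> (\<Sum>b\<in>Basis. norm u * \<bar>f b\<bar>)"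
    by (intro sum_mono mult_right_mono Basis_le_norm) auto
  finally show ?thesis by (simp add: sum_distrib_left mult.commute)
qed

text \<open>Coercivity of \<open>G x\<close> makes \<open>w\<close> continuous at \<open>x\<close>; then \<open>G x (w y - w x)\<close> differs from a
  differentiable functional by products of continuous functions with differentiable functions that
  vanish at \<open>x\<close>.\<close>

lemma differentiable_representative:
  fixes G :: "'m::real_normed_vector \<Rightarrow> 'v::euclidean_space \<Rightarrow> 'v \<Rightarrow> real"
  assumes S: "open S" "x \<in> S" and G: "\<And>y. y \<in> S \<Longrightarrow> inner_prod (G y)"
    and Gd: "\<And>u v. (\<lambda>y. G y u v) differentiable (at x)"
    and r: "\<And>z. (\<lambda>y. r y z) differentiable (at x)"
    and w: "\<And>y z. y \<in> S \<Longrightarrow> G y (w y) z = r y z"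
  shows "w differentiable (at x)"
proof -
  interpret x: inner_prod "G x" using G S by blast
  have cont: "(f \<longlongrightarrow> f x) (at x)" if "f differentiable (at x)" for f :: "'m \<Rightarrow> real"
    using differentiable_imp_continuous_within[OF that] by (simp add: isCont_def)
  obtain l where l: "l > 0" "\<And>u. l * (norm u)\<^sup>2 \<le> G x u u" using x.coercive by blast
  define M where "M y = (\<Sum>b\<in>Basis. \<Sum>c\<in>Basis. \<bar>G y b c - G x b c\<bar>)" for y
  define R where "R y = (\<Sum>b\<in>Basis. \<bar>r y b - r x b\<bar>)" for y
  have "(M \<longlongrightarrow> (\<Sum>b\<in>Basis. \<Sum>c\<in>Basis. \<bar>G x b c - G x b c\<bar>)) (at x)"
    unfolding M_def[abs_def] by (intro tendsto_intros cont Gd)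
  then have M0: "(M \<longlongrightarrow> 0) (at x)" by simp
  have "(R \<longlongrightarrow> (\<Sum>b\<in>Basis. \<bar>r x b - r x b\<bar>)) (at x)"
    unfolding R_def[abs_def] by (intro tendsto_intros cont r)
  then have R0: "(R \<longlongrightarrow> 0) (at x)" by simp
  have Mb: "\<bar>G y u v - G x u v\<bar> \<le> M y * norm u * norm v" if "y \<in> S" for y u v
  proof -
    interpret y: inner_prod "G y" using G that by blast
    have 1: "linear (\<lambda>u. G y u v - G x u v)" "linear (\<lambda>v. G y u v - G x u v)" for u v
      by (intro linear_compose_sub x.lin_left y.lin_left x.lin_right y.lin_right)+
    have "\<bar>G y u v - G x u v\<bar> \<le> (\<Sum>b\<in>Basis. \<bar>G y b v - G x b v\<bar>) * norm u"
      by (rule linear_bound_Basis[OF 1(1)])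
    also have "\<dots> \<le> (\<Sum>b\<in>Basis. (\<Sum>c\<in>Basis. \<bar>G y b c - G x b c\<bar>) * norm v) * norm u"
      by (intro mult_right_mono sum_mono linear_bound_Basis[OF 1(2)]) auto
    also have "\<dots> = M y * norm u * norm v" by (simp add: M_def sum_distrib_left sum_distrib_right mult_ac)
    finally show ?thesis .
  qed
  have Rb: "\<bar>r y z - r x z\<bar> \<le> R y * norm z" if "y \<in> S" for y z
  proof -
    interpret y: inner_prod "G y" using G that by blast
    have "r y = G y (w y)" "r x = G x (w x)" using w S that by auto
    then have "linear (\<lambda>z. r y z - r x z)"
      by (metis linear_compose_sub x.lin_right y.lin_right)
    then show ?thesis unfolding R_def by (rule linear_bound_Basis)
  qed
  have diff: "G x (w y - w x) z = (r y z - r x z) - (G y (w y) z - G x (w y) z)" if "y \<in> S" for y z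
    using w[OF that, of z] w[OF S(2), of z] by (simp add: x.G_simps)
  have est: "norm (w y - w x) \<le> 2 / l * (R y + M y * norm (w x))" if y: "y \<in> S" "M y < l / 2" for y
  proof (cases "w y = w x")
    case True
    then show ?thesis using l by (simp add: M_def R_def sum_nonneg)
  next
    case False
    define d where "d = w y - w x"
    have d: "norm d > 0" using False by (simp add: d_def)
    have M: "M y \<ge> 0" by (simp add: M_def sum_nonneg)
    have wy: "norm (w y) \<le> norm (w x) + norm d"
      using norm_triangle_ineq[of "w x" d] by (simp add: d_def)
    have "l * (norm d)\<^sup>2 \<le> G x d d" by (rule l)
    also have "\<dots> = (r y d - r x d) - (G y (w y) d - G x (w y) d)" using diff[OF y(1)] by (simp add: d_def)
    also have "\<dots> \<le> R y * norm d + M y * norm (w y) * norm d"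
      using Rb[OF y(1), of d] Mb[OF y(1), of "w y" d] by linarith
    also have "\<dots> \<le> R y * norm d + M y * (norm (w x) + norm d) * norm d"
      using wy M by (intro add_mono mult_right_mono mult_left_mono) auto
    finally have "norm d * (l * norm d) \<le> norm d * (R y + M y * (norm (w x) + norm d))"
      by (simp add: power2_eq_square algebra_simps)
    then have "l * norm d \<le> R y + M y * (norm (w x) + norm d)" using d by simp
    \<comment> \<open>Because \<open>M y < l / 2\<close>, this term is absorbed by the left-hand
      side; the factor \<open>2 / l\<close> of the estimate comes from here.\<close>
    moreover have "M y * norm d \<le> l / 2 * norm d" using y(2) by (intro mult_right_mono) auto
    ultimately have "l / 2 * norm d \<le> R y + M y * norm (w x)" by (simp add: algebra_simps)
    then show ?thesis using l by (simp add: d_def field_simps)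
  qed
  have "((\<lambda>y. w y - w x) \<longlongrightarrow> 0) (at x)"
  proof (rule Lim_null_comparison)
    have "((\<lambda>y. 2 / l * (R y + M y * norm (w x))) \<longlongrightarrow> 2 / l * (0 + 0 * norm (w x))) (at x)"
      by (intro tendsto_intros M0 R0)
    then show "((\<lambda>y. 2 / l * (R y + M y * norm (w x))) \<longlongrightarrow> 0) (at x)" by simp
    have "eventually (\<lambda>y. M y < l / 2) (at x)" using M0 l by (intro order_tendstoD) auto
    moreover have "eventually (\<lambda>y. y \<in> S) (at x)"
      using eventually_nhds_open[OF S] unfolding eventually_at_filter by (rule eventually_mono) simp
    ultimately show "eventually (\<lambda>y. norm (w y - w x) \<le> 2 / l * (R y + M y * norm (w x))) (at x)"
      by eventually_elim (rule est)
  qed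
  then have wc: "isCont w x" by (simp add: isCont_def LIM_zero_iff)
  have comp: "(\<lambda>y. w y \<bullet> b) differentiable (at x)" for b
  proof -
    have "linear (\<lambda>z. z \<bullet> b)" by (simp add: bounded_linear.linear bounded_linear_inner_left)
    \<comment> \<open>Pairing with \<open>k\<close> under \<open>G x\<close> reads off the
      \<open>b\<close>-component, so one vector replaces the inverse of the Gram matrix.\<close>
    then obtain k where k: "\<And>z. G x z k = z \<bullet> b" using x.representable x.commute by metis
    define f where "f y = w x \<bullet> b + ((r y k - r x k) - (\<Sum>c\<in>Basis. (w y \<bullet> c) * (G y c k - G x c k)))" for y
    have "(\<lambda>y. (w y \<bullet> c) * (G y c k - G x c k)) differentiable (at x)" for c
    proof -
      have "((\<lambda>y. G y c k - G x c k) has_derivative (\<lambda>v. deriv_at (\<lambda>y. G y c k) x v - 0)) (at x)"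
        by (intro has_derivative_diff has_derivative_deriv_at Gd has_derivative_const)
      moreover have "isCont (\<lambda>y. w y \<bullet> c) x" using wc by (intro continuous_intros)
      ultimately show ?thesis by (intro differentiableI[OF has_derivative_mult_zero]) auto
    qed
    then have fd: "f differentiable (at x)" unfolding f_def[abs_def]
      using r by (intro differentiable_add differentiable_diff differentiable_const differentiable_sum) auto
    have "eventually (\<lambda>y. f y = w y \<bullet> b) (nhds x)"
      using eventually_nhds_open[OF S]
    proof eventually_elim
      case (elim y)
      interpret y: inner_prod "G y" using G elim by blast
      have "(\<Sum>c\<in>Basis. (w y \<bullet> c) * (G y c k - G x c k)) =
        (\<Sum>c\<in>Basis. G y ((w y \<bullet> c) *\<^sub>R c) k) - (\<Sum>c\<in>Basis. G x ((w y \<bullet> c) *\<^sub>R c) k)"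
        by (simp add: x.G_simps y.G_simps algebra_simps sum_subtractf)
      also have "\<dots> = G y (w y) k - G x (w y) k"
        by (simp only: euclidean_representation flip: y.G_sum_left x.G_sum_left)
      finally have "f y = w x \<bullet> b + G x (w y - w x) k" by (simp add: f_def diff[OF elim])
      then show ?case by (simp add: k inner_diff_left)
    qed
    then show ?thesis using fd by (rule differentiable_transform_eventually)
  qed
  then show ?thesis using differentiable_componentwise_within[of w x UNIV] by blast
qed

section \<open>Riemannian metrics on open sets\<close>

text \<open>Only \<open>C\<^sup>2\<close> regularity is required, so that the induced metric of an immersion is an instance
  as soon as its first derivatives are known.\<close>

locale local_metric =
  fixes S :: "'e::euclidean_space set" and G :: "'e \<Rightarrow> 'e \<Rightarrow> 'e \<Rightarrow> real"
  assumes open_S: "open S"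
    and inner: "x \<in> S \<Longrightarrow> inner_prod (G x)"
    and G_diff: "x \<in> S \<Longrightarrow> (\<lambda>y. G y u v) differentiable (at x)"
    and dG_diff: "x \<in> S \<Longrightarrow> (\<lambda>y. deriv_at (\<lambda>z. G z u v) y w) differentiable (at x)"
begin

abbreviation \<Gamma> where "\<Gamma> \<equiv> christoffel G"

lemma ev_S: "x \<in> S \<Longrightarrow> eventually (\<lambda>y. y \<in> S) (nhds x)"
  using open_S by (rule eventually_nhds_open)

lemma dG_commute:
  assumes "x \<in> S"
  shows "deriv_at (\<lambda>y. G y u v) x w = deriv_at (\<lambda>y. G y v u) x w"
proof -
  have "eventually (\<lambda>y. G y u v = G y v u) (nhds x)"
    using ev_S[OF assms] by eventually_elim (rule inner_prod.commute[OF inner])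
  then show ?thesis using deriv_at_transform_eventually G_diff[OF assms] by metis
qed

lemma ev_linear: "x \<in> S \<Longrightarrow> eventually (\<lambda>y. linear (G y u)) (nhds x)"
  using ev_S by (rule eventually_mono) (auto intro: inner_prod.lin_right inner)

lemma linear_dG: "x \<in> S \<Longrightarrow> linear (\<lambda>v. deriv_at (\<lambda>y. G y u v) x w)"
  by (intro linear_deriv_at_family ev_linear G_diff)

lemma linear_dG_left: "x \<in> S \<Longrightarrow> linear (\<lambda>u. deriv_at (\<lambda>y. G y u v) x w)"
  using linear_dG[of x v w] by (simp add: dG_commute)

lemma linear_dG_dir: "x \<in> S \<Longrightarrow> linear (deriv_at (\<lambda>y. G y u v) x)"
  by (intro linear_frechet_derivative G_diff)

lemma koszul:
  assumes x: "x \<in> S"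
  shows "2 * G x (\<Gamma> x u v) z =
    deriv_at (\<lambda>y. G y v z) x u + deriv_at (\<lambda>y. G y u z) x v - deriv_at (\<lambda>y. G y u v) x z"
proof -
  interpret inner_prod "G x" by (rule inner[OF x])
  let ?f = "\<lambda>z. deriv_at (\<lambda>y. G y v z) x u + deriv_at (\<lambda>y. G y u z) x v - deriv_at (\<lambda>y. G y u v) x z"
  have "linear (\<lambda>z. (1/2) *\<^sub>R ?f z)"
    by (intro linear_compose_scale_right linear_compose_sub linear_compose_add linear_dG linear_dG_dir x)
  then have "\<exists>!w. \<forall>z. G x w z = (1/2) *\<^sub>R ?f z" by (rule representable)
  then have "\<exists>!w. \<forall>z. 2 * G x w z = ?f z" by (simp add: field_simps)
  then show ?thesis unfolding christoffel_def by (rule theI'[THEN spec])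
qed

lemma christoffel_commute:
  assumes x: "x \<in> S"
  shows "\<Gamma> x u v = \<Gamma> x v u"
proof (rule inner_prod.nondeg[OF inner[OF x]])
  fix z
  show "G x (\<Gamma> x u v) z = G x (\<Gamma> x v u) z"
    using koszul[OF x, of u v z] koszul[OF x, of v u z] dG_commute[OF x, of u v z] by simp
qed

lemma linear_christoffel:
  assumes x: "x \<in> S"
  shows "linear (\<Gamma> x u)"
proof -
  interpret inner_prod "G x" by (rule inner[OF x])
  show ?thesis
  proof (rule linearI; rule nondeg)
    fix v w z
    have "2 * G x (\<Gamma> x u (v + w)) z = 2 * G x (\<Gamma> x u v + \<Gamma> x u w) z"
      unfolding G_simps distrib_left koszul[OF x]
      by (simp add: linear_add[OF linear_dG_left[OF x]] linear_add[OF linear_dG[OF x]]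
          linear_add[OF linear_dG_dir[OF x]])
    then show "G x (\<Gamma> x u (v + w)) z = G x (\<Gamma> x u v + \<Gamma> x u w) z" by simp
  next
    fix c :: real and v z
    have "2 * G x (\<Gamma> x u (c *\<^sub>R v)) z = c * (2 * G x (\<Gamma> x u v) z)"
      unfolding koszul[OF x]
      by (simp add: linear_cmul[OF linear_dG_left[OF x]] linear_cmul[OF linear_dG[OF x]]
          linear_cmul[OF linear_dG_dir[OF x]] algebra_simps)
    then show "G x (\<Gamma> x u (c *\<^sub>R v)) z = G x (c *\<^sub>R \<Gamma> x u v) z" by (simp add: G_simps)
  qed
qed

lemma linear_christoffel_left:
  assumes x: "x \<in> S"
  shows "linear (\<lambda>u. \<Gamma> x u v)"
proof -
  have "(\<lambda>u. \<Gamma> x u v) = \<Gamma> x v" using christoffel_commute[OF x] by blast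
  then show ?thesis using linear_christoffel[OF x] by simp
qed

lemma metric_compatible:
  assumes x: "x \<in> S"
  shows "deriv_at (\<lambda>y. G y u v) x w = G x (\<Gamma> x w u) v + G x u (\<Gamma> x w v)"
proof -
  interpret inner_prod "G x" by (rule inner[OF x])
  show ?thesis
    using koszul[OF x, of w u v] koszul[OF x, of w v u] commute[of u "\<Gamma> x w v"]
      dG_commute[OF x, of u v w] dG_commute[OF x, of w u v] dG_commute[OF x, of w v u]
    by simp
qed

text \<open>The Koszul functional depends differentiably on the point, and the vector that
  represents it inherits this.\<close>

lemma christoffel_diff:
  assumes x: "x \<in> S"
  shows "(\<lambda>y. \<Gamma> y u v) differentiable (at x)"
proof (rule differentiable_representative[OF open_S x inner G_diff[OF x]])
  fix z
  show "(\<lambda>y. (1/2) * (deriv_at (\<lambda>y. G y v z) y u + deriv_at (\<lambda>y. G y u z) y v - deriv_at (\<lambda>y. G y u v) y z))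
    differentiable at x"
    by (intro differentiable_mult differentiable_const differentiable_diff differentiable_add dG_diff x)
next
  fix y z assume "y \<in> S"
  then show "G y (\<Gamma> y u v) z =
    (1/2) * (deriv_at (\<lambda>y. G y v z) y u + deriv_at (\<lambda>y. G y u z) y v - deriv_at (\<lambda>y. G y u v) y z)"
    using koszul[of y u v z] by simp
qed

lemma curvature_const:
  assumes x: "x \<in> S"
  shows "curvature G (\<lambda>_. u) (\<lambda>_. v) (\<lambda>_. w) x =
    deriv_at (\<lambda>y. \<Gamma> y v w) x u + \<Gamma> x u (\<Gamma> x v w) - (deriv_at (\<lambda>y. \<Gamma> y u w) x v + \<Gamma> x v (\<Gamma> x u w))"
proof -
  have "levi_civita G (lie_bracket (\<lambda>_. u) (\<lambda>_. v)) (\<lambda>_. w) x = 0"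
    using linear_0[OF linear_christoffel_left[OF x]] by (simp add: levi_civita_def lie_bracket_def)
  then show ?thesis by (simp add: curvature_def levi_civita_def[abs_def])
qed

text \<open>Stated along a map because the derivatives of an immersion are fields along it and need
  not extend to the ambient open set. Taking \<open>F\<close> to be the identity covers fields on
  \<open>S\<close>.\<close>

lemma christoffel_along:
  fixes F :: "'m::real_normed_vector \<Rightarrow> 'e"
  assumes F: "(F has_derivative DF) (at x)" "F x \<in> S"
    and W: "(W has_derivative DW) (at x)" and Z: "(Z has_derivative DZ) (at x)"
  shows "((\<lambda>y. \<Gamma> (F y) (W y) (Z y)) has_derivative
    (\<lambda>a. deriv_at (\<lambda>y. \<Gamma> y (W x) (Z x)) (F x) (DF a) + \<Gamma> (F x) (W x) (DZ a) + \<Gamma> (F x) (DW a) (Z x))) (at x)"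
proof -
  have ev: "eventually (\<lambda>y. F y \<in> S) (nhds x)"
    using differentiable_eventually_in[OF differentiableI[OF F(1)] open_S F(2)] .
  have c: "((\<lambda>y. \<Gamma> (F y) u v) has_derivative (\<lambda>a. deriv_at (\<lambda>y. \<Gamma> y u v) (F x) (DF a))) (at x)" for u v
    using diff_chain_at[OF F(1) has_derivative_deriv_at[OF christoffel_diff[OF F(2)]], of u v]
    by (simp add: o_def)
  have l1: "eventually (\<lambda>y. linear (\<Gamma> (F y) u)) (nhds x)" for u
    using ev by (rule eventually_mono) (rule linear_christoffel)
  have l2: "eventually (\<lambda>y. linear (\<lambda>u. \<Gamma> (F y) u (Z y))) (nhds x)"
    using ev by (rule eventually_mono) (rule linear_christoffel_left)
  have 1: "((\<lambda>y. \<Gamma> (F y) u (Z y)) has_derivative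
    (\<lambda>a. deriv_at (\<lambda>y. \<Gamma> y u (Z x)) (F x) (DF a) + \<Gamma> (F x) u (DZ a))) (at x)" for u
    using has_derivative_linear_family[OF l1 differentiableI[OF c] Z] by (simp add: deriv_at_eqI[OF c])
  show ?thesis
    using has_derivative_linear_family[OF l2 differentiableI[OF 1] W] by (simp add: deriv_at_eqI[OF 1])
qed

text \<open>\<open>DW a + \<Gamma> (F x) (DF a) (W x)\<close> is the covariant derivative of \<open>W\<close> along the map \<open>F\<close>.\<close>

lemma metric_along:
  fixes F :: "'m::real_normed_vector \<Rightarrow> 'e"
  assumes F: "(F has_derivative DF) (at x)" "F x \<in> S"
    and W: "(W has_derivative DW) (at x)" and Z: "(Z has_derivative DZ) (at x)"
  shows "((\<lambda>y. G (F y) (W y) (Z y)) has_derivative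
    (\<lambda>a. G (F x) (DW a + \<Gamma> (F x) (DF a) (W x)) (Z x) + G (F x) (W x) (DZ a + \<Gamma> (F x) (DF a) (Z x)))) (at x)"
proof -
  interpret inner_prod "G (F x)" by (rule inner[OF F(2)])
  have ev: "eventually (\<lambda>y. F y \<in> S) (nhds x)"
    using differentiable_eventually_in[OF differentiableI[OF F(1)] open_S F(2)] .
  have c: "((\<lambda>y. G (F y) u v) has_derivative (\<lambda>a. deriv_at (\<lambda>y. G y u v) (F x) (DF a))) (at x)" for u v
    using diff_chain_at[OF F(1) has_derivative_deriv_at[OF G_diff[OF F(2)]], of u v]
    by (simp add: o_def)
  have l1: "eventually (\<lambda>y. linear (G (F y) u)) (nhds x)" for u
    using ev by (rule eventually_mono) (auto intro: inner_prod.lin_right inner)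
  have l2: "eventually (\<lambda>y. linear (\<lambda>u. G (F y) u (Z y))) (nhds x)"
    using ev by (rule eventually_mono) (auto intro: inner_prod.lin_left inner)
  have 1: "((\<lambda>y. G (F y) u (Z y)) has_derivative
    (\<lambda>a. deriv_at (\<lambda>y. G y u (Z x)) (F x) (DF a) + G (F x) u (DZ a))) (at x)" for u
    using has_derivative_linear_family[OF l1 differentiableI[OF c] Z] by (simp add: deriv_at_eqI[OF c])
  have "((\<lambda>y. G (F y) (W y) (Z y)) has_derivative
    (\<lambda>a. (deriv_at (\<lambda>y. G y (W x) (Z x)) (F x) (DF a) + G (F x) (W x) (DZ a)) + G (F x) (DW a) (Z x))) (at x)"
    using has_derivative_linear_family[OF l2 differentiableI[OF 1] W] by (simp add: deriv_at_eqI[OF 1])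
  then show ?thesis by (simp add: metric_compatible[OF F(2)] G_simps algebra_simps)
qed

end

section \<open>The exterior derivative of a 1-form under a map\<close>

lemma ext_deriv_const:
  "ext_deriv \<eta> (\<lambda>_. u) (\<lambda>_. v) x =
    (deriv_at (\<lambda>y. \<eta> y v) x u - deriv_at (\<lambda>y. \<eta> y u) x v - \<eta> x 0) / 2"
  by (simp add: ext_deriv_def lie_bracket_def)

lemma form_along:
  fixes F :: "'m::real_normed_vector \<Rightarrow> 'e::euclidean_space" and \<eta> :: "'e \<Rightarrow> 'e \<Rightarrow> real"
  assumes S: "open S" "\<And>x. x \<in> S \<Longrightarrow> linear (\<eta> x)" "\<And>x u. x \<in> S \<Longrightarrow> (\<lambda>x. \<eta> x u) differentiable (at x)"
    and F: "(F has_derivative DF) (at x)" "F x \<in> S" and Z: "(Z has_derivative DZ) (at x)"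
  shows "((\<lambda>y. \<eta> (F y) (Z y)) has_derivative
    (\<lambda>a. deriv_at (\<lambda>y. \<eta> y (Z x)) (F x) (DF a) + \<eta> (F x) (DZ a))) (at x)"
proof -
  have ev: "eventually (\<lambda>y. F y \<in> S) (nhds x)"
    using differentiable_eventually_in[OF differentiableI[OF F(1)] S(1) F(2)] .
  have c: "((\<lambda>y. \<eta> (F y) u) has_derivative (\<lambda>a. deriv_at (\<lambda>y. \<eta> y u) (F x) (DF a))) (at x)" for u
    using diff_chain_at[OF F(1) has_derivative_deriv_at[OF S(3)[OF F(2)]], of u]
    by (simp add: o_def)
  have l: "eventually (\<lambda>y. linear (\<eta> (F y))) (nhds x)"
    using ev by (rule eventually_mono) (rule S(2))
  show ?thesis
    using has_derivative_linear_family[OF l differentiableI[OF c] Z] by (simp add: deriv_at_eqI[OF c])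
qed

text \<open>Naturality of \<open>d\<close>: the second derivatives of \<open>F\<close> cancel by
  symmetry. It is applied to chart transitions and to the immersion.\<close>

lemma ext_deriv_pullback:
  fixes F :: "'f::euclidean_space \<Rightarrow> 'e::euclidean_space"
  assumes S: "open S" "\<And>x. x \<in> S \<Longrightarrow> linear (\<eta> x)" "\<And>x u. x \<in> S \<Longrightarrow> (\<lambda>x. \<eta> x u) differentiable (at x)"
    and U: "open U" "x \<in> U" and F: "smooth_on U F" "F x \<in> S"
    and pull: "\<And>y a. y \<in> U \<Longrightarrow> \<theta> y a = \<eta> (F y) (deriv_at F y a)"
  shows "ext_deriv \<theta> (\<lambda>_. a) (\<lambda>_. b) x =
    ext_deriv \<eta> (\<lambda>_. deriv_at F x a) (\<lambda>_. deriv_at F x b) (F x)"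
proof -
  have Fd: "(F has_derivative deriv_at F x) (at x)"
    by (rule has_derivative_deriv_at[OF smooth_on_differentiable[OF F(1) U(2)]])
  have Zd: "((\<lambda>y. deriv_at F y b) has_derivative deriv_at (\<lambda>y. deriv_at F y b) x) (at x)" for b
    by (rule has_derivative_deriv_at[OF smooth_on_differentiable[OF smooth_on_deriv[OF F(1)] U(2)]])
  have ev: "eventually (\<lambda>y. \<eta> (F y) (deriv_at F y b) = \<theta> y b) (nhds x)" for b
    using eventually_nhds_open[OF U] by eventually_elim (simp add: pull)
  have *: "deriv_at (\<lambda>y. \<theta> y b) x a =
      deriv_at (\<lambda>y. \<eta> y (deriv_at F x b)) (F x) (deriv_at F x a) + \<eta> (F x) (deriv_at (\<lambda>y. deriv_at F y b) x a)" for a b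
    using deriv_at_eqI[OF has_derivative_transform_nhds[OF ev form_along[OF S Fd F(2) Zd, of b]]] by simp
  \<comment> \<open>The vanishing bracket of constant fields leaves the terms
    \<open>\<theta> x 0\<close> and \<open>\<eta> (F x) 0\<close> in \<open>ext_deriv_const\<close>;
    this equation identifies them.\<close>
  have "deriv_at F x 0 = 0" using linear_0[OF has_derivative_linear[OF Fd]] .
  then show ?thesis
    using symmetric_second_derivative[OF U F(1), of a b] by (simp add: ext_deriv_const * pull[OF U(2)])
qed

section \<open>The Gauss equation in local coordinates\<close>

locale local_immersion = local_metric S G
  for S :: "'e::euclidean_space set" and G +
  fixes U :: "'f::euclidean_space set" and F :: "'f \<Rightarrow> 'e" and gM :: "'f \<Rightarrow> 'f \<Rightarrow> 'f \<Rightarrow> real"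
  assumes open_U: "open U" and smooth_F: "smooth_on U F" and F_in: "y \<in> U \<Longrightarrow> F y \<in> S"
    and inj_DF: "y \<in> U \<Longrightarrow> inj (deriv_at F y)"
    and gM: "y \<in> U \<Longrightarrow> gM y a b = G (F y) (deriv_at F y a) (deriv_at F y b)"
begin

lemma F_deriv: "y \<in> U \<Longrightarrow> (F has_derivative deriv_at F y) (at y)"
  by (rule has_derivative_deriv_at[OF smooth_on_differentiable[OF smooth_F]])

lemma DF_deriv: "y \<in> U \<Longrightarrow> ((\<lambda>y. deriv_at F y a) has_derivative deriv_at (\<lambda>y. deriv_at F y a) y) (at y)"
  by (rule has_derivative_deriv_at[OF smooth_on_differentiable[OF smooth_on_deriv[OF smooth_F]]])

lemma DDF_deriv: "y \<in> U \<Longrightarrow> ((\<lambda>y. deriv_at (\<lambda>y. deriv_at F y b) y a) has_derivative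
    deriv_at (\<lambda>y. deriv_at (\<lambda>y. deriv_at F y b) y a) y) (at y)"
  by (rule has_derivative_deriv_at[OF smooth_on_differentiable[OF smooth_on_deriv[OF smooth_on_deriv[OF smooth_F]]]])

lemma linear_DF: "y \<in> U \<Longrightarrow> linear (deriv_at F y)"
  by (rule has_derivative_linear[OF F_deriv])

lemma linear_DDF: "y \<in> U \<Longrightarrow> linear (deriv_at (\<lambda>y. deriv_at F y a) y)"
  by (rule has_derivative_linear[OF DF_deriv])

lemma DDF_commute: "y \<in> U \<Longrightarrow> deriv_at (\<lambda>y. deriv_at F y b) y a = deriv_at (\<lambda>y. deriv_at F y a) y b"
  using symmetric_second_derivative[OF open_U _ smooth_F] .

text \<open>The covariant derivative along \<open>F\<close>, in direction \<open>a\<close>, of the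
  image of the constant field \<open>b\<close>: the quantity \<open>ambient_deriv\<close>, before
  its normal part is taken.\<close>

definition \<beta> where "\<beta> y a b =
  deriv_at (\<lambda>y. deriv_at F y b) y a + \<Gamma> (F y) (deriv_at F y a) (deriv_at F y b)"

lemma \<beta>_commute: "y \<in> U \<Longrightarrow> \<beta> y a b = \<beta> y b a"
  by (simp add: \<beta>_def DDF_commute[of y a b] christoffel_commute[OF F_in, of y "deriv_at F y a"])

lemma linear_\<beta>_left: "y \<in> U \<Longrightarrow> linear (\<lambda>a. \<beta> y a b)"
  unfolding \<beta>_def
  by (intro linear_compose_add linear_DDF
      linear_compose[OF linear_DF linear_christoffel_left[OF F_in], unfolded o_def])

lemma linear_\<beta>:
  assumes y: "y \<in> U"
  shows "linear (\<beta> y a)"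
proof -
  have "\<beta> y a = (\<lambda>b. \<beta> y b a)" using \<beta>_commute[OF y] by blast
  then show ?thesis using linear_\<beta>_left[OF y] by simp
qed

lemma \<beta>_deriv:
  assumes y: "y \<in> U"
  shows "((\<lambda>y. \<beta> y b c) has_derivative (\<lambda>a.
    deriv_at (\<lambda>y. deriv_at (\<lambda>y. deriv_at F y c) y b) y a +
    (deriv_at (\<lambda>x. \<Gamma> x (deriv_at F y b) (deriv_at F y c)) (F y) (deriv_at F y a)
      + \<Gamma> (F y) (deriv_at F y b) (deriv_at (\<lambda>y. deriv_at F y c) y a)
      + \<Gamma> (F y) (deriv_at (\<lambda>y. deriv_at F y b) y a) (deriv_at F y c)))) (at y)"
  unfolding \<beta>_def[abs_def]
  by (intro has_derivative_add DDF_deriv christoffel_along F_deriv DF_deriv F_in y)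

lemma gM_deriv:
  assumes y: "y \<in> U"
  shows "((\<lambda>y. gM y b c) has_derivative
    (\<lambda>a. G (F y) (\<beta> y a b) (deriv_at F y c) + G (F y) (deriv_at F y b) (\<beta> y a c))) (at y)"
proof -
  have "eventually (\<lambda>y. G (F y) (deriv_at F y b) (deriv_at F y c) = gM y b c) (nhds y)"
    using eventually_nhds_open[OF open_U y] by eventually_elim (simp add: gM)
  then show ?thesis
    using metric_along[OF F_deriv[OF y] F_in[OF y] DF_deriv[OF y] DF_deriv[OF y], of b c]
    by (auto simp: \<beta>_def intro: has_derivative_transform_nhds)
qed

lemma inner_gM:
  assumes y: "y \<in> U"
  shows "inner_prod (gM y)"
proof -
  interpret inner_prod "G (F y)" by (rule inner[OF F_in[OF y]])
  note lin = linear_DF[OF y]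
  show ?thesis
  proof
    show "bilinear (gM y)" unfolding bilinear_def gM[OF y]
      using linear_compose[OF lin lin_left] linear_compose[OF lin lin_right] by (simp add: o_def gM[OF y])
    show "gM y u v = gM y v u" for u v by (simp add: gM[OF y] commute)
    show "0 < gM y u u" if "u \<noteq> 0" for u
    proof -
      have "deriv_at F y u \<noteq> 0"
        using linear_inj_iff_eq_0[OF lin] inj_DF[OF y] that by blast
      then show ?thesis by (simp add: gM[OF y] pos)
    qed
  qed
qed

text \<open>By \<open>gM_deriv\<close> the first derivatives of \<open>gM\<close> are again inner
  products of differentiable fields along \<open>F\<close>, so they can be differentiated once
  more.\<close>

sublocale M: local_metric U gM
proof (rule local_metric.intro)
  show "open U" by (rule open_U)
  show "inner_prod (gM y)" if "y \<in> U" for y using inner_gM[OF that] .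
  show "(\<lambda>y. gM y u v) differentiable at x" if "x \<in> U" for x u v
    using differentiableI[OF gM_deriv[OF that]] .
  show "(\<lambda>y. deriv_at (\<lambda>z. gM z b c) y a) differentiable at x" if x: "x \<in> U" for x a b c
  proof (rule differentiable_transform_eventually)
    show "eventually (\<lambda>y. G (F y) (\<beta> y a b) (deriv_at F y c) + G (F y) (deriv_at F y b) (\<beta> y a c)
        = deriv_at (\<lambda>z. gM z b c) y a) (nhds x)"
      using eventually_nhds_open[OF open_U x] by eventually_elim (simp add: deriv_at_eqI[OF gM_deriv])
    show "(\<lambda>y. G (F y) (\<beta> y a b) (deriv_at F y c) + G (F y) (deriv_at F y b) (\<beta> y a c)) differentiable at x"
      using metric_along[OF F_deriv[OF x] F_in[OF x] \<beta>_deriv[OF x, of a b] DF_deriv[OF x, of c]]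
        metric_along[OF F_deriv[OF x] F_in[OF x] DF_deriv[OF x, of b] \<beta>_deriv[OF x, of a c]]
      by (intro differentiable_add) (auto intro: differentiableI)
  qed
qed

text \<open>The induced connection is the tangential part of the ambient one: in the Koszul formula
  for \<open>gM\<close>, written with \<open>gM_deriv\<close>, symmetry of \<open>\<beta>\<close>
  cancels four of the six terms and makes the other two equal.\<close>

lemma gM_christoffel:
  assumes y: "y \<in> U"
  shows "gM y (M.\<Gamma> y a b) c = G (F y) (\<beta> y a b) (deriv_at F y c)"
proof -
  interpret inner_prod "G (F y)" by (rule inner[OF F_in[OF y]])
  show ?thesis
    using M.koszul[OF y, of a b c] \<beta>_commute[OF y]
    by (simp add: deriv_at_eqI[OF gM_deriv[OF y]] \<beta>_commute[OF y, of b a] \<beta>_commute[OF y, of c a]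
        \<beta>_commute[OF y, of c b] commute[of "deriv_at F y _" "\<beta> y _ _"])
qed

text \<open>The ambient curvature of tangent vectors as a commutator of covariant derivatives along
  \<open>F\<close>; the third derivatives of \<open>F\<close> drop out by symmetry.\<close>

lemma curvature_along:
  assumes y: "y \<in> U"
  shows "curvature G (\<lambda>_. deriv_at F y a) (\<lambda>_. deriv_at F y b) (\<lambda>_. deriv_at F y c) (F y) =
    deriv_at (\<lambda>y. \<beta> y b c) y a + \<Gamma> (F y) (deriv_at F y a) (\<beta> y b c)
    - (deriv_at (\<lambda>y. \<beta> y a c) y b + \<Gamma> (F y) (deriv_at F y b) (\<beta> y a c))"
proof -
  have "deriv_at (\<lambda>y. deriv_at (\<lambda>y. deriv_at F y c) y b) y a = deriv_at (\<lambda>y. deriv_at (\<lambda>y. deriv_at F y c) y a) y b"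
    by (rule symmetric_second_derivative[OF open_U y smooth_on_deriv[OF smooth_F]])
  moreover have "deriv_at (\<lambda>y. deriv_at F y b) y a = deriv_at (\<lambda>y. deriv_at F y a) y b"
    by (rule DDF_commute[OF y])
  moreover have "\<Gamma> (F y) u (\<beta> y p q) = \<Gamma> (F y) u (deriv_at (\<lambda>y. deriv_at F y q) y p)
      + \<Gamma> (F y) u (\<Gamma> (F y) (deriv_at F y p) (deriv_at F y q))" for u p q
    unfolding \<beta>_def by (rule linear_add[OF linear_christoffel[OF F_in[OF y]]])
  ultimately show ?thesis
    by (simp add: curvature_const[OF F_in[OF y]] deriv_at_eqI[OF \<beta>_deriv[OF y]])
qed

definition \<sigma> where "\<sigma> y a b = \<beta> y a b - deriv_at F y (M.\<Gamma> y a b)"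

lemma \<sigma>_normal: "y \<in> U \<Longrightarrow> G (F y) (\<sigma> y a b) (deriv_at F y c) = 0"
  using gM_christoffel[of y a b c] inner_prod.G_simps(3)[OF inner[OF F_in]] gM by (simp add: \<sigma>_def)

lemma \<sigma>_commute: "y \<in> U \<Longrightarrow> \<sigma> y a b = \<sigma> y b a"
  by (simp add: \<sigma>_def \<beta>_commute[of y a b] M.christoffel_commute[of y a b])

lemma linear_\<sigma>: "y \<in> U \<Longrightarrow> linear (\<sigma> y a)"
  unfolding \<sigma>_def[abs_def]
  by (intro linear_compose_sub linear_\<beta> linear_compose[OF M.linear_christoffel linear_DF, unfolded o_def])

lemma \<beta>_inner:
  assumes y: "y \<in> U"
  shows "G (F y) (\<beta> y a b) (\<beta> y c d) =
    gM y (M.\<Gamma> y a b) (M.\<Gamma> y c d) + G (F y) (\<sigma> y a b) (\<sigma> y c d)"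
proof -
  interpret inner_prod "G (F y)" by (rule inner[OF F_in[OF y]])
  show ?thesis
    using \<sigma>_normal[OF y, of a b "M.\<Gamma> y c d"] \<sigma>_normal[OF y, of c d "M.\<Gamma> y a b"]
    unfolding gM_christoffel[OF y] by (simp add: \<sigma>_def G_simps gM[OF y] commute)
qed

text \<open>Differentiate \<open>gM_christoffel\<close> in direction \<open>a\<close> and
  antisymmetrize in \<open>a\<close> and \<open>b\<close>. Splitting the products of
  \<open>\<beta>\<close> into tangential and normal parts cancels the Christoffel products and
  leaves those of \<open>\<sigma>\<close>, so \<open>\<sigma>\<close> is never differentiated and no
  normal connection appears.\<close>

theorem gauss:
  assumes x: "x \<in> U"
  shows "gM x (curvature gM (\<lambda>_. a) (\<lambda>_. b) (\<lambda>_. c) x) d =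
    G (F x) (curvature G (\<lambda>_. deriv_at F x a) (\<lambda>_. deriv_at F x b) (\<lambda>_. deriv_at F x c) (F x)) (deriv_at F x d)
    + G (F x) (\<sigma> x b c) (\<sigma> x a d) - G (F x) (\<sigma> x a c) (\<sigma> x b d)"
proof -
  interpret inner_prod "G (F x)" by (rule inner[OF F_in[OF x]])
  interpret m: inner_prod "gM x" by (rule M.inner[OF x])
  have *: "gM x (deriv_at (\<lambda>y. M.\<Gamma> y b c) x a + M.\<Gamma> x a (M.\<Gamma> x b c)) d + gM x (M.\<Gamma> x b c) (M.\<Gamma> x a d) =
      G (F x) (deriv_at (\<lambda>y. \<beta> y b c) x a + \<Gamma> (F x) (deriv_at F x a) (\<beta> x b c)) (deriv_at F x d)
      + G (F x) (\<beta> x b c) (\<beta> x a d)" for a b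
  proof -
    have "eventually (\<lambda>y. gM y (M.\<Gamma> y b c) d = G (F y) (\<beta> y b c) (deriv_at F y d)) (nhds x)"
      using eventually_nhds_open[OF open_U x] by eventually_elim (simp add: gM_christoffel)
    moreover have 1: "((\<lambda>y. gM y (M.\<Gamma> y b c) d) has_derivative
      (\<lambda>a. gM x (deriv_at (\<lambda>y. M.\<Gamma> y b c) x a + M.\<Gamma> x a (M.\<Gamma> x b c)) d + gM x (M.\<Gamma> x b c) (M.\<Gamma> x a d))) (at x)"
      using M.metric_along[OF has_derivative_ident x has_derivative_deriv_at[OF M.christoffel_diff[OF x]] has_derivative_const, of b c d]
      by simp
    moreover have 2: "((\<lambda>y. G (F y) (\<beta> y b c) (deriv_at F y d)) has_derivative
      (\<lambda>a. G (F x) (deriv_at (\<lambda>y. \<beta> y b c) x a + \<Gamma> (F x) (deriv_at F x a) (\<beta> x b c)) (deriv_at F x d)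
      + G (F x) (\<beta> x b c) (\<beta> x a d))) (at x)"
      using metric_along[OF F_deriv[OF x] F_in[OF x] has_derivative_deriv_at[OF differentiableI[OF \<beta>_deriv[OF x]]] DF_deriv[OF x], of b c d]
      by (simp add: \<beta>_def)
    ultimately show ?thesis
      using deriv_at_transform_eventually[OF _ differentiableI[OF 1]]
      by (simp add: deriv_at_eqI[OF 1] deriv_at_eqI[OF 2] fun_eq_iff)
  qed
  show ?thesis
    unfolding curvature_along[OF x] M.curvature_const[OF x]
    using *[of b a] *[of a b] unfolding \<beta>_inner[OF x]
    by (simp add: G_simps(3) m.G_simps(3))
qed

end

section \<open>Contact metric structures in local coordinates\<close>

locale local_contact = local_metric S G
  for S :: "'e::euclidean_space set" and G +
  fixes \<phi> :: "'e \<Rightarrow> 'e \<Rightarrow> 'e" and \<xi> :: "'e \<Rightarrow> 'e" and \<eta> :: "'e \<Rightarrow> 'e \<Rightarrow> real"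
  assumes linear_\<phi>: "x \<in> S \<Longrightarrow> linear (\<phi> x)"
    and smooth_\<phi>: "smooth_on S (\<lambda>x. \<phi> x u)"
    and smooth_\<xi>: "smooth_on S \<xi>"
    and smooth_\<eta>: "smooth_on S (\<lambda>x. \<eta> x u)"
    and \<phi>_\<phi>: "x \<in> S \<Longrightarrow> \<phi> x (\<phi> x u) = - u + \<eta> x u *\<^sub>R \<xi> x"
    and \<eta>_\<xi>: "x \<in> S \<Longrightarrow> \<eta> x (\<xi> x) = 1"
    and \<eta>_\<phi>: "x \<in> S \<Longrightarrow> \<eta> x (\<phi> x u) = 0"
    and \<phi>_\<xi>: "x \<in> S \<Longrightarrow> \<phi> x (\<xi> x) = 0"
    and G_\<xi>: "x \<in> S \<Longrightarrow> G x u (\<xi> x) = \<eta> x u"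
    and \<phi>_skew: "x \<in> S \<Longrightarrow> G x u (\<phi> x v) = - G x (\<phi> x u) v"
    and d\<eta>: "x \<in> S \<Longrightarrow> ext_deriv \<eta> (\<lambda>_. u) (\<lambda>_. v) x = G x u (\<phi> x v)"
begin

lemma linear_\<eta>: "x \<in> S \<Longrightarrow> linear (\<eta> x)"
proof -
  assume x: "x \<in> S"
  have "\<eta> x = (\<lambda>u. G x u (\<xi> x))" using G_\<xi>[OF x] by auto
  then show ?thesis using inner_prod.lin_left[OF inner[OF x]] by simp
qed

lemma \<xi>_deriv: "x \<in> S \<Longrightarrow> (\<xi> has_derivative deriv_at \<xi> x) (at x)"
  by (rule has_derivative_deriv_at[OF smooth_on_differentiable[OF smooth_\<xi>]])

lemma \<phi>_deriv: "x \<in> S \<Longrightarrow> ((\<lambda>y. \<phi> y u) has_derivative deriv_at (\<lambda>y. \<phi> y u) x) (at x)"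
  by (rule has_derivative_deriv_at[OF smooth_on_differentiable[OF smooth_\<phi>]])

text \<open>\<open>T\<close> is \<open>\<nabla>\<xi>\<close>, and \<open>P\<close> is its self-adjoint part: half the Lie derivative of the metric.\<close>

definition T where "T x u = deriv_at \<xi> x u + \<Gamma> x u (\<xi> x)"
definition P where "P x u = T x u + \<phi> x u"
definition h where "h x u = (1/2) *\<^sub>R lie_deriv_endo \<xi> \<phi> (\<lambda>_. u) x"

lemma h_eq: "2 *\<^sub>R h x u =
    deriv_at (\<lambda>y. \<phi> y u) x (\<xi> x) - deriv_at \<xi> x (\<phi> x u) + \<phi> x (deriv_at \<xi> x u)" if "x \<in> S"
  using linear_neg[OF linear_\<phi>[OF that]] by (simp add: h_def lie_deriv_endo_def lie_bracket_def)

lemma linear_D\<xi>: "x \<in> S \<Longrightarrow> linear (deriv_at \<xi> x)"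
  by (rule has_derivative_linear[OF \<xi>_deriv])

lemma linear_T: "x \<in> S \<Longrightarrow> linear (T x)"
  unfolding T_def[abs_def] by (intro linear_compose_add linear_D\<xi> linear_christoffel_left)

lemma linear_P: "x \<in> S \<Longrightarrow> linear (P x)"
  unfolding P_def[abs_def] by (intro linear_compose_add linear_T linear_\<phi>)

text \<open>The exterior derivative of the dual form \<open>\<eta>\<close> is the skew part of
  \<open>T\<close>. The contact condition identifies that part with \<open>- \<phi>\<close>, and
  adding \<open>\<phi>\<close> removes it.\<close>

lemma P_symmetric:
  assumes x: "x \<in> S"
  shows "G x (P x u) v = G x u (P x v)"
proof -
  interpret inner_prod "G x" by (rule inner[OF x])
  have "eventually (\<lambda>y. G y u (\<xi> y) = \<eta> y u) (nhds x)" for u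
    using ev_S[OF x] by eventually_elim (simp add: G_\<xi>)
  then have *: "deriv_at (\<lambda>y. \<eta> y u) x w = G x (\<Gamma> x w u) (\<xi> x) + G x u (T x w)" for u w
    using deriv_at_eqI[OF has_derivative_transform_nhds[OF _ metric_along[OF has_derivative_ident x
            has_derivative_const \<xi>_deriv[OF x]]], of u "\<lambda>y. \<eta> y u"]
    by (simp add: T_def)
  have "G x v (T x u) - G x u (T x v) = 2 * G x u (\<phi> x v)"
    using d\<eta>[OF x, of u v] linear_0[OF linear_\<eta>[OF x]] christoffel_commute[OF x, of u v]
    by (simp add: ext_deriv_const *)
  then show ?thesis
    using \<phi>_skew[OF x, of u v] commute[of v "T x u"] by (simp add: P_def G_simps)
qed

text \<open>Unit length makes the image of \<open>T x\<close> orthogonal to \<open>\<xi>\<close>,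
  and so is that of \<open>\<phi> x\<close>; by symmetry \<open>P x\<close> then annihilates
  \<open>\<xi>\<close>. In particular the integral curves of \<open>\<xi>\<close> are
  geodesics.\<close>

lemma P_\<xi>:
  assumes x: "x \<in> S"
  shows "P x (\<xi> x) = 0"
proof -
  interpret inner_prod "G x" by (rule inner[OF x])
  have "eventually (\<lambda>y. G y (\<xi> y) (\<xi> y) = 1) (nhds x)"
    using ev_S[OF x] by eventually_elim (simp add: G_\<xi> \<eta>_\<xi>)
  from deriv_at_const_0[OF this]
  have TT: "G x (T x u) (\<xi> x) + G x (\<xi> x) (T x u) = 0" for u
    using deriv_at_eqI[OF metric_along[OF has_derivative_ident x \<xi>_deriv[OF x] \<xi>_deriv[OF x]]]
    by (simp add: T_def)
  have "G x (T x u) (\<xi> x) = 0" for u using TT[of u] commute[of "\<xi> x" "T x u"] by linarith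
  then have "G x (P x u) (\<xi> x) = 0" for u using G_\<xi>[OF x, of "\<phi> x u"] \<eta>_\<phi>[OF x]
    by (simp add: P_def G_simps)
  then have "G x u (P x (\<xi> x)) = 0" for u using P_symmetric[OF x] by simp
  then show ?thesis using eq_0_iff by blast
qed

lemma T_\<xi>: "x \<in> S \<Longrightarrow> T x (\<xi> x) = 0"
  using P_\<xi>[of x] \<phi>_\<xi>[of x] by (simp add: P_def)

text \<open>\<open>L\<^sub>\<xi> d\<eta> = 0\<close>, because \<open>d\<eta>\<close> is closed and \<open>\<xi>\<close> lies in its kernel.\<close>

lemma lie_deriv_d\<eta>:
  assumes x: "x \<in> S"
  shows "deriv_at (\<lambda>y. G y u (\<phi> y v)) x (\<xi> x) + G x (deriv_at \<xi> x u) (\<phi> x v)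
    + G x u (\<phi> x (deriv_at \<xi> x v)) = 0"
proof -
  interpret inner_prod "G x" by (rule inner[OF x])
  define \<Omega> where "\<Omega> y u v = G y u (\<phi> y v)" for y u v
  have skew: "\<Omega> y u v = - \<Omega> y v u" if "y \<in> S" for y u v
    using \<phi>_skew[OF that, of u v] inner_prod.commute[OF inner[OF that], of "\<phi> y u" v] by (simp add: \<Omega>_def)
  have \<Omega>d: "((\<lambda>y. \<Omega> y u v) has_derivative deriv_at (\<lambda>y. \<Omega> y u v) x) (at x)" for u v
    using differentiableI[OF metric_along[OF has_derivative_ident x has_derivative_const \<phi>_deriv[OF x], of u v]]
    unfolding \<Omega>_def by (rule has_derivative_deriv_at)
  have ev: "eventually (\<lambda>y. (1/2) *\<^sub>R (deriv_at (\<lambda>y. \<eta> y v) y u - deriv_at (\<lambda>y. \<eta> y u) y v) = \<Omega> y u v) (nhds x)" for u v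
    using ev_S[OF x]
  proof eventually_elim
    case (elim y)
    show ?case
      using d\<eta>[OF elim, of u v] linear_0[OF linear_\<eta>[OF elim]] by (simp add: ext_deriv_const \<Omega>_def)
  qed
  have D\<eta>: "((\<lambda>y. deriv_at (\<lambda>y. \<eta> y v) y u) has_derivative deriv_at (\<lambda>y. deriv_at (\<lambda>y. \<eta> y v) y u) x) (at x)" for u v
    by (rule has_derivative_deriv_at[OF smooth_on_differentiable[OF smooth_on_deriv[OF smooth_\<eta>] x]])
  have d\<Omega>: "deriv_at (\<lambda>y. \<Omega> y u v) x w =
      (1/2) * (deriv_at (\<lambda>y. deriv_at (\<lambda>y. \<eta> y v) y u) x w - deriv_at (\<lambda>y. deriv_at (\<lambda>y. \<eta> y u) y v) x w)" for u v w
    using deriv_at_eqI[OF has_derivative_transform_nhds[OF ev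
          has_derivative_scaleR_right[OF has_derivative_diff[OF D\<eta> D\<eta>]]], of u v] by simp
  \<comment> \<open>This is \<open>d(d\<eta>) = 0\<close>: the six second derivatives of
    \<open>\<eta>\<close> cancel in pairs.\<close>
  have closed: "deriv_at (\<lambda>y. \<Omega> y u v) x w + deriv_at (\<lambda>y. \<Omega> y v w) x u + deriv_at (\<lambda>y. \<Omega> y w u) x v = 0" for u v w
    using symmetric_second_derivative[OF open_S x smooth_\<eta>, of v u w]
      symmetric_second_derivative[OF open_S x smooth_\<eta>, of u v w]
      symmetric_second_derivative[OF open_S x smooth_\<eta>, of w u v]
    unfolding d\<Omega> by (simp add: diff_divide_distrib)
  have lin: "eventually (\<lambda>y. linear (\<lambda>u. \<Omega> y u v)) (nhds x)" for v
    using ev_S[OF x] by (rule eventually_mono) (simp add: \<Omega>_def inner_prod.lin_left inner)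
  have "eventually (\<lambda>y. \<Omega> y (\<xi> y) v = 0) (nhds x)" for v
    using ev_S[OF x]
  proof eventually_elim
    case (elim y)
    then show ?case
      using skew[OF elim, of "\<xi> y" v] \<phi>_\<xi>[OF elim] inner_prod.G_simps(10)[OF inner[OF elim]]
      by (simp add: \<Omega>_def)
  qed
  from deriv_at_const_0[OF this]
  have \<xi>0: "deriv_at (\<lambda>y. \<Omega> y (\<xi> x) v) x w + \<Omega> x (deriv_at \<xi> x w) v = 0" for v w
    using deriv_at_eqI[OF has_derivative_linear_family[OF lin differentiableI[OF \<Omega>d] \<xi>_deriv[OF x]], of v]
    by (simp add: fun_eq_iff)
  have "eventually (\<lambda>y. - \<Omega> y u v = \<Omega> y v u) (nhds x)" for u v
    using ev_S[OF x] by eventually_elim (simp add: skew[of _ v u])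
  then have sk: "deriv_at (\<lambda>y. \<Omega> y v u) x w = - deriv_at (\<lambda>y. \<Omega> y u v) x w" for u v w
    using deriv_at_eqI[OF has_derivative_transform_nhds[OF _ has_derivative_minus[OF \<Omega>d]], of u v "\<lambda>y. \<Omega> y v u"] by simp
  \<comment> \<open>Cartan's formula: with \<open>\<xi> x\<close> in the third slot of
    \<open>closed\<close>, the differentiated kernel identity \<open>\<xi>0\<close> trades the other
    two terms for derivatives of \<open>\<xi>\<close>.\<close>
  show ?thesis
    using closed[of u v "\<xi> x"] \<xi>0[of v u] \<xi>0[of u v] sk[of v "\<xi> x" u] skew[OF x, of u "deriv_at \<xi> x v"]
    unfolding \<Omega>_def by linarith
qed

text \<open>The form \<open>G u (\<phi> v)\<close> is invariant under the flow of
  \<open>\<xi>\<close>. By the Leibniz rule the Lie derivatives of its factors cancel: that of the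
  metric is \<open>2 G (P u) v\<close> and that of \<open>\<phi>\<close> is \<open>2 h\<close>, so
  \<open>G (P u) (\<phi> v) + G u (h v) = 0\<close>.\<close>

lemma h_eq_P_\<phi>:
  assumes x: "x \<in> S"
  shows "h x v = - P x (\<phi> x v)"
proof -
  interpret inner_prod "G x" by (rule inner[OF x])
  have *: "G x u (h x v) = G x u (- P x (\<phi> x v))" for u
  proof -
    have "deriv_at (\<lambda>y. G y u (\<phi> y v)) x (\<xi> x) =
        G x (\<Gamma> x (\<xi> x) u) (\<phi> x v) + G x u (deriv_at (\<lambda>y. \<phi> y v) x (\<xi> x) + \<Gamma> x (\<xi> x) (\<phi> x v))"
      using deriv_at_eqI[OF metric_along[OF has_derivative_ident x has_derivative_const \<phi>_deriv[OF x], of u v]] by simp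
    moreover have "G x u (2 *\<^sub>R h x v) = G x u (deriv_at (\<lambda>y. \<phi> y v) x (\<xi> x))
        - G x u (deriv_at \<xi> x (\<phi> x v)) + G x u (\<phi> x (deriv_at \<xi> x v))"
      unfolding h_eq[OF x] by (simp add: G_simps)
    ultimately have "G x (T x u) (\<phi> x v) + G x u (T x (\<phi> x v)) = - 2 * G x u (h x v)"
      using lie_deriv_d\<eta>[OF x, of u v] christoffel_commute[OF x, of "\<xi> x"]
      by (simp add: T_def G_simps)
    then show ?thesis
      using P_symmetric[OF x, of u "\<phi> x v"] \<phi>_skew[OF x, of u "\<phi> x v"] by (simp add: P_def G_simps)
  qed
  show ?thesis by (rule nondeg) (simp only: commute[of "h x v"] commute[of "- P x (\<phi> x v)"] *)
qed

lemma h_fun: "x \<in> S \<Longrightarrow> h x = (\<lambda>v. - P x (\<phi> x v))"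
  using h_eq_P_\<phi> by blast

section \<open>Trace identities for the structure tensors\<close>

lemma trace_\<phi>: "x \<in> S \<Longrightarrow> trace_on (\<phi> x) = 0"
  using inner_prod.trace_on_skew[OF inner linear_\<phi>] \<phi>_skew by blast

lemma trace_\<phi>_\<phi>: "x \<in> S \<Longrightarrow> trace_on (\<lambda>u. \<phi> x (\<phi> x u)) = 1 - real DIM('e)"
  by (simp add: \<phi>_\<phi> trace_on_add trace_on_diff trace_on_minus trace_on_ident trace_on_rank_one linear_\<eta> \<eta>_\<xi>)

lemma trace_on_deriv_const:
  assumes x: "x \<in> S" and L: "\<And>u. ((\<lambda>y. L y u) has_derivative L' u) (at x)"
    and c: "\<And>y. y \<in> S \<Longrightarrow> trace_on (L y) = c"
  shows "trace_on (\<lambda>u. L' u w) = 0"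
proof -
  have "((\<lambda>y. trace_on (L y)) has_derivative (\<lambda>w. trace_on (\<lambda>u. L' u w))) (at x)"
    unfolding trace_on_def by (intro has_derivative_sum has_derivative_inner_left L)
  moreover have "eventually (\<lambda>y. trace_on (L y) = c) (nhds x)"
    using ev_S[OF x] by eventually_elim (rule c)
  ultimately show ?thesis using deriv_at_const_0 deriv_at_eqI by metis
qed

lemma linear_D\<phi>: "x \<in> S \<Longrightarrow> linear (\<lambda>u. deriv_at (\<lambda>y. \<phi> y u) x w)"
  using ev_S[of x] by (intro linear_deriv_at_family differentiableI[OF \<phi>_deriv])
    (auto elim: eventually_mono intro: linear_\<phi>)

text \<open>Twice \<open>h\<close> is the derivative of \<open>\<phi>\<close> along
  \<open>\<xi>\<close> plus a commutator. The first has the trace of a derivative of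
  \<open>tr \<phi> = 0\<close>, the second has none.\<close>

lemma trace_h:
  assumes x: "x \<in> S"
  shows "trace_on (h x) = 0"
proof -
  have "2 * trace_on (h x) = trace_on (\<lambda>u. 2 *\<^sub>R h x u)" by (simp add: trace_on_scaleR)
  also have "\<dots> = trace_on (\<lambda>u. deriv_at (\<lambda>y. \<phi> y u) x (\<xi> x)) - trace_on (\<lambda>u. deriv_at \<xi> x (\<phi> x u))
      + trace_on (\<lambda>u. \<phi> x (deriv_at \<xi> x u))"
    unfolding h_eq[OF x] by (simp add: trace_on_add trace_on_diff)
  also have "\<dots> = 0"
    using trace_on_deriv_const[OF x \<phi>_deriv[OF x] trace_\<phi>]
      trace_on_cyclic[OF linear_D\<xi>[OF x] linear_\<phi>[OF x]] by simp
  finally show ?thesis by simp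
qed

text \<open>Composing \<open>h = - P \<phi>\<close> with \<open>\<phi>\<close> gives
  \<open>P = h \<phi>\<close>, because \<open>P \<xi> = 0\<close>. The trace of
  \<open>\<phi> h\<close> vanishes like that of \<open>h\<close>, with the constant trace of
  \<open>\<phi> \<phi>\<close> in place of \<open>tr \<phi>\<close>.\<close>

lemma trace_P:
  assumes x: "x \<in> S"
  shows "trace_on (P x) = 0"
proof -
  note l\<phi> = linear_\<phi>[OF x] and lD = linear_D\<xi>[OF x] and lD\<phi> = linear_D\<phi>[OF x, of "\<xi> x"]
  have l\<phi>D: "linear (\<lambda>u. \<phi> x (deriv_at \<xi> x u))" using linear_compose[OF lD l\<phi>] by (simp add: o_def)
  have lin: "eventually (\<lambda>y. linear (\<phi> y)) (nhds x)"
    using ev_S[OF x] by (rule eventually_mono) (rule linear_\<phi>)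
  \<comment> \<open>The derivative of the constant trace of \<open>\<phi> \<phi>\<close> along
    \<open>\<xi>\<close>; its two summands have equal traces by cyclicity.\<close>
  have "trace_on (\<lambda>u. deriv_at (\<lambda>y. \<phi> y (\<phi> x u)) x (\<xi> x) + \<phi> x (deriv_at (\<lambda>y. \<phi> y u) x (\<xi> x))) = 0"
    by (rule trace_on_deriv_const[OF x has_derivative_linear_family[OF lin differentiableI[OF \<phi>_deriv[OF x]] \<phi>_deriv[OF x]] trace_\<phi>_\<phi>])
  then have D0: "trace_on (\<lambda>u. \<phi> x (deriv_at (\<lambda>y. \<phi> y u) x (\<xi> x))) = 0"
    using trace_on_cyclic[OF l\<phi> lD\<phi>] by (simp add: trace_on_add)
  have "2 *\<^sub>R \<phi> x (h x u) = \<phi> x (deriv_at (\<lambda>y. \<phi> y u) x (\<xi> x)) - \<phi> x (deriv_at \<xi> x (\<phi> x u))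
      + \<phi> x (\<phi> x (deriv_at \<xi> x u))" for u
    using arg_cong[OF h_eq[OF x, of u], of "\<phi> x"] by (simp add: linear_cmul[OF l\<phi>] linear_add[OF l\<phi>] linear_diff[OF l\<phi>])
  then have "trace_on (\<lambda>u. 2 *\<^sub>R \<phi> x (h x u)) = trace_on (\<lambda>u. \<phi> x (deriv_at (\<lambda>y. \<phi> y u) x (\<xi> x)))
      - trace_on (\<lambda>u. \<phi> x (deriv_at \<xi> x (\<phi> x u))) + trace_on (\<lambda>u. \<phi> x (\<phi> x (deriv_at \<xi> x u)))"
    by (simp add: trace_on_add trace_on_diff)
  then have "trace_on (\<lambda>u. \<phi> x (h x u)) = 0"
    using D0 trace_on_cyclic[OF l\<phi>D l\<phi>] by (simp add: trace_on_scaleR)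
  moreover have lh: "linear (h x)"
    using linear_compose_neg[OF linear_compose[OF l\<phi> linear_P[OF x]]] by (simp add: h_fun[OF x] o_def)
  ultimately have "trace_on (\<lambda>u. h x (\<phi> x u)) = 0" using trace_on_cyclic[OF l\<phi> lh] by simp
  moreover have "h x (\<phi> x u) = P x u" for u
    by (simp add: h_eq_P_\<phi>[OF x] \<phi>_\<phi>[OF x] linear_diff[OF linear_P[OF x]] linear_neg[OF linear_P[OF x]]
        linear_cmul[OF linear_P[OF x]] P_\<xi>[OF x])
  ultimately show ?thesis by simp
qed

lemma trace_T: "x \<in> S \<Longrightarrow> trace_on (T x) = 0"
  using trace_P[of x] trace_\<phi>[of x] by (simp add: P_def[abs_def] trace_on_add)

text \<open>The Riccati equation of the geodesic field \<open>\<xi>\<close>, whose trace is Raychaudhuri's equation.\<close>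

lemma trace_curvature_\<xi>:
  assumes x: "x \<in> S"
  shows "trace_on (\<lambda>u. curvature G (\<lambda>_. u) (\<lambda>_. \<xi> x) (\<lambda>_. \<xi> x) x) = - trace_on (\<lambda>u. T x (T x u))"
proof -
  note lT = linear_T[OF x] and l\<Gamma> = linear_christoffel[OF x]
  have D\<xi>d: "((\<lambda>y. deriv_at \<xi> y u) has_derivative deriv_at (\<lambda>y. deriv_at \<xi> y u) x) (at x)" for u
    by (rule has_derivative_deriv_at[OF smooth_on_differentiable[OF smooth_on_deriv[OF smooth_\<xi>] x]])
  have Td: "((\<lambda>y. T y u) has_derivative (\<lambda>w. deriv_at (\<lambda>y. deriv_at \<xi> y u) x w +
      (deriv_at (\<lambda>y. \<Gamma> y u (\<xi> x)) x w + \<Gamma> x u (deriv_at \<xi> x w)))) (at x)" for u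
    unfolding T_def[abs_def]
    using has_derivative_add[OF D\<xi>d christoffel_along[OF has_derivative_ident x has_derivative_const \<xi>_deriv[OF x], of u]]
      linear_0[OF linear_christoffel_left[OF x]] by simp
  have lin: "eventually (\<lambda>y. linear (T y)) (nhds x)"
    using ev_S[OF x] by (rule eventually_mono) (rule linear_T)
  have "eventually (\<lambda>y. T y (\<xi> y) = 0) (nhds x)"
    using ev_S[OF x] by eventually_elim (rule T_\<xi>)
  from deriv_at_const_0[OF this]
  have T0: "deriv_at (\<lambda>y. T y (\<xi> x)) x w + T x (deriv_at \<xi> x w) = 0" for w
    using deriv_at_eqI[OF has_derivative_linear_family[OF lin differentiableI[OF Td] \<xi>_deriv[OF x]]]
    by (simp add: fun_eq_iff)
  \<comment> \<open>The Riccati equation: the last three terms are minus the covariant derivative of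
    \<open>T\<close> along \<open>\<xi>\<close>. Their trace vanishes, since \<open>T\<close> is
    traceless on all of \<open>S\<close> and the Christoffel terms form a commutator.\<close>
  have R: "curvature G (\<lambda>_. u) (\<lambda>_. \<xi> x) (\<lambda>_. \<xi> x) x =
      - T x (T x u) + T x (\<Gamma> x (\<xi> x) u) - deriv_at (\<lambda>y. T y u) x (\<xi> x) - \<Gamma> x (\<xi> x) (T x u)" for u
  proof -
    have "deriv_at (\<lambda>y. T y (\<xi> x)) x u = - T x (deriv_at \<xi> x u)" using T0[of u] by (simp add: eq_neg_iff_add_eq_0)
    moreover have "T x (T x u) = T x (deriv_at \<xi> x u) + T x (\<Gamma> x (\<xi> x) u)"
      by (simp add: T_def[of x u] linear_add[OF lT] christoffel_commute[OF x, of u])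
    moreover have "\<Gamma> x u (deriv_at \<xi> x (\<xi> x)) + \<Gamma> x u (\<Gamma> x (\<xi> x) (\<xi> x)) = 0"
      using T_\<xi>[OF x] linear_add[OF l\<Gamma>, of u] linear_0[OF l\<Gamma>] by (metis T_def)
    moreover have "\<Gamma> x (\<xi> x) (T x u) = \<Gamma> x (\<xi> x) (deriv_at \<xi> x u) + \<Gamma> x (\<xi> x) (\<Gamma> x u (\<xi> x))"
      by (simp add: T_def linear_add[OF l\<Gamma>])
    moreover have "deriv_at (\<lambda>y. deriv_at \<xi> y u) x (\<xi> x) = deriv_at (\<lambda>y. deriv_at \<xi> y (\<xi> x)) x u"
      by (rule symmetric_second_derivative[OF open_S x smooth_\<xi>])
    ultimately show ?thesis
      unfolding curvature_const[OF x] deriv_at_eqI[OF Td] by (simp add: algebra_simps)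
  qed
  have "trace_on (\<lambda>u. deriv_at (\<lambda>y. T y u) x (\<xi> x)) = 0"
    using trace_on_deriv_const[OF x Td trace_T] by (simp add: deriv_at_eqI[OF Td])
  then show ?thesis
    unfolding R using trace_on_cyclic[OF lT l\<Gamma>] by (simp add: trace_on_add trace_on_diff trace_on_minus)
qed

text \<open>The cross terms of \<open>T\<^sup>2\<close> are traceless because
  \<open>tr h = 0\<close>, and so is the term with \<open>c\<close>. The unit coefficient of
  \<open>u - \<eta> x u *\<^sub>R \<xi> x\<close> is the value for which its trace
  \<open>DIM('e) - 1\<close> equals \<open>- tr \<phi>\<^sup>2\<close>; nothing but the trace of
  \<open>P\<^sup>2\<close> is left.\<close>

theorem sasakian_if_unit_curvature:
  assumes x: "x \<in> S"
    and R: "\<And>u. curvature G (\<lambda>_. u) (\<lambda>_. \<xi> x) (\<lambda>_. \<xi> x) x = (u - \<eta> x u *\<^sub>R \<xi> x) + c *\<^sub>R h x u"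
  shows "h x u = 0" and "T x u = - \<phi> x u"
proof -
  interpret inner_prod "G x" by (rule inner[OF x])
  note lP = linear_P[OF x] and l\<phi> = linear_\<phi>[OF x]
  have "trace_on (\<lambda>u. curvature G (\<lambda>_. u) (\<lambda>_. \<xi> x) (\<lambda>_. \<xi> x) x) = real DIM('e) - 1"
    unfolding R by (simp add: trace_on_add trace_on_diff trace_on_scaleR trace_on_ident
        trace_on_rank_one linear_\<eta>[OF x] \<eta>_\<xi>[OF x] trace_h[OF x])
  moreover have "T x (T x u) = P x (P x u) - P x (\<phi> x u) - \<phi> x (P x u) + \<phi> x (\<phi> x u)" for u
  proof -
    have T: "T x w = P x w - \<phi> x w" for w by (simp add: P_def)
    show ?thesis unfolding T by (simp add: linear_diff[OF lP] linear_diff[OF l\<phi>])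
  qed
  then have "trace_on (\<lambda>u. T x (T x u)) = trace_on (\<lambda>u. P x (P x u)) - trace_on (\<lambda>u. P x (\<phi> x u))
      - trace_on (\<lambda>u. \<phi> x (P x u)) + trace_on (\<lambda>u. \<phi> x (\<phi> x u))"
    by (simp add: trace_on_add trace_on_diff)
  moreover have "trace_on (\<lambda>u. P x (\<phi> x u)) = 0"
    using trace_h[OF x] by (simp add: h_fun[OF x] trace_on_minus)
  moreover have "trace_on (\<lambda>u. \<phi> x (P x u)) = trace_on (\<lambda>u. P x (\<phi> x u))"
    by (rule trace_on_cyclic[OF l\<phi> lP])
  ultimately have "trace_on (\<lambda>u. P x (P x u)) = 0"
    using trace_curvature_\<xi>[OF x] trace_\<phi>_\<phi>[OF x] by simp
  then have P0: "P x u = 0" for u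
    using lP P_symmetric[OF x] by (intro trace_on_square_symmetric) auto
  show "h x u = 0" by (simp add: h_eq_P_\<phi>[OF x] P0)
  show "T x u = - \<phi> x u" using P0[of u] by (simp add: P_def eq_neg_iff_add_eq_0)
qed

end

section \<open>Integral submanifolds in local coordinates\<close>

locale local_integral = local_immersion S G U F gM + local_contact S G \<phi> \<xi> \<eta>
  for S :: "'e::euclidean_space set" and G U and F :: "'f::euclidean_space \<Rightarrow> 'e" and gM \<phi> \<xi> \<eta> +
  assumes tangent: "y \<in> U \<Longrightarrow> \<eta> (F y) (deriv_at F y a) = 0"
begin

text \<open>The pullback of \<open>\<eta>\<close> is the zero form, hence so is the pullback of
  \<open>d\<eta>\<close>, which the contact condition turns into this inner product.\<close>

lemma \<phi>_orthogonal:
  assumes y: "y \<in> U"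
  shows "G (F y) (deriv_at F y a) (\<phi> (F y) (deriv_at F y b)) = 0"
proof -
  have "ext_deriv (\<lambda>_ _. 0) (\<lambda>_. a) (\<lambda>_. b) y =
      ext_deriv \<eta> (\<lambda>_. deriv_at F y a) (\<lambda>_. deriv_at F y b) (F y)"
    by (rule ext_deriv_pullback[OF open_S linear_\<eta> smooth_on_differentiable[OF smooth_\<eta>] open_U y smooth_F F_in[OF y]])
      (simp_all add: tangent)
  moreover have "ext_deriv (\<lambda>_ _. 0) (\<lambda>_. a) (\<lambda>_. b) y = 0" by (simp add: ext_deriv_const)
  ultimately show ?thesis by (simp add: d\<eta>[OF F_in[OF y]])
qed

text \<open>Differentiate \<open>G (DF b) \<xi> = 0\<close> in direction \<open>a\<close>: the
  derivative of \<open>\<xi>\<close> is \<open>- \<phi> (DF a)\<close>, which is orthogonal to the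
  submanifold.\<close>

lemma \<sigma>_\<xi>:
  assumes y: "y \<in> U" and T: "\<And>u. T (F y) u = - \<phi> (F y) u"
  shows "G (F y) (\<sigma> y a b) (\<xi> (F y)) = 0"
proof -
  interpret inner_prod "G (F y)" by (rule inner[OF F_in[OF y]])
  have "eventually (\<lambda>y. G (F y) (deriv_at F y b) (\<xi> (F y)) = 0) (nhds y)"
    using eventually_nhds_open[OF open_U y] by eventually_elim (simp add: G_\<xi> F_in tangent)
  from deriv_at_const_0[OF this]
  have "G (F y) (\<beta> y a b) (\<xi> (F y)) + G (F y) (deriv_at F y b) (T (F y) (deriv_at F y a)) = 0"
    using deriv_at_eqI[OF metric_along[OF F_deriv[OF y] F_in[OF y] DF_deriv[OF y]
          diff_chain_at[OF F_deriv[OF y] \<xi>_deriv[OF F_in[OF y]]], of b]]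
    by (simp add: \<beta>_def T_def o_def fun_eq_iff)
  then show ?thesis
    using \<phi>_orthogonal[OF y, of b a] tangent[OF y] G_\<xi>[OF F_in[OF y]]
    by (simp add: \<sigma>_def T G_simps linear_diff[OF linear_\<eta>[OF F_in[OF y]]])
qed

end

section \<open>Charts\<close>

lemma smooth_map_id: "smooth_atlas A \<Longrightarrow> smooth_map A A id"
  by (auto simp: smooth_map_def smooth_atlas_def continuous_on_id)

locale atlas =
  fixes A :: "('p::{t2_space, second_countable_topology}, 'e::euclidean_space) chart set"
  assumes atlas: "smooth_atlas A"
begin

lemma chart_at: "chart_at A p \<in> A" "p \<in> chart_dom (chart_at A p)"
proof -
  have "p \<in> (\<Union>c\<in>A. chart_dom c)" using atlas by (simp add: smooth_atlas_def)
  then have "\<exists>c. c \<in> A \<and> p \<in> chart_dom c" unfolding UN_iff by blast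
  then have "chart_at A p \<in> A \<and> p \<in> chart_dom (chart_at A p)" unfolding chart_at_def by (rule someI_ex)
  then show "chart_at A p \<in> A" "p \<in> chart_dom (chart_at A p)" by auto
qed

context
  fixes c assumes c: "c \<in> A"
begin

lemma chart: "is_chart c"
  using c atlas by (auto simp: smooth_atlas_def)

lemma open_dom: "open (chart_dom c)" and open_im: "open (coord c ` chart_dom c)"
  using chart by (auto simp: is_chart_def)

lemma hom: "homeomorphism (chart_dom c) (coord c ` chart_dom c) (coord c) (uncoord c)"
  using chart by (auto simp: is_chart_def)

lemma uncoord_coord: "p \<in> chart_dom c \<Longrightarrow> uncoord c (coord c p) = p"
  using hom by (auto simp: homeomorphism_def)

lemma open_image:
  assumes "open W"
  shows "open (coord c ` (chart_dom c \<inter> W))"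
proof -
  have "openin (top_of_set (chart_dom c)) (chart_dom c \<inter> W)" using assms by (rule openin_open_Int)
  then have "openin (top_of_set (coord c ` chart_dom c)) (coord c ` (chart_dom c \<inter> W))"
    using homeomorphism_imp_open_map[OF hom] by blast
  then show ?thesis using openin_open_eq[OF open_im] by blast
qed

end

end

section \<open>Local expressions of maps and changes of chart\<close>

definition rep where "rep c d \<iota> = coord d \<circ> \<iota> \<circ> uncoord c"

text \<open>Since chart transitions are local expressions of \<open>id\<close>, this single chain
  rule yields both the cocycle rule for changes of chart and the chart independence of the
  differential.\<close>

lemma rep_chain:
  assumes "smooth_atlas B" "smooth_atlas A" "smooth_atlas C"
    and \<iota>: "smooth_map B A \<iota>" and \<kappa>: "smooth_map A C \<kappa>"
    and cde: "c \<in> B" "d \<in> A" "e \<in> C"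
    and q: "q \<in> chart_dom c" "\<iota> q \<in> chart_dom d" "\<kappa> (\<iota> q) \<in> chart_dom e"
  shows "deriv_at (rep c e (\<kappa> \<circ> \<iota>)) (coord c q) u =
    deriv_at (rep d e \<kappa>) (coord d (\<iota> q)) (deriv_at (rep c d \<iota>) (coord c q) u)"
proof -
  interpret B: atlas B by standard fact
  interpret A: atlas A by standard fact
  have o: "open (\<iota> -` chart_dom d)" using \<iota> A.open_dom[OF cde(2)] open_vimage by (auto simp: smooth_map_def)
  have "smooth_on (coord c ` (chart_dom c \<inter> \<iota> -` chart_dom d)) (rep c d \<iota>)"
    using \<iota> cde unfolding smooth_map_def rep_def by blast
  then have 1: "(rep c d \<iota> has_derivative deriv_at (rep c d \<iota>) (coord c q)) (at (coord c q))"
    using q by (intro has_derivative_deriv_at smooth_on_differentiable) auto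
  have r: "rep c d \<iota> (coord c q) = coord d (\<iota> q)" using q cde by (simp add: rep_def B.uncoord_coord)
  have "smooth_on (coord d ` (chart_dom d \<inter> \<kappa> -` chart_dom e)) (rep d e \<kappa>)"
    using \<kappa> cde unfolding smooth_map_def rep_def by blast
  then have 2: "(rep d e \<kappa> has_derivative deriv_at (rep d e \<kappa>) (coord d (\<iota> q))) (at (rep c d \<iota> (coord c q)))"
    unfolding r using q by (intro has_derivative_deriv_at smooth_on_differentiable) auto
  have "eventually (\<lambda>y. (rep d e \<kappa> \<circ> rep c d \<iota>) y = rep c e (\<kappa> \<circ> \<iota>) y) (nhds (coord c q))"
    unfolding eventually_nhds
  proof (intro exI conjI ballI)
    show "open (coord c ` (chart_dom c \<inter> \<iota> -` chart_dom d))" using B.open_image[OF cde(1) o] .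
    show "coord c q \<in> coord c ` (chart_dom c \<inter> \<iota> -` chart_dom d)" using q by auto
    show "(rep d e \<kappa> \<circ> rep c d \<iota>) y = rep c e (\<kappa> \<circ> \<iota>) y" if "y \<in> coord c ` (chart_dom c \<inter> \<iota> -` chart_dom d)" for y
      using that cde by (auto simp: rep_def B.uncoord_coord A.uncoord_coord)
  qed
  from deriv_at_eqI[OF has_derivative_transform_nhds[OF this diff_chain_at[OF 1 2]]]
  show ?thesis by simp
qed

context atlas
begin

lemma to_chart_rep: "to_chart A c p = deriv_at (rep (chart_at A p) c id) (coord (chart_at A p) p)"
  and from_chart_rep: "from_chart A c p = deriv_at (rep c (chart_at A p) id) (coord c p)"
  by (simp_all add: to_chart_def from_chart_def rep_def o_assoc)

lemma rep_id_self:
  assumes "c \<in> A" "p \<in> chart_dom c"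
  shows "deriv_at (rep c c id) (coord c p) = id"
proof -
  have "eventually (\<lambda>y. y = rep c c id y) (nhds (coord c p))"
    unfolding eventually_nhds
    by (intro exI[of _ "coord c ` chart_dom c"])
      (use open_im[OF assms(1)] uncoord_coord[OF assms(1)] assms in \<open>auto simp: rep_def\<close>)
  then show ?thesis
    using deriv_at_eqI[OF has_derivative_transform_nhds[OF _ has_derivative_ident]] by (metis eq_id_iff)
qed

lemma from_chart_self: "from_chart A (chart_at A p) p u = u"
  and to_chart_self: "to_chart A (chart_at A p) p u = u"
  unfolding from_chart_rep to_chart_rep by (simp_all add: rep_id_self chart_at)

lemma rep_id_chain:
  assumes "c \<in> A" "d \<in> A" "e \<in> A" "p \<in> chart_dom c" "p \<in> chart_dom d" "p \<in> chart_dom e"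
  shows "deriv_at (rep d e id) (coord d p) (deriv_at (rep c d id) (coord c p) u) = deriv_at (rep c e id) (coord c p) u"
  using rep_chain[OF atlas atlas atlas smooth_map_id[OF atlas] smooth_map_id[OF atlas], of c d e p u] assms by simp

context
  fixes c p assumes c: "c \<in> A" and p: "p \<in> chart_dom c"
begin

lemma from_to_chart: "from_chart A c p (to_chart A c p u) = u"
  and to_from_chart: "to_chart A c p (from_chart A c p u) = u"
  unfolding from_chart_rep to_chart_rep using c p by (simp_all add: rep_id_chain rep_id_self chart_at)

lemma from_chart_trans:
  "d \<in> A \<Longrightarrow> p \<in> chart_dom d \<Longrightarrow> from_chart A d p (deriv_at (rep c d id) (coord c p) u) = from_chart A c p u"
  unfolding from_chart_rep using c p by (simp add: rep_id_chain chart_at)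

lemma smooth_rep_id: "d \<in> A \<Longrightarrow> smooth_on (coord c ` (chart_dom c \<inter> chart_dom d)) (rep c d id)"
  using atlas c by (auto simp: smooth_atlas_def rep_def)

lemma linear_from_chart: "linear (from_chart A c p)"
proof -
  have "rep c (chart_at A p) id differentiable (at (coord c p))"
    using p chart_at by (intro smooth_on_differentiable[OF smooth_rep_id]) auto
  then show ?thesis unfolding from_chart_rep by (rule linear_frechet_derivative)
qed

lemma linear_to_chart: "linear (to_chart A c p)"
proof -
  have "rep (chart_at A p) c id = coord c \<circ> uncoord (chart_at A p)" by (simp add: rep_def)
  then have "smooth_on (coord (chart_at A p) ` (chart_dom (chart_at A p) \<inter> chart_dom c)) (rep (chart_at A p) c id)"
    using atlas c chart_at by (simp add: smooth_atlas_def)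
  then have "rep (chart_at A p) c id differentiable (at (coord (chart_at A p) p))"
    by (rule smooth_on_differentiable) (use p chart_at in auto)
  then show ?thesis unfolding to_chart_rep by (rule linear_frechet_derivative)
qed

lemma inj_from_chart: "inj (from_chart A c p)"
  by (metis injI to_from_chart)

lemma metric_rep_coord: "metric_rep A c g (coord c p) u v = g p (from_chart A c p u) (from_chart A c p v)"
  and form_rep_coord: "form_rep A c \<eta> (coord c p) u = \<eta> p (from_chart A c p u)"
  and endo_rep_coord: "endo_rep A c \<phi> (coord c p) u = to_chart A c p (\<phi> p (from_chart A c p u))"
  and vec_rep_coord: "vec_rep A c \<xi> (coord c p) = to_chart A c p (\<xi> p)"
  using c p by (simp_all add: metric_rep_def form_rep_def endo_rep_def vec_rep_def uncoord_coord)

lemma inner_prod_metric_rep: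
  assumes "riemannian_metric A g"
  shows "inner_prod (metric_rep A c g (coord c p))"
proof -
  have g: "bilinear (g p)" "\<And>u v. g p u v = g p v u" "\<And>u. u \<noteq> 0 \<Longrightarrow> 0 < g p u u"
    using assms by (auto simp: riemannian_metric_def)
  note l = linear_from_chart
  have "linear (\<lambda>u. g p u w)" "linear (g p w)" for w using g(1) by (auto simp: bilinear_def)
  then have "bilinear (\<lambda>u v. g p (from_chart A c p u) (from_chart A c p v))"
    unfolding bilinear_def using linear_compose[OF l] by (auto simp: o_def)
  moreover have "from_chart A c p u \<noteq> 0" if "u \<noteq> 0" for u
    using linear_inj_iff_eq_0[OF l] inj_from_chart that by blast
  moreover have "metric_rep A c g (coord c p) = (\<lambda>u v. g p (from_chart A c p u) (from_chart A c p v))"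
    by (intro ext) (rule metric_rep_coord)
  ultimately show ?thesis using g(2,3) by unfold_locales auto
qed

end

lemma inner_prod_metric:
  assumes "riemannian_metric A g"
  shows "inner_prod (g p)"
proof
  show "bilinear (g p)" "g p u v = g p v u" "u \<noteq> 0 \<Longrightarrow> 0 < g p u u" for u v
    using assms unfolding riemannian_metric_def by blast+
qed

lemma local_metric:
  assumes g: "riemannian_metric A g" and c: "c \<in> A"
  shows "local_metric (coord c ` chart_dom c) (metric_rep A c g)"
proof -
  have s: "smooth_on (coord c ` chart_dom c) (\<lambda>x. metric_rep A c g x u v)" for u v
    using g c unfolding riemannian_metric_def by blast
  show ?thesis
  proof (rule local_metric.intro)
    show "inner_prod (metric_rep A c g x)" if "x \<in> coord c ` chart_dom c" for x
      using that inner_prod_metric_rep[OF c _ g] by auto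
  qed (use open_im[OF c] smooth_on_differentiable[OF s] smooth_on_differentiable[OF smooth_on_deriv[OF s]] in auto)
qed

text \<open>Tensoriality of \<open>d\<eta>\<close> transfers the contact condition from the distinguished charts to \<open>c\<close>.\<close>

lemma ext_deriv_rep:
  assumes \<eta>: "one_form A \<eta>" and c: "c \<in> A" and p: "p \<in> chart_dom c"
  shows "ext_deriv (form_rep A c \<eta>) (\<lambda>_. u) (\<lambda>_. v) (coord c p) =
    ext_deriv_at A \<eta> p (from_chart A c p u) (from_chart A c p v)"
proof -
  let ?d = "chart_at A p"
  have d: "?d \<in> A" "p \<in> chart_dom ?d" by (rule chart_at)+
  have lin: "linear (\<eta> p)" for p using \<eta> by (simp add: one_form_def)
  have sm: "smooth_on (coord ?d ` chart_dom ?d) (\<lambda>x. form_rep A ?d \<eta> x u)" for u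
    using \<eta> d by (simp add: one_form_def)
  have coord: "rep c ?d id (coord c p') = coord ?d p'" if "p' \<in> chart_dom c" for p'
    using that c by (simp add: rep_def uncoord_coord)
  have "ext_deriv (form_rep A c \<eta>) (\<lambda>_. u) (\<lambda>_. v) (coord c p) =
    ext_deriv (form_rep A ?d \<eta>) (\<lambda>_. deriv_at (rep c ?d id) (coord c p) u)
      (\<lambda>_. deriv_at (rep c ?d id) (coord c p) v) (rep c ?d id (coord c p))"
  proof (rule ext_deriv_pullback)
    show "open (coord ?d ` chart_dom ?d)" by (rule open_im[OF d(1)])
    show "linear (form_rep A ?d \<eta> x)" if x: "x \<in> coord ?d ` chart_dom ?d" for x
    proof -
      obtain p' where p': "p' \<in> chart_dom ?d" "x = coord ?d p'" using x by auto
      have "form_rep A ?d \<eta> x = (\<lambda>u. \<eta> p' (from_chart A ?d p' u))"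
        unfolding p'(2) by (intro ext) (rule form_rep_coord[OF d(1) p'(1)])
      then show ?thesis
        using linear_compose[OF linear_from_chart[OF d(1) p'(1)] lin] by (simp add: o_def)
    qed
    show "(\<lambda>x. form_rep A ?d \<eta> x u) differentiable at x" if "x \<in> coord ?d ` chart_dom ?d" for x u
      by (rule smooth_on_differentiable[OF sm that])
    show "open (coord c ` (chart_dom c \<inter> chart_dom ?d))" by (rule open_image[OF c open_dom[OF d(1)]])
    show "coord c p \<in> coord c ` (chart_dom c \<inter> chart_dom ?d)" using p d by auto
    show "smooth_on (coord c ` (chart_dom c \<inter> chart_dom ?d)) (rep c ?d id)"
      by (rule smooth_rep_id[OF c p d(1)])
    show "rep c ?d id (coord c p) \<in> coord ?d ` chart_dom ?d" using coord[OF p] d by auto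
    show "form_rep A c \<eta> y a = form_rep A ?d \<eta> (rep c ?d id y) (deriv_at (rep c ?d id) y a)"
      if y: "y \<in> coord c ` (chart_dom c \<inter> chart_dom ?d)" for y a
    proof -
      obtain p' where p': "p' \<in> chart_dom c" "p' \<in> chart_dom ?d" "y = coord c p'" using y by auto
      show ?thesis
        unfolding p'(3) coord[OF p'(1)] form_rep_coord[OF c p'(1)] form_rep_coord[OF d(1) p'(2)]
        by (simp add: from_chart_trans[OF c p'(1) d(1) p'(2)])
    qed
  qed
  then show ?thesis
    by (simp add: ext_deriv_at_def coord[OF p] from_chart_rep Let_def)
qed

text \<open>The algebraic identities survive because \<open>to_chart\<close> and
  \<open>from_chart\<close> are mutually inverse. The contact condition, stated at each point in
  that point's own chart, must later be differentiated and is therefore needed throughout the domain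
  of one chart \<open>c\<close>; \<open>ext_deriv_rep\<close> provides this.\<close>

lemma local_contact:
  assumes cm: "contact_metric A \<phi> \<xi> \<eta> g" and c: "c \<in> A"
  shows "local_contact (coord c ` chart_dom c) (metric_rep A c g) (endo_rep A c \<phi>) (vec_rep A c \<xi>) (form_rep A c \<eta>)"
proof -
  have acm: "almost_contact_metric A \<phi> \<xi> \<eta> g" and d\<eta>: "\<And>p u v. ext_deriv_at A \<eta> p u v = g p u (\<phi> p v)"
    using cm by (auto simp: contact_metric_def)
  have t: "endo_field A \<phi>" "vector_field A \<xi>" "one_form A \<eta>" "riemannian_metric A g"
    using acm by (auto simp: almost_contact_metric_def)
  have alg: "\<phi> p (\<phi> p u) = - u + \<eta> p u *\<^sub>R \<xi> p" "\<eta> p (\<xi> p) = 1" "\<eta> p (\<phi> p u) = 0" "\<phi> p (\<xi> p) = 0"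
    "g p u (\<xi> p) = \<eta> p u" "g p u (\<phi> p v) = - g p (\<phi> p u) v" for p u v
    using acm unfolding almost_contact_metric_def by blast+
  have lin\<phi>: "linear (\<phi> p)" for p using t(1) by (simp add: endo_field_def)
  show ?thesis
  proof (rule local_contact.intro[OF local_metric[OF t(4) c]], rule local_contact_axioms.intro)
    show "smooth_on (coord c ` chart_dom c) (\<lambda>x. endo_rep A c \<phi> x u)"
      "smooth_on (coord c ` chart_dom c) (vec_rep A c \<xi>)"
      "smooth_on (coord c ` chart_dom c) (\<lambda>x. form_rep A c \<eta> x u)" for u
      using t c by (simp_all add: endo_field_def vector_field_def one_form_def)
  next
    fix x assume "x \<in> coord c ` chart_dom c"
    then obtain p where p: "p \<in> chart_dom c" and x: "x = coord c p" by auto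
    note reps = metric_rep_coord[OF c p] form_rep_coord[OF c p] endo_rep_coord[OF c p] vec_rep_coord[OF c p]
      from_to_chart[OF c p] to_from_chart[OF c p] linear_0[OF linear_from_chart[OF c p]] linear_0[OF linear_to_chart[OF c p]]
      linear_add[OF linear_to_chart[OF c p]] linear_cmul[OF linear_to_chart[OF c p]] linear_neg[OF linear_to_chart[OF c p]]
    have "endo_rep A c \<phi> x = (\<lambda>u. to_chart A c p (\<phi> p (from_chart A c p u)))" using x reps by auto
    then show "linear (endo_rep A c \<phi> x)"
      using linear_compose[OF linear_compose[OF linear_from_chart[OF c p] lin\<phi>] linear_to_chart[OF c p]]
      by (simp add: o_def)
    show "endo_rep A c \<phi> x (endo_rep A c \<phi> x u) = - u + form_rep A c \<eta> x u *\<^sub>R vec_rep A c \<xi> x" for u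
      unfolding x reps alg ..
    show "form_rep A c \<eta> x (vec_rep A c \<xi> x) = 1" unfolding x reps alg ..
    show "form_rep A c \<eta> x (endo_rep A c \<phi> x u) = 0" for u unfolding x reps alg ..
    show "endo_rep A c \<phi> x (vec_rep A c \<xi> x) = 0" unfolding x reps alg ..
    show "metric_rep A c g x u (vec_rep A c \<xi> x) = form_rep A c \<eta> x u" for u unfolding x reps alg ..
    show "metric_rep A c g x u (endo_rep A c \<phi> x v) = - metric_rep A c g x (endo_rep A c \<phi> x u) v" for u v
      unfolding x reps by (rule alg)
    show "ext_deriv (form_rep A c \<eta>) (\<lambda>_. u) (\<lambda>_. v) x = metric_rep A c g x u (endo_rep A c \<phi> x v)" for u v
      unfolding x ext_deriv_rep[OF t(3) c p] d\<eta> reps ..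
  qed
qed

end

section \<open>The immersion in fixed charts\<close>

text \<open>\<open>differential\<close> uses the distinguished charts of \<open>q\<close> and
  \<open>\<iota> q\<close>, which may vary with \<open>q\<close>. This expresses it in charts held
  fixed, as differentiation requires.\<close>

lemma differential_from_chart:
  assumes B: "smooth_atlas B" and A: "smooth_atlas A" and \<iota>: "smooth_map B A \<iota>"
    and c: "c \<in> B" "q \<in> chart_dom c" and d: "d \<in> A" "\<iota> q \<in> chart_dom d"
  shows "differential B A \<iota> q (from_chart B c q a) = from_chart A d (\<iota> q) (deriv_at (rep c d \<iota>) (coord c q) a)"
proof -
  interpret B: atlas B by standard fact
  interpret A: atlas A by standard fact
  have "local_map B A \<iota> q = rep (chart_at B q) (chart_at A (\<iota> q)) \<iota>" by (simp add: local_map_def rep_def)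
  then show ?thesis
    unfolding differential_def B.from_chart_rep A.from_chart_rep
    using rep_chain[OF B B A smooth_map_id[OF B] \<iota>, of c "chart_at B q" "chart_at A (\<iota> q)" q a]
      rep_chain[OF B A A \<iota> smooth_map_id[OF A], of c d "chart_at A (\<iota> q)" q a] c d B.chart_at A.chart_at
    by simp
qed

locale C_totally_real_submanifold =
  fixes A :: "('p::{t2_space, second_countable_topology}, 'e::euclidean_space) chart set"
    and B :: "('q::{t2_space, second_countable_topology}, 'f::euclidean_space) chart set"
    and \<iota> :: "'q \<Rightarrow> 'p" and \<phi> \<xi> \<eta> g
  assumes A: "smooth_atlas A" and B: "smooth_atlas B"
    and contact: "contact_metric A \<phi> \<xi> \<eta> g"
    and immersion: "immersion B A \<iota>" and C_totally_real: "C_totally_real B A \<iota> g \<xi>"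
begin

sublocale A: atlas A by standard (rule A)
sublocale B: atlas B by standard (rule B)

lemma smooth: "smooth_map B A \<iota>" and inj: "inj (differential B A \<iota> q)"
  using immersion by (auto simp: immersion_def)

lemma acm: "almost_contact_metric A \<phi> \<xi> \<eta> g"
  using contact by (simp add: contact_metric_def)

lemma metric: "riemannian_metric A g"
  using acm by (simp add: almost_contact_metric_def)

lemma point: "\<phi> p (\<phi> p u) = - u + \<eta> p u *\<^sub>R \<xi> p" "\<eta> p (\<xi> p) = 1" "\<eta> p (\<phi> p u) = 0" "\<phi> p (\<xi> p) = 0"
    "g p u v = g p (\<phi> p u) (\<phi> p v) + \<eta> p u * \<eta> p v"
    "g p u (\<xi> p) = \<eta> p u" "g p u (\<phi> p v) = - g p (\<phi> p u) v"
  using acm unfolding almost_contact_metric_def by blast+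

abbreviation gM where "gM \<equiv> induced_metric B A \<iota> g"

lemma \<eta>_differential: "\<eta> (\<iota> q) (differential B A \<iota> q a) = 0"
  using C_totally_real inner_prod.commute[OF A.inner_prod_metric[OF metric]]
  by (simp add: C_totally_real_def normal_vectors_def flip: point(6))

context
  fixes q :: 'q
begin

abbreviation "c \<equiv> chart_at B q"
abbreviation "d \<equiv> chart_at A (\<iota> q)"
abbreviation "U \<equiv> coord c ` (chart_dom c \<inter> \<iota> -` chart_dom d)"
abbreviation "S \<equiv> coord d ` chart_dom d"
abbreviation "F \<equiv> rep c d \<iota>"
abbreviation "x \<equiv> coord c q"

lemma U_cases:
  assumes "y \<in> U"
  obtains q' where "q' \<in> chart_dom c" "\<iota> q' \<in> chart_dom d" "y = coord c q'" "F y = coord d (\<iota> q')"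
  using assms B.uncoord_coord[OF B.chart_at(1)] by (auto simp: rep_def)

lemma x_U: "x \<in> U" and F_x: "F x = coord d (\<iota> q)"
  using B.chart_at A.chart_at B.uncoord_coord[OF B.chart_at(1)] by (auto simp: rep_def)

text \<open>The charts stay those of \<open>q\<close> and \<open>\<iota> q\<close> on the whole
  neighbourhood \<open>U\<close>. At another point \<open>q'\<close> its distinguished charts may be
  different ones, and \<open>D\<close> converts between the two descriptions.\<close>

lemma local_integral:
  "local_integral S (metric_rep A d g) U F (metric_rep B c gM) (endo_rep A d \<phi>) (vec_rep A d \<xi>) (form_rep A d \<eta>)"
proof -
  have dA: "d \<in> A" and cB: "c \<in> B" by (rule A.chart_at B.chart_at)+
  interpret local_contact S "metric_rep A d g" "endo_rep A d \<phi>" "vec_rep A d \<xi>" "form_rep A d \<eta>"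
    by (rule A.local_contact[OF contact dA])
  have D: "differential B A \<iota> q' (from_chart B c q' a) = from_chart A d (\<iota> q') (deriv_at F (coord c q') a)"
    if "q' \<in> chart_dom c" "\<iota> q' \<in> chart_dom d" for q' a
    by (rule differential_from_chart[OF B A smooth cB that(1) dA that(2)])
  have "local_immersion_axioms S (metric_rep A d g) U F (metric_rep B c gM)"
  proof
    have "open (\<iota> -` chart_dom d)"
      using smooth A.open_dom[OF dA] open_vimage by (auto simp: smooth_map_def)
    then show "open U" by (rule B.open_image[OF cB])
    show "smooth_on U F" using smooth cB dA unfolding smooth_map_def rep_def by blast
  next
    fix y assume "y \<in> U"
    then obtain q' where q': "q' \<in> chart_dom c" "\<iota> q' \<in> chart_dom d" "y = coord c q'" "F y = coord d (\<iota> q')"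
      by (rule U_cases)
    show "F y \<in> S" using q' by auto
    show "inj (deriv_at F y)"
    proof (rule injI)
      fix a b assume "deriv_at F y a = deriv_at F y b"
      then have "differential B A \<iota> q' (from_chart B c q' a) = differential B A \<iota> q' (from_chart B c q' b)"
        using D[OF q'(1,2)] q'(3) by simp
      then show "a = b" using inj B.inj_from_chart[OF cB q'(1)] by (meson injD)
    qed
    show "metric_rep B c gM y a b = metric_rep A d g (F y) (deriv_at F y a) (deriv_at F y b)" for a b
      unfolding q'(4) unfolding q'(3) B.metric_rep_coord[OF cB q'(1)] A.metric_rep_coord[OF dA q'(2)]
      by (simp add: induced_metric_def D[OF q'(1,2)])
  qed
  moreover have "local_integral_axioms U F (form_rep A d \<eta>)"
  proof
    fix y a assume "y \<in> U"
    then obtain q' where q': "q' \<in> chart_dom c" "\<iota> q' \<in> chart_dom d" "y = coord c q'" "F y = coord d (\<iota> q')"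
      by (rule U_cases)
    show "form_rep A d \<eta> (F y) (deriv_at F y a) = 0"
      unfolding q'(4) unfolding q'(3) A.form_rep_coord[OF dA q'(2)]
      by (simp add: \<eta>_differential flip: D[OF q'(1,2)])
  qed
  ultimately show ?thesis
    by (intro local_integral.intro local_immersion.intro local_metric_axioms local_contact_axioms)
qed

abbreviation D where "D \<equiv> differential B A \<iota> q"
abbreviation sff where "sff \<equiv> second_fundamental_form B A \<iota> g q"

text \<open>At \<open>x\<close> the fixed charts are the distinguished ones, so local expressions
  and tensors coincide; this is the way back from coordinates to the manifold.\<close>

lemma linear_D: "linear D"
  and metric_rep_x: "metric_rep A d g (F x) = g (\<iota> q)" "metric_rep B c gM x = gM q"
  and deriv_F_x: "deriv_at F x = D"
  and contact_rep_x: "endo_rep A d \<phi> (F x) = \<phi> (\<iota> q)" "vec_rep A d \<xi> (F x) = \<xi> (\<iota> q)" "form_rep A d \<eta> (F x) = \<eta> (\<iota> q)"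
proof -
  interpret local_integral S "metric_rep A d g" U F "metric_rep B c gM" "endo_rep A d \<phi>" "vec_rep A d \<xi>" "form_rep A d \<eta>"
    by (rule local_integral)
  show D: "deriv_at F x = D" by (simp add: differential_def local_map_def rep_def)
  show "linear D" using linear_DF[OF x_U] by (simp add: D)
  show "metric_rep A d g (F x) = g (\<iota> q)" "metric_rep B c gM x = gM q"
    unfolding F_x by (intro ext; simp add: A.metric_rep_coord A.chart_at A.from_chart_self
        B.metric_rep_coord B.chart_at B.from_chart_self)+
  show "endo_rep A d \<phi> (F x) = \<phi> (\<iota> q)" "form_rep A d \<eta> (F x) = \<eta> (\<iota> q)"
    unfolding F_x by (intro ext; simp add: A.endo_rep_coord A.form_rep_coord A.chart_at A.from_chart_self A.to_chart_self)+
  show "vec_rep A d \<xi> (F x) = \<xi> (\<iota> q)"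
    unfolding F_x by (simp add: A.vec_rep_coord A.chart_at A.to_chart_self)
qed

text \<open>\<open>\<sigma>\<close> is normal and differs from \<open>\<beta>\<close> by a tangent
  vector, so uniqueness of the orthogonal decomposition identifies it with the normal part.\<close>

lemma sff_local: "sff a b = local_immersion.\<sigma> (metric_rep A d g) F (metric_rep B c gM) x a b"
proof -
  interpret L: local_integral S "metric_rep A d g" U F "metric_rep B c gM" "endo_rep A d \<phi>" "vec_rep A d \<xi>" "form_rep A d \<eta>"
    by (rule local_integral)
  interpret E: inner_prod "g (\<iota> q)" by (rule A.inner_prod_metric[OF metric])
  have "local_map B A \<iota> q = F" by (simp add: local_map_def rep_def)
  then have amb: "ambient_deriv B A \<iota> g q a b = L.\<beta> x a b"
    by (simp add: ambient_deriv_def L.\<beta>_def Let_def)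
  have "subspace (range D)" using linear_D by (simp add: linear_subspace_image)
  note ex1 = E.orthogonal_decomposition[OF this, of "L.\<beta> x a b"]
  have "normal_part B A \<iota> g q (L.\<beta> x a b) = L.\<sigma> x a b"
    unfolding normal_part_def
  proof (rule the1_equality)
    show "\<exists>!N. N \<in> normal_vectors B A \<iota> g q \<and> L.\<beta> x a b - N \<in> range D"
      using ex1 by (simp add: normal_vectors_def)
    show "L.\<sigma> x a b \<in> normal_vectors B A \<iota> g q \<and> L.\<beta> x a b - L.\<sigma> x a b \<in> range D"
      using L.\<sigma>_normal[OF x_U] by (auto simp: normal_vectors_def metric_rep_x deriv_F_x L.\<sigma>_def)
  qed
  then show ?thesis by (simp add: second_fundamental_form_def amb)
qed

lemma sff_normal: "g (\<iota> q) (sff a b) (D e) = 0"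
  and sff_commute: "sff a b = sff b a"
  and linear_sff: "linear (sff a)"
  and gauss_equation: "gM q (riemann_at B gM q a b e) f =
    g (\<iota> q) (riemann_at A g (\<iota> q) (D a) (D b) (D e)) (D f)
    + g (\<iota> q) (sff b e) (sff a f) - g (\<iota> q) (sff a e) (sff b f)"
  and \<phi>_tangent: "g (\<iota> q) (D a) (\<phi> (\<iota> q) (D b)) = 0"
proof -
  interpret L: local_integral S "metric_rep A d g" U F "metric_rep B c gM" "endo_rep A d \<phi>" "vec_rep A d \<xi>" "form_rep A d \<eta>"
    by (rule local_integral)
  interpret E: inner_prod "g (\<iota> q)" by (rule A.inner_prod_metric[OF metric])
  note sff = sff_local
  show "g (\<iota> q) (sff a b) (D e) = 0"
    using L.\<sigma>_normal[OF x_U, of a b e] by (simp add: sff metric_rep_x deriv_F_x)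
  show "sff a b = sff b a" using L.\<sigma>_commute[OF x_U] by (simp add: sff)
  have "sff a = L.\<sigma> x a" by (intro ext) (rule sff)
  then show "linear (sff a)" using L.linear_\<sigma>[OF x_U] by simp
  show "gM q (riemann_at B gM q a b e) f =
    g (\<iota> q) (riemann_at A g (\<iota> q) (D a) (D b) (D e)) (D f)
    + g (\<iota> q) (sff b e) (sff a f) - g (\<iota> q) (sff a e) (sff b f)"
    using L.gauss[OF x_U, of a b e f]
    by (simp add: sff metric_rep_x deriv_F_x riemann_at_def Let_def flip: F_x)
  show "g (\<iota> q) (D a) (\<phi> (\<iota> q) (D b)) = 0"
    using L.\<phi>_orthogonal[OF x_U, of a b] by (simp add: metric_rep_x deriv_F_x contact_rep_x)
qed

lemma h_\<xi>: "h_tensor A \<xi> \<phi> (\<iota> q) (\<xi> (\<iota> q)) = 0"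
  and \<eta>_h: "\<eta> (\<iota> q) (h_tensor A \<xi> \<phi> (\<iota> q) u) = 0"
  and sasakian: "(\<And>u. riemann_at A g (\<iota> q) u (\<xi> (\<iota> q)) (\<xi> (\<iota> q)) =
      (u - \<eta> (\<iota> q) u *\<^sub>R \<xi> (\<iota> q)) + k *\<^sub>R h_tensor A \<xi> \<phi> (\<iota> q) u) \<Longrightarrow>
    h_tensor A \<xi> \<phi> (\<iota> q) u = 0 \<and> g (\<iota> q) (sff a b) (\<xi> (\<iota> q)) = 0"
proof -
  interpret L: local_integral S "metric_rep A d g" U F "metric_rep B c gM" "endo_rep A d \<phi>" "vec_rep A d \<xi>" "form_rep A d \<eta>"
    by (rule local_integral)
  interpret E: inner_prod "g (\<iota> q)" by (rule A.inner_prod_metric[OF metric])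
  note FxS = L.F_in[OF x_U]
  have h: "h_tensor A \<xi> \<phi> (\<iota> q) u = L.h (F x) u" for u
    by (simp add: h_tensor_def lie_deriv_endo_at_def L.h_def F_x Let_def)
  show "h_tensor A \<xi> \<phi> (\<iota> q) (\<xi> (\<iota> q)) = 0"
    unfolding h L.h_eq_P_\<phi>[OF FxS] by (simp add: contact_rep_x point linear_0[OF L.linear_P[OF FxS]])
  have "g (\<iota> q) (L.P (F x) w) (\<xi> (\<iota> q)) = 0" for w
    using L.P_symmetric[OF FxS, of w "\<xi> (\<iota> q)"] L.P_\<xi>[OF FxS]
    by (simp add: metric_rep_x contact_rep_x E.G_simps)
  then show "\<eta> (\<iota> q) (h_tensor A \<xi> \<phi> (\<iota> q) u) = 0"
    unfolding h L.h_eq_P_\<phi>[OF FxS] point(6)[symmetric] by (simp add: E.G_simps)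
  assume R: "\<And>u. riemann_at A g (\<iota> q) u (\<xi> (\<iota> q)) (\<xi> (\<iota> q)) =
      (u - \<eta> (\<iota> q) u *\<^sub>R \<xi> (\<iota> q)) + k *\<^sub>R h_tensor A \<xi> \<phi> (\<iota> q) u"
  have R': "curvature (metric_rep A d g) (\<lambda>_. u) (\<lambda>_. vec_rep A d \<xi> (F x)) (\<lambda>_. vec_rep A d \<xi> (F x)) (F x) =
      (u - form_rep A d \<eta> (F x) u *\<^sub>R vec_rep A d \<xi> (F x)) + k *\<^sub>R L.h (F x) u" for u
    using R[of u] by (simp add: contact_rep_x riemann_at_def Let_def h flip: F_x)
  note sff = sff_local
  show "h_tensor A \<xi> \<phi> (\<iota> q) u = 0 \<and> g (\<iota> q) (sff a b) (\<xi> (\<iota> q)) = 0"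
    using L.sasakian_if_unit_curvature[OF FxS R'] L.\<sigma>_\<xi>[OF x_U, of a b]
    by (simp add: h sff metric_rep_x contact_rep_x)
qed

end

end

section \<open>Chen's inequality for a symmetric matrix\<close>

lemma sum_split_two:
  fixes f :: "nat \<Rightarrow> 'a::comm_monoid_add"
  assumes "2 \<le> n"
  shows "(\<Sum>i\<in>{1..n}. f i) = f 1 + f 2 + (\<Sum>i\<in>{3..n}. f i)"
  using assms by (simp add: sum.atLeast_Suc_atMost numeral_2_eq_2 numeral_3_eq_3 add.assoc)

lemma sum_pairs_symmetric:
  fixes f :: "nat \<Rightarrow> nat \<Rightarrow> real"
  assumes "\<And>i j. f i j = f j i"
  shows "2 * (\<Sum>j\<in>{1..n}. \<Sum>i\<in>{1..<j}. f i j) = (\<Sum>j\<in>{1..n}. \<Sum>i\<in>{1..n}. f i j) - (\<Sum>i\<in>{1..n}. f i i)"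
proof (induction n)
  case (Suc n)
  have "{1..<Suc n} = {1..n}" by auto
  moreover have "(\<Sum>i\<in>{1..n}. f (Suc n) i) = (\<Sum>i\<in>{1..n}. f i (Suc n))"
    by (intro sum.cong refl assms)
  ultimately show ?case using Suc by (simp add: sum.distrib algebra_simps)
qed simp

text \<open>The contribution of one normal direction, with \<open>x\<close> the matrix of its shape operator, to the
  slack in the inequality.\<close>

definition chen_defect :: "nat \<Rightarrow> (nat \<Rightarrow> nat \<Rightarrow> real) \<Rightarrow> real"
  where "chen_defect n x =
    (real n - 2) / (2 * (real n - 1)) * (\<Sum>i\<in>{1..n}. x i i)\<^sup>2
    - (\<Sum>j\<in>{1..n}. \<Sum>i\<in>{1..<j}. x i i * x j j - (x i j)\<^sup>2) + (x 1 1 * x 2 2 - (x 1 2)\<^sup>2)"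

text \<open>The term \<open>x 1 1 * x 2 2\<close> completes the squares of these two entries to that
  of their sum, so the diagonal part depends only on \<open>a 1 + a 2\<close>, \<open>M\<close> and
  \<open>Q\<close>. Completing the square in \<open>a 1 + a 2\<close> leaves the variance of the
  remaining diagonal entries, whose mean is \<open>\<mu>\<close>.\<close>

lemma chen_defect_sum_of_squares:
  fixes x :: "nat \<Rightarrow> nat \<Rightarrow> real"
  assumes n: "n \<ge> 3"
  defines "\<mu> \<equiv> (\<Sum>i\<in>{3..n}. x i i) / (real n - 2)"
  shows "chen_defect n x = (real n - 2) / (2 * (real n - 1)) * (x 1 1 + x 2 2 - \<mu>)\<^sup>2
    + (\<Sum>i\<in>{3..n}. (x i i - \<mu>)\<^sup>2) / 2
    + (\<Sum>j\<in>{1..n}. \<Sum>i\<in>{1..<j}. if (i, j) = (1, 2) then 0 else (x i j)\<^sup>2)"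
proof -
  define a where "a i = x i i" for i
  define N where "N = real n - 2"
  have N: "N \<ge> 1" using n by (simp add: N_def)
  define M where "M = (\<Sum>i\<in>{3..n}. a i)"
  define Q where "Q = (\<Sum>i\<in>{3..n}. (a i)\<^sup>2)"
  define W where "W = (\<Sum>j\<in>{1..n}. \<Sum>i\<in>{1..<j}. if (i, j) = (1, 2) then 0 else (x i j)\<^sup>2)"
  have tr: "(\<Sum>i\<in>{1..n}. a i) = a 1 + a 2 + M" using sum_split_two[of n a] n by (simp add: M_def)
  have tr2: "(\<Sum>i\<in>{1..n}. (a i)\<^sup>2) = (a 1)\<^sup>2 + (a 2)\<^sup>2 + Q" using sum_split_two[of n "\<lambda>i. (a i)\<^sup>2"] n by (simp add: Q_def)
  have "2 * (\<Sum>j\<in>{1..n}. \<Sum>i\<in>{1..<j}. a i * a j) = (\<Sum>j\<in>{1..n}. \<Sum>i\<in>{1..n}. a i * a j) - (\<Sum>i\<in>{1..n}. (a i)\<^sup>2)"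
    using sum_pairs_symmetric[of "\<lambda>i j. a i * a j" n] by (simp add: mult.commute power2_eq_square)
  moreover have "(\<Sum>j\<in>{1..n}. \<Sum>i\<in>{1..n}. a i * a j) = (a 1 + a 2 + M)\<^sup>2"
    unfolding tr[symmetric] by (simp add: power2_eq_square sum_product mult.commute)
  ultimately have prods: "2 * (\<Sum>j\<in>{1..n}. \<Sum>i\<in>{1..<j}. a i * a j) = (a 1 + a 2 + M)\<^sup>2 - (a 1)\<^sup>2 - (a 2)\<^sup>2 - Q"
    using tr2 by simp
  have off: "(\<Sum>j\<in>{1..n}. \<Sum>i\<in>{1..<j}. (x i j)\<^sup>2) = W + (x 1 2)\<^sup>2"
  proof -
    have "(\<Sum>i\<in>{1..<j}. (x i j)\<^sup>2) = (\<Sum>i\<in>{1..<j}. if (i, j) = (1, 2) then 0 else (x i j)\<^sup>2)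
        + (if j = 2 then (x 1 2)\<^sup>2 else 0)" for j :: nat
    proof (cases "j = 2")
      case True
      have "{1..<2::nat} = {1}" by auto
      then show ?thesis using True by simp
    qed simp
    then show ?thesis using n by (simp add: W_def sum.distrib)
  qed
  have \<mu>: "\<mu> = M / N" by (simp add: \<mu>_def M_def a_def N_def)
  \<comment> \<open>The usual variance identity for the \<open>N = n - 2\<close> entries from index
    3 on.\<close>
  have spread: "(\<Sum>i\<in>{3..n}. (a i - \<mu>)\<^sup>2) = Q - M\<^sup>2 / N"
  proof -
    have "(\<Sum>i\<in>{3..n}. (a i - \<mu>)\<^sup>2) = Q - 2 * \<mu> * M + real (card {3..n}) * \<mu>\<^sup>2"
      by (simp add: power2_diff sum.distrib sum_subtractf Q_def M_def sum_distrib_left mult_ac)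
    also have "real (card {3..n}) = N" using n by (simp add: N_def of_nat_diff)
    also have "Q - 2 * \<mu> * M + N * \<mu>\<^sup>2 = Q - M\<^sup>2 / N"
      using N unfolding \<mu> by (simp add: power2_eq_square field_simps)
    finally show ?thesis .
  qed
  have "(\<Sum>j\<in>{1..n}. \<Sum>i\<in>{1..<j}. x i i * x j j - (x i j)\<^sup>2)
      = (\<Sum>j\<in>{1..n}. \<Sum>i\<in>{1..<j}. a i * a j) - (W + (x 1 2)\<^sup>2)"
    unfolding off[symmetric] by (simp add: a_def sum_subtractf)
  then have "chen_defect n x = N / (2 * (N + 1)) * (a 1 + a 2 + M)\<^sup>2
      - ((a 1 + a 2 + M)\<^sup>2 - (a 1)\<^sup>2 - (a 2)\<^sup>2 - Q) / 2 + W + a 1 * a 2"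
    using prods tr unfolding chen_defect_def a_def[symmetric] N_def by (simp add: add.commute)
  also have "\<dots> = N / (2 * (N + 1)) * (a 1 + a 2 - M / N)\<^sup>2 + (Q - M\<^sup>2 / N) / 2 + W"
  proof -
    \<comment> \<open>A difference of two squares; its first factor \<open>M * (N + 1) / N\<close>
      cancels the coefficient, so the identity becomes polynomial up to
      \<open>M / N\<close>.\<close>
    have "N / (2 * (N + 1)) * (a 1 + a 2 + M)\<^sup>2 - N / (2 * (N + 1)) * (a 1 + a 2 - M / N)\<^sup>2 =
        N / (2 * (N + 1)) * ((M + M / N) * (2 * (a 1 + a 2) + M - M / N))"
      by (simp add: power2_eq_square algebra_simps)
    also have "M + M / N = M * (N + 1) / N" using N by (simp add: field_simps)
    also have "N / (2 * (N + 1)) * (M * (N + 1) / N * (2 * (a 1 + a 2) + M - M / N)) =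
        M / 2 * (2 * (a 1 + a 2) + M - M / N)"
    proof -
      have "N / (2 * k) * (M * k / N * z) = M / 2 * z" if "k \<noteq> 0" for k z
        using N that by simp
      from this[of "N + 1" "2 * (a 1 + a 2) + M - M / N"] N show ?thesis by linarith
    qed
    finally show ?thesis by (simp add: power2_eq_square algebra_simps add_divide_distrib diff_divide_distrib)
  qed
  also have "M / N = \<mu>" by (rule \<mu>[symmetric])
  finally show ?thesis unfolding spread[symmetric] W_def by (simp add: N_def a_def add.commute)
qed

lemma chen_defect_nonneg: "n \<ge> 3 \<Longrightarrow> chen_defect n x \<ge> 0"
  by (subst chen_defect_sum_of_squares) (auto intro!: add_nonneg_nonneg sum_nonneg)

lemma chen_defect_eq_0_iff:
  assumes n: "n \<ge> 3"
  shows "chen_defect n x = 0 \<longleftrightarrow>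
    (\<forall>i\<in>{3..n}. x i i = x 1 1 + x 2 2) \<and> (\<forall>j\<in>{1..n}. \<forall>i\<in>{1..<j}. (i, j) \<noteq> (1, 2) \<longrightarrow> x i j = 0)"
proof -
  define \<mu> where "\<mu> = (\<Sum>i\<in>{3..n}. x i i) / (real n - 2)"
  define p where "p = (real n - 2) / (2 * (real n - 1)) * (x 1 1 + x 2 2 - \<mu>)\<^sup>2"
  define s where "s = (\<Sum>i\<in>{3..n}. (x i i - \<mu>)\<^sup>2)"
  define w where "w = (\<Sum>j\<in>{1..n}. \<Sum>i\<in>{1..<j}. if (i, j) = (1, 2) then 0 else (x i j)\<^sup>2)"
  have nn: "p \<ge> 0" "s \<ge> 0" "w \<ge> 0" using n by (auto simp: p_def s_def w_def intro!: sum_nonneg)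
  have p: "p = 0 \<longleftrightarrow> x 1 1 + x 2 2 = \<mu>" using n by (simp add: p_def)
  have s: "s = 0 \<longleftrightarrow> (\<forall>i\<in>{3..n}. x i i = \<mu>)" unfolding s_def by (subst sum_nonneg_eq_0_iff) auto
  have w: "w = 0 \<longleftrightarrow> (\<forall>j\<in>{1..n}. \<forall>i\<in>{1..<j}. (i, j) \<noteq> (1, 2) \<longrightarrow> x i j = 0)"
    unfolding w_def by (subst sum_nonneg_eq_0_iff sum_nonneg; auto intro!: sum_nonneg simp: sum_nonneg_eq_0_iff)+
  \<comment> \<open>Needed to eliminate the mean from the criterion: entries all equal to
    \<open>x 1 1 + x 2 2\<close> have this value as their mean.\<close>
  have \<mu>: "\<mu> = x 1 1 + x 2 2" if "\<forall>i\<in>{3..n}. x i i = x 1 1 + x 2 2"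
  proof -
    have "(\<Sum>i\<in>{3..n}. x i i) = (\<Sum>i\<in>{3..n}. x 1 1 + x 2 2)" using that by (intro sum.cong) auto
    also have "\<dots> = (real n - 2) * (x 1 1 + x 2 2)" using n by (simp add: of_nat_diff)
    finally show ?thesis using n by (simp add: \<mu>_def)
  qed
  have "chen_defect n x = p + s / 2 + w"
    using chen_defect_sum_of_squares[OF n, of x] by (simp add: p_def s_def w_def \<mu>_def)
  then have "chen_defect n x = 0 \<longleftrightarrow> p = 0 \<and> s = 0 \<and> w = 0" using nn by auto
  then show ?thesis using p s w \<mu> by auto
qed

section \<open>Chen's inequality at a point\<close>

lemma in_span_pair:
  assumes "a \<in> span {u, v}"
  shows "\<exists>p r. a = p *\<^sub>R u + r *\<^sub>R v"
proof -
  obtain p where "a - p *\<^sub>R u \<in> span {v}" using assms unfolding span_breakdown_eq[of a u] by blast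
  then obtain r where "a - p *\<^sub>R u = r *\<^sub>R v" by (auto simp: span_singleton)
  then have "a = p *\<^sub>R u + r *\<^sub>R v" by (simp add: algebra_simps)
  then show ?thesis by blast
qed

text \<open>The expression is the off-diagonal entry of the symmetric matrix with diagonal
  \<open>a\<close>, \<open>c\<close> and off-diagonal \<open>b\<close> after a rotation. A quarter
  turn reverses its sign, so it vanishes in between.\<close>

lemma ex_rotation_zero:
  fixes a b c :: real
  shows "\<exists>p r. p\<^sup>2 + r\<^sup>2 = 1 \<and> (c - a) * (p * r) + b * (p\<^sup>2 - r\<^sup>2) = 0"
proof -
  define f where "f t = (c - a) * (cos t * sin t) + b * ((cos t)\<^sup>2 - (sin t)\<^sup>2)" for t
  have f: "isCont f t" for t unfolding f_def by (intro continuous_intros)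
  have ends: "f 0 = b" "f (pi / 2) = - b" by (simp_all add: f_def)
  have "\<exists>t. f t = 0"
  proof (cases "b \<ge> 0")
    case True
    then show ?thesis using IVT2[of f "pi / 2" 0 0] f ends by auto
  next
    case False
    then show ?thesis using IVT[of f 0 0 "pi / 2"] f ends by auto
  qed
  then obtain t where "f t = 0" by blast
  then show ?thesis by (intro exI[of _ "cos t"] exI[of _ "sin t"]) (simp add: f_def)
qed

text \<open>What remains of the geometry at one point: \<open>\<kappa>\<close> stands for the
  ambient sectional curvature on tangent planes and will be \<open>f1 (\<iota> q)\<close>.\<close>

locale gauss_point = M: inner_prod GM + E: inner_prod GE
  for GM :: "'f::euclidean_space \<Rightarrow> 'f \<Rightarrow> real" and GE :: "'e::euclidean_space \<Rightarrow> 'e \<Rightarrow> real" +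
  fixes \<sigma> :: "'f \<Rightarrow> 'f \<Rightarrow> 'e" and \<kappa> :: real
  assumes linear_\<sigma>: "linear (\<sigma> a)" and \<sigma>_commute: "\<sigma> a b = \<sigma> b a"
begin

lemma linear_\<sigma>_left: "linear (\<lambda>a. \<sigma> a b)"
proof -
  have "(\<lambda>a. \<sigma> a b) = \<sigma> b" using \<sigma>_commute by blast
  then show ?thesis using linear_\<sigma> by simp
qed

text \<open>The right-hand side of the Gauss equation; it is a sectional curvature only for
  orthonormal \<open>u\<close>, \<open>v\<close>.\<close>

definition K where "K u v = \<kappa> + GE (\<sigma> u u) (\<sigma> v v) - GE (\<sigma> u v) (\<sigma> u v)"

definition orthonormal_pair where "orthonormal_pair u v \<longleftrightarrow> GM u u = 1 \<and> GM v v = 1 \<and> GM u v = 0"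

definition \<tau> where "\<tau> e = (\<Sum>j\<in>{1..DIM('f)}. \<Sum>i\<in>{1..<j}. K (e i) (e j))"

definition tr where "tr e = (\<Sum>i\<in>{1..DIM('f)}. \<sigma> (e i) (e i))"

lemma tr_eq:
  assumes "onb GM UNIV {1..DIM('f)} e" "onb GM UNIV {1..DIM('f)} e'"
  shows "tr e = tr e'"
  unfolding tr_def using M.onb_trace_eq[OF assms(1) _ assms(2) _ linear_\<sigma>_left linear_\<sigma>] by simp

lemma \<tau>_eq_norms: "2 * \<tau> e = (real DIM('f) * (real DIM('f) - 1)) * \<kappa> + GE (tr e) (tr e)
    - (\<Sum>j\<in>{1..DIM('f)}. \<Sum>i\<in>{1..DIM('f)}. GE (\<sigma> (e i) (e j)) (\<sigma> (e i) (e j)))"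
proof -
  have K: "K u v = K v u" for u v by (simp add: K_def E.commute \<sigma>_commute[of u v])
  have Kii: "K u u = \<kappa>" for u by (simp add: K_def)
  have "2 * \<tau> e = (\<Sum>j\<in>{1..DIM('f)}. \<Sum>i\<in>{1..DIM('f)}. K (e i) (e j)) - real DIM('f) * \<kappa>"
    unfolding \<tau>_def using sum_pairs_symmetric[of "\<lambda>i j. K (e i) (e j)" "DIM('f)"] K by (simp add: Kii)
  moreover have "GE (tr e) (tr e) = (\<Sum>j\<in>{1..DIM('f)}. \<Sum>i\<in>{1..DIM('f)}. GE (\<sigma> (e i) (e i)) (\<sigma> (e j) (e j)))"
    unfolding tr_def E.G_sum_right E.G_sum_left ..
  ultimately show ?thesis by (simp add: K_def sum.distrib sum_subtractf algebra_simps)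
qed

text \<open>In \<open>\<tau>_eq_norms\<close> the squared norm of \<open>\<sigma>\<close> is a
  double trace, so the frame can be exchanged in one index at a time.
  \<open>scalar_curvature\<close> takes an arbitrary chosen frame, whereas the estimate needs
  adapted ones.\<close>

lemma \<tau>_eq:
  assumes e: "onb GM UNIV {1..DIM('f)} e" and e': "onb GM UNIV {1..DIM('f)} e'"
  shows "\<tau> e = \<tau> e'"
proof -
  have lin: "linear (\<lambda>u. GE (\<sigma> u v) w)" "linear (\<lambda>u. GE w (\<sigma> u v))" "linear (\<lambda>u. GE (\<sigma> v u) w)" "linear (\<lambda>u. GE w (\<sigma> v u))" for v w
    using linear_compose[OF linear_\<sigma>_left E.lin_left] linear_compose[OF linear_\<sigma>_left E.lin_right]
      linear_compose[OF linear_\<sigma> E.lin_left] linear_compose[OF linear_\<sigma> E.lin_right]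
    by (simp_all add: o_def)
  have 1: "(\<Sum>i\<in>{1..DIM('f)}. GE (\<sigma> (e i) v) (\<sigma> (e i) v)) = (\<Sum>i\<in>{1..DIM('f)}. GE (\<sigma> (e' i) v) (\<sigma> (e' i) v))" for v
    using M.onb_trace_eq[OF e _ e', where M = "\<lambda>u u'. GE (\<sigma> u v) (\<sigma> u' v)"] lin by simp
  have 2: "(\<Sum>j\<in>{1..DIM('f)}. GE (\<sigma> v (e j)) (\<sigma> v (e j))) = (\<Sum>j\<in>{1..DIM('f)}. GE (\<sigma> v (e' j)) (\<sigma> v (e' j)))" for v
    using M.onb_trace_eq[OF e _ e', where M = "\<lambda>u u'. GE (\<sigma> v u) (\<sigma> v u')"] lin by simp
  have "(\<Sum>j\<in>{1..DIM('f)}. \<Sum>i\<in>{1..DIM('f)}. GE (\<sigma> (e i) (e j)) (\<sigma> (e i) (e j))) =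
    (\<Sum>i\<in>{1..DIM('f)}. \<Sum>j\<in>{1..DIM('f)}. GE (\<sigma> (e' i) (e j)) (\<sigma> (e' i) (e j)))"
    unfolding 1 by (rule sum.swap)
  also have "\<dots> = (\<Sum>j\<in>{1..DIM('f)}. \<Sum>i\<in>{1..DIM('f)}. GE (\<sigma> (e' i) (e' j)) (\<sigma> (e' i) (e' j)))"
    unfolding 2 by (rule sum.swap)
  finally show ?thesis
    using \<tau>_eq_norms[of e] \<tau>_eq_norms[of e'] tr_eq[OF e e'] by simp
qed

lemma \<sigma>_combination:
  "\<sigma> (p *\<^sub>R u + r *\<^sub>R v) (s *\<^sub>R u + t *\<^sub>R v) =
    (p * s) *\<^sub>R \<sigma> u u + (p * t + r * s) *\<^sub>R \<sigma> u v + (r * t) *\<^sub>R \<sigma> v v"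
  by (simp add: linear_add[OF linear_\<sigma>] linear_add[OF linear_\<sigma>_left] linear_cmul[OF linear_\<sigma>]
      linear_cmul[OF linear_\<sigma>_left] \<sigma>_commute[of v u] algebra_simps)

text \<open>A change of basis multiplies the Gauss expression by the square of its determinant. This
  makes the definite description in \<open>sectional_curvature\<close> meaningful and allows the
  rotation inside a minimizing plane.\<close>

lemma K_eq_of_span:
  assumes uv: "orthonormal_pair u v" and ab: "orthonormal_pair a b" and span: "a \<in> span {u, v}" "b \<in> span {u, v}"
  shows "K a b = K u v"
proof -
  obtain p r where a: "a = p *\<^sub>R u + r *\<^sub>R v"
    using in_span_pair[OF span(1)] by blast
  obtain s t where b: "b = s *\<^sub>R u + t *\<^sub>R v"
    using in_span_pair[OF span(2)] by blast
  have o: "GM u u = 1" "GM v v = 1" "GM u v = 0" "GM v u = 0" using uv M.commute by (auto simp: orthonormal_pair_def)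
  have ps: "p\<^sup>2 + r\<^sup>2 = 1" "s\<^sup>2 + t\<^sup>2 = 1" "p * s + r * t = 0"
    using ab by (auto simp: orthonormal_pair_def a b M.G_simps o power2_eq_square mult.commute)
  \<comment> \<open>Lagrange's identity; it shows that the determinant of the change of orthonormal
    pair is plus or minus 1.\<close>
  have "(p * t - r * s)\<^sup>2 = (p\<^sup>2 + r\<^sup>2) * (s\<^sup>2 + t\<^sup>2) - (p * s + r * t)\<^sup>2"
    by (simp add: power2_eq_square algebra_simps)
  then have det: "(p * t - r * s)\<^sup>2 = 1" using ps by simp
  have "GE (\<sigma> a a) (\<sigma> b b) - GE (\<sigma> a b) (\<sigma> a b) =
      (p * t - r * s)\<^sup>2 * (GE (\<sigma> u u) (\<sigma> v v) - GE (\<sigma> u v) (\<sigma> u v))"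
  proof -
    define X Y Z where "X = \<sigma> u u" and "Y = \<sigma> u v" and "Z = \<sigma> v v"
    have ex: "GE (x *\<^sub>R X + y *\<^sub>R Y + z *\<^sub>R Z) (x' *\<^sub>R X + y' *\<^sub>R Y + z' *\<^sub>R Z) =
        x * x' * GE X X + (x * y' + y * x') * GE X Y + (x * z' + z * x') * GE X Z
        + y * y' * GE Y Y + (y * z' + z * y') * GE Y Z + z * z' * GE Z Z" for x y z x' y' z'
      by (simp add: E.G_simps E.commute[of Y X] E.commute[of Z X] E.commute[of Z Y] algebra_simps)
    show ?thesis
      unfolding a b \<sigma>_combination X_def[symmetric] Y_def[symmetric] Z_def[symmetric] ex
      by (simp add: power2_eq_square algebra_simps)
  qed
  then show ?thesis by (simp add: K_def det)
qed

text \<open>Orthonormal pairs form a closed set, bounded by coercivity of \<open>GM\<close>. An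
  infimum that was only approached would leave the equality case without a plane to exhibit.\<close>

lemma K_attains_inf:
  assumes "2 \<le> DIM('f)"
  shows "\<exists>u v. orthonormal_pair u v \<and> (\<forall>a b. orthonormal_pair a b \<longrightarrow> K u v \<le> K a b)"
proof -
  define P where "P = {w. orthonormal_pair (fst w) (snd w)}"
  have bil: "bilinear \<sigma>" using linear_\<sigma> linear_\<sigma>_left by (simp add: bilinear_def)
  have cM: "continuous_on UNIV (\<lambda>w. GM (f w) (f' w))"
    if "continuous_on UNIV f" "continuous_on UNIV f'" for f f' :: "'f \<times> 'f \<Rightarrow> 'f"
    by (rule bilinear_continuous_on_compose[OF that M.bil])
  have c\<sigma>: "continuous_on UNIV (\<lambda>w. \<sigma> (f w) (f' w))"
    if "continuous_on UNIV f" "continuous_on UNIV f'" for f f' :: "'f \<times> 'f \<Rightarrow> 'f"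
    by (rule bilinear_continuous_on_compose[OF that bil])
  have cE: "continuous_on UNIV (\<lambda>w. GE (f w) (f' w))"
    if "continuous_on UNIV f" "continuous_on UNIV f'" for f f' :: "'f \<times> 'f \<Rightarrow> 'e"
    by (rule bilinear_continuous_on_compose[OF that E.bil])
  have cf: "continuous_on UNIV (fst :: 'f \<times> 'f \<Rightarrow> 'f)" and cs: "continuous_on UNIV (snd :: 'f \<times> 'f \<Rightarrow> 'f)"
    by (intro continuous_intros)+
  have "P = {w. GM (fst w) (fst w) = 1} \<inter> {w. GM (snd w) (snd w) = 1} \<inter> {w. GM (fst w) (snd w) = 0}"
    by (auto simp: P_def orthonormal_pair_def)
  moreover note closed_Collect_eq[OF cM[OF cf cf] continuous_on_const, of 1]
    closed_Collect_eq[OF cM[OF cs cs] continuous_on_const, of 1]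
    closed_Collect_eq[OF cM[OF cf cs] continuous_on_const, of 0]
  ultimately have "closed P" by (simp add: closed_Int)
  moreover have "bounded P"
  proof -
    obtain l where l: "l > 0" "\<And>u. l * (norm u)\<^sup>2 \<le> GM u u" using M.coercive by blast
    have bd: "norm u \<le> sqrt (1 / l)" if "GM u u = 1" for u
      using l(2)[of u] l(1) that by (intro real_le_rsqrt) (simp add: field_simps)
    have "norm w \<le> sqrt (1 / l) + sqrt (1 / l)" if "w \<in> P" for w
    proof -
      have "norm w \<le> norm (fst w) + norm (snd w)" using norm_Pair_le[of "fst w" "snd w"] by simp
      then show ?thesis using bd[of "fst w"] bd[of "snd w"] that by (simp add: P_def orthonormal_pair_def)
    qed
    then show ?thesis unfolding bounded_iff by blast
  qed
  ultimately have "compact P" by (simp add: compact_eq_bounded_closed)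
  moreover have "P \<noteq> {}"
  proof -
    obtain e where e: "onb GM UNIV {1..DIM('f)} e" using M.onb_UNIV_exists by blast
    then have "orthonormal_pair (e 1) (e 2)" using assms by (simp add: onb_def orthonormal_pair_def)
    then have "(e 1, e 2) \<in> P" by (simp add: P_def)
    then show ?thesis by blast
  qed
  moreover have "continuous_on UNIV (\<lambda>w. K (fst w) (snd w))"
    unfolding K_def by (intro continuous_on_add continuous_on_diff continuous_on_const cE c\<sigma> cf cs)
  then have "continuous_on P (\<lambda>w. K (fst w) (snd w))" by (rule continuous_on_subset) simp
  ultimately obtain w where "w \<in> P" "\<forall>z\<in>P. K (fst w) (snd w) \<le> K (fst z) (snd z)"
    using continuous_attains_inf[of P "\<lambda>w. K (fst w) (snd w)"] by blast
  then show ?thesis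
    by (intro exI[of _ "fst w"] exI[of _ "snd w"]) (auto simp: P_def)
qed

lemma rotate_pair:
  assumes "orthonormal_pair u v"
  shows "\<exists>a b. orthonormal_pair a b \<and> a \<in> span {u, v} \<and> b \<in> span {u, v} \<and> GE (\<sigma> a b) N = 0"
proof -
  obtain p r :: real where pr: "p\<^sup>2 + r\<^sup>2 = 1"
    "(GE (\<sigma> v v) N - GE (\<sigma> u u) N) * (p * r) + GE (\<sigma> u v) N * (p\<^sup>2 - r\<^sup>2) = 0"
    using ex_rotation_zero by blast
  define a where "a = p *\<^sub>R u + r *\<^sub>R v"
  define b where "b = (- r) *\<^sub>R u + p *\<^sub>R v"
  have o: "GM u u = 1" "GM v v = 1" "GM u v = 0" "GM v u = 0" using assms M.commute by (auto simp: orthonormal_pair_def)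
  have "orthonormal_pair a b"
    using pr(1) by (simp add: orthonormal_pair_def a_def b_def M.G_simps o power2_eq_square add.commute)
  moreover have "GE (\<sigma> a b) N = 0"
    using pr(2) unfolding a_def b_def \<sigma>_combination by (simp add: E.G_simps power2_eq_square algebra_simps)
  moreover have "a \<in> span {u, v}" "b \<in> span {u, v}"
    unfolding a_def b_def by (intro span_add span_scale span_base; simp)+
  ultimately show ?thesis by blast
qed

text \<open>Parseval in the normal frame splits every product of values of \<open>\<sigma>\<close>
  over the normal directions. The coefficient of \<open>\<kappa>\<close> is
  \<open>n(n-1)/2 - 1\<close>: one for each pair in \<open>\<tau>\<close>, less the one in
  \<open>K (e 1) (e 2)\<close>.\<close>

lemma defect_sum:
  assumes e: "onb GM UNIV {1..DIM('f)} e" and n: "DIM('f) \<ge> 3"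
    and N: "onb GE N J b" "finite J" and \<sigma>: "\<And>u v. \<sigma> u v \<in> N"
  shows "(real DIM('f) - 2) / (2 * (real DIM('f) - 1)) * GE (tr e) (tr e)
      + (real DIM('f) + 1) * (real DIM('f) - 2) / 2 * \<kappa> - (\<tau> e - K (e 1) (e 2)) =
    (\<Sum>r\<in>J. chen_defect DIM('f) (\<lambda>i j. GE (\<sigma> (e i) (e j)) (b r)))"
proof -
  define x where "x r i j = GE (\<sigma> (e i) (e j)) (b r)" for r i j
  let ?n = "DIM('f)"
  have prod: "GE (\<sigma> u v) (\<sigma> u' v') = (\<Sum>r\<in>J. GE (\<sigma> u v) (b r) * GE (\<sigma> u' v') (b r))" for u v u' v'
    using N \<sigma> by (intro E.parseval) (auto simp: E.onb_iff)
  have "tr e \<in> span (b ` J)"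
    using N \<sigma> unfolding tr_def by (intro span_sum) (auto simp: E.onb_iff)
  then have "GE (tr e) (tr e) = (\<Sum>r\<in>J. GE (tr e) (b r) * GE (tr e) (b r))"
    using N by (intro E.parseval) (auto simp: E.onb_iff)
  then have T: "GE (tr e) (tr e) = (\<Sum>r\<in>J. (\<Sum>i\<in>{1..?n}. x r i i)\<^sup>2)"
    by (simp add: tr_def E.G_sum_left x_def power2_eq_square)
  have k: "K (e i) (e j) = \<kappa> + (\<Sum>r\<in>J. x r i i * x r j j - (x r i j)\<^sup>2)" for i j
    by (simp add: K_def prod x_def sum_subtractf power2_eq_square)
  have pairs: "(\<Sum>j\<in>{1..?n}. \<Sum>i\<in>{1..<j}. (1::real)) = real ?n * (real ?n - 1) / 2"
    using sum_pairs_symmetric[of "\<lambda>_ _. 1" ?n] by (simp add: algebra_simps)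
  have "\<tau> e = (\<Sum>j\<in>{1..?n}. \<Sum>i\<in>{1..<j}. \<kappa> * 1) + (\<Sum>j\<in>{1..?n}. \<Sum>i\<in>{1..<j}. \<Sum>r\<in>J. x r i i * x r j j - (x r i j)\<^sup>2)"
    by (simp only: \<tau>_def k sum.distrib mult_1_right)
  also have "(\<Sum>j\<in>{1..?n}. \<Sum>i\<in>{1..<j}. \<kappa> * 1) = \<kappa> * (real ?n * (real ?n - 1) / 2)"
    unfolding pairs[symmetric] sum_distrib_left ..
  also have "(\<Sum>j\<in>{1..?n}. \<Sum>i\<in>{1..<j}. \<Sum>r\<in>J. x r i i * x r j j - (x r i j)\<^sup>2)
      = (\<Sum>r\<in>J. \<Sum>j\<in>{1..?n}. \<Sum>i\<in>{1..<j}. x r i i * x r j j - (x r i j)\<^sup>2)"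
    unfolding sum.swap[of _ J] ..
  finally have t: "\<tau> e = \<kappa> * (real ?n * (real ?n - 1) / 2)
      + (\<Sum>r\<in>J. \<Sum>j\<in>{1..?n}. \<Sum>i\<in>{1..<j}. x r i i * x r j j - (x r i j)\<^sup>2)" .
  have "(\<Sum>r\<in>J. chen_defect ?n (x r)) = (real ?n - 2) / (2 * (real ?n - 1)) * GE (tr e) (tr e)
      - (\<Sum>r\<in>J. \<Sum>j\<in>{1..?n}. \<Sum>i\<in>{1..<j}. x r i i * x r j j - (x r i j)\<^sup>2) + (K (e 1) (e 2) - \<kappa>)"
    unfolding chen_defect_def sum.distrib sum_subtractf[of _ _ J] T k sum_distrib_left[symmetric] by simp
  moreover have "(real ?n + 1) * (real ?n - 2) / 2 * \<kappa> = \<kappa> * (real ?n * (real ?n - 1) / 2) - \<kappa>"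
    by (simp add: field_simps)
  ultimately have "(real ?n - 2) / (2 * (real ?n - 1)) * GE (tr e) (tr e)
      + (real ?n + 1) * (real ?n - 2) / 2 * \<kappa> - (\<tau> e - K (e 1) (e 2)) = (\<Sum>r\<in>J. chen_defect ?n (x r))"
    unfolding t by linarith
  then show ?thesis by (simp add: x_def[abs_def])
qed

lemma pair_extend:
  assumes "orthonormal_pair u v" "2 \<le> DIM('f)"
  shows "\<exists>e. onb GM UNIV {1..DIM('f)} e \<and> e 1 = u \<and> e 2 = v"
proof -
  define e0 where "e0 i = (if i = 1 then u else v)" for i :: nat
  have "M.orthonormal_on {1, 2} e0"
    using assms M.commute[of v u] by (auto simp: M.orthonormal_on_def e0_def orthonormal_pair_def)
  then obtain e where "\<forall>j\<in>{1, 2}. e j = e0 j" "onb GM UNIV {1..DIM('f)} e"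
    using M.onb_extend[of UNIV "{1..DIM('f)}" "{1, 2}" e0] assms(2) by auto
  then show ?thesis by (intro exI[of _ e]) (auto simp: e0_def)
qed

lemma plane_section_orthonormal:
  "plane_section \<pi> \<longleftrightarrow> (\<exists>u v. orthonormal_pair u v \<and> \<pi> = span {u, v})"
proof
  assume \<pi>: "plane_section \<pi>"
  then obtain e where e: "onb GM \<pi> {1, 2} e"
    using M.onb_exists[of \<pi> "{1, 2}"] by (auto simp: plane_section_def)
  then have "orthonormal_pair (e 1) (e 2) \<and> \<pi> = span {e 1, e 2}"
    by (auto simp: onb_def orthonormal_pair_def)
  then show "\<exists>u v. orthonormal_pair u v \<and> \<pi> = span {u, v}" by blast
next
  assume "\<exists>u v. orthonormal_pair u v \<and> \<pi> = span {u, v}"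
  then obtain u v where uv: "orthonormal_pair u v" "\<pi> = span {u, v}" by blast
  define e where "e i = (if i = 1 then u else v)" for i :: nat
  have "M.orthonormal_on {1, 2} e"
    using uv M.commute[of v u] by (auto simp: M.orthonormal_on_def e_def orthonormal_pair_def)
  moreover have "e ` {1, 2} = {u, v}" by (auto simp: e_def)
  ultimately have "dim (span {u, v}) = card {1, 2::nat}" using M.orthonormal_dim[of "{1, 2}" e] by simp
  then have "dim (span {u, v}) = 2" by (simp add: numeral_2_eq_2)
  then show "plane_section \<pi>" by (simp add: plane_section_def uv subspace_span)
qed

end

section \<open>Submanifolds of generalized \<open>(\<kappa>,\<mu>)\<close>-contact space forms\<close>

locale space_form_submanifold = C_totally_real_submanifold A B \<iota> \<phi> \<xi> \<eta> g
  for A :: "('p::{t2_space, second_countable_topology}, 'e::euclidean_space) chart set"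
    and B :: "('q::{t2_space, second_countable_topology}, 'f::euclidean_space) chart set"
    and \<iota> \<phi> \<xi> \<eta> g +
  fixes f1 f2 f3 f4 f5 f6 :: "'p \<Rightarrow> real"
  assumes form: "gen_km_space_form A \<phi> \<xi> \<eta> g f1 f2 f3 f4 f5 f6" and f3: "f3 p = f1 p - 1"
begin

context
  fixes q :: 'q
begin

abbreviation "G \<equiv> g (\<iota> q)"
abbreviation "GM \<equiv> gM q"
abbreviation "N \<equiv> normal_vectors B A \<iota> g q"
abbreviation "h \<equiv> h_tensor A \<xi> \<phi> (\<iota> q)"

interpretation E: inner_prod G
  by (rule A.inner_prod_metric[OF metric])

lemma linear_\<phi>: "linear (\<phi> (\<iota> q))"
  using acm by (simp add: almost_contact_metric_def endo_field_def)

lemma linear_\<eta>: "linear (\<eta> (\<iota> q))"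
  using acm by (simp add: almost_contact_metric_def one_form_def)

lemma riemann: "riemann_at A g (\<iota> q) X Y Z =
   f1 (\<iota> q) *\<^sub>R R1 G X Y Z + f2 (\<iota> q) *\<^sub>R R2 G (\<phi> (\<iota> q)) X Y Z
   + f3 (\<iota> q) *\<^sub>R R3 G (\<eta> (\<iota> q)) (\<xi> (\<iota> q)) X Y Z + f4 (\<iota> q) *\<^sub>R R4 G h X Y Z
   + f5 (\<iota> q) *\<^sub>R R5 G (\<phi> (\<iota> q)) h X Y Z + f6 (\<iota> q) *\<^sub>R R6 G (\<eta> (\<iota> q)) (\<xi> (\<iota> q)) h X Y Z"
  using form by (simp add: gen_km_space_form_def Let_def)

lemma G_\<xi>_left: "G (\<xi> (\<iota> q)) u = \<eta> (\<iota> q) u"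
  using E.commute[of "\<xi> (\<iota> q)" u] by (simp add: point(2,3,6))

text \<open>\<open>R2\<close> and \<open>R5\<close> vanish here by \<open>\<phi> \<xi> = 0\<close>
  and \<open>h \<xi> = 0\<close>, while \<open>R3\<close> and \<open>R6\<close> are the negatives of
  \<open>R1\<close> and \<open>R4\<close>. The hypothesis on \<open>f3\<close> gives the difference
  \<open>f1 - f3\<close> the value 1.\<close>

lemma riemann_\<xi>: "riemann_at A g (\<iota> q) u (\<xi> (\<iota> q)) (\<xi> (\<iota> q)) =
    (u - \<eta> (\<iota> q) u *\<^sub>R \<xi> (\<iota> q)) + (f4 (\<iota> q) - f6 (\<iota> q)) *\<^sub>R h u"
  unfolding riemann R1_def R2_def R3_def R4_def R5_def R6_def
  by (simp add: point(2-4) point(6) G_\<xi>_left h_\<xi> \<eta>_h E.G_simps linear_0[OF linear_\<phi>] linear_0[OF linear_\<eta>] f3 algebra_simps)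

lemma h_0: "h u = 0" and sff_\<xi>: "G (sff q a b) (\<xi> (\<iota> q)) = 0"
  using sasakian[OF riemann_\<xi>] by blast+

lemma inner_prod_gM: "inner_prod GM"
proof -
  interpret L: local_integral "S q" "metric_rep A (d q) g" "U q" "F q" "metric_rep B (c q) gM" "endo_rep A (d q) \<phi>" "vec_rep A (d q) \<xi>" "form_rep A (d q) \<eta>"
    by (rule local_integral)
  show ?thesis using L.inner_gM[OF x_U] by (simp add: metric_rep_x)
qed

interpretation P: gauss_point GM G "sff q" "f1 (\<iota> q)"
  by (intro gauss_point.intro gauss_point_axioms.intro inner_prod_gM E.inner_prod_axioms linear_sff sff_commute)

lemma gM_D: "GM a b = G (D q a) (D q b)"
  by (simp add: induced_metric_def)

text \<open>\<open>R4\<close>, \<open>R5\<close>, \<open>R6\<close> go with \<open>h\<close>,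
  \<open>R3\<close> goes because \<open>\<eta>\<close> vanishes on tangent vectors, and
  \<open>R2\<close> because \<open>\<phi>\<close> maps them to normal ones.\<close>

lemma riemann_M: "GM (riemann_at B gM q a b b) a =
    f1 (\<iota> q) * (GM a a * GM b b - (GM a b)\<^sup>2) + G (sff q a a) (sff q b b) - G (sff q a b) (sff q a b)"
proof -
  have "G (riemann_at A g (\<iota> q) (D q a) (D q b) (D q b)) (D q a) = f1 (\<iota> q) * (GM a a * GM b b - (GM a b)\<^sup>2)"
    unfolding riemann R1_def R2_def R3_def R4_def R5_def R6_def
    by (simp add: h_0 \<eta>_differential \<phi>_tangent E.G_simps linear_0[OF linear_\<phi>] gM_D power2_eq_square
        E.commute[of "D q b" "D q a"] algebra_simps)
  then show ?thesis
    using gauss_equation[of q a b b a] sff_commute[of q b a] E.commute[of "sff q b b"] by simp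
qed

lemma sectional_curvature_eq:
  assumes uv: "P.orthonormal_pair u v"
  shows "sectional_curvature B gM q (span {u, v}) = P.K u v"
  unfolding sectional_curvature_def
proof (rule the_equality)
  have K: "GM (riemann_at B gM q a b b) a = P.K a b" if "P.orthonormal_pair a b" for a b
    using that by (simp add: riemann_M P.K_def P.orthonormal_pair_def)
  show "\<forall>a\<in>span {u, v}. \<forall>b\<in>span {u, v}. GM a a = 1 \<longrightarrow> GM b b = 1 \<longrightarrow> GM a b = 0 \<longrightarrow>
      P.K u v = GM (riemann_at B gM q a b b) a"
    using K P.K_eq_of_span[OF uv] by (simp add: P.orthonormal_pair_def)
  show "k = P.K u v" if "\<forall>a\<in>span {u, v}. \<forall>b\<in>span {u, v}. GM a a = 1 \<longrightarrow> GM b b = 1 \<longrightarrow> GM a b = 0 \<longrightarrow>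
      k = GM (riemann_at B gM q a b b) a" for k
  proof -
    have "u \<in> span {u, v}" "v \<in> span {u, v}" by (simp_all add: span_base)
    then show ?thesis using that uv K[OF uv] by (simp add: P.orthonormal_pair_def)
  qed
qed

text \<open>The frame in \<open>\<tau>\<close> is left free, independently of the minimizing pair,
  so that it can be adapted afterwards.\<close>

lemma delta_eq:
  assumes n: "DIM('f) \<ge> 3" and e: "onb GM UNIV {1..DIM('f)} e"
  shows "\<exists>u v. P.orthonormal_pair u v \<and> (\<forall>a b. P.orthonormal_pair a b \<longrightarrow> P.K u v \<le> P.K a b)
    \<and> delta_invariant B gM q = P.\<tau> e - P.K u v"
proof -
  obtain u v where uv: "P.orthonormal_pair u v" "\<And>a b. P.orthonormal_pair a b \<Longrightarrow> P.K u v \<le> P.K a b"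
    using P.K_attains_inf n by fastforce
  have set: "{sectional_curvature B gM q \<pi> |\<pi>. plane_section \<pi>} = {P.K a b |a b. P.orthonormal_pair a b}"
    using sectional_curvature_eq by (auto simp: P.plane_section_orthonormal) metis
  have inf: "inf_K B gM q = P.K u v"
    unfolding inf_K_def set using uv by (intro cInf_eq_minimum) auto
  define e' where "e' = (SOME e. onb GM UNIV {1..DIM('f)} e)"
  have e': "onb GM UNIV {1..DIM('f)} e'" unfolding e'_def using e by (rule someI[of "onb GM UNIV {1..DIM('f)}"])
  have "sectional_curvature B gM q (span {e' i, e' j}) = P.K (e' i) (e' j)"
    if "j \<in> {1..DIM('f)}" "i \<in> {1..<j}" for i j
    using e' that by (intro sectional_curvature_eq) (auto simp: onb_def P.orthonormal_pair_def)
  then have "scalar_curvature B gM q = P.\<tau> e'"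
    unfolding scalar_curvature_def P.\<tau>_def Let_def e'_def[symmetric] by (intro sum.cong refl)
  then have "delta_invariant B gM q = P.\<tau> e - P.K u v"
    by (simp add: delta_invariant_def inf P.\<tau>_eq[OF e e'])
  then show ?thesis using uv by blast
qed

lemma mean_curvature_eq:
  assumes e: "onb GM UNIV {1..DIM('f)} e"
  shows "mean_curvature B A \<iota> g q = (1 / real DIM('f)) *\<^sub>R P.tr e"
proof -
  define e' where "e' = (SOME e. onb GM UNIV {1..DIM('f)} e)"
  have e': "onb GM UNIV {1..DIM('f)} e'" unfolding e'_def using e by (rule someI[of "onb GM UNIV {1..DIM('f)}"])
  show ?thesis
    unfolding P.tr_eq[OF e e'] unfolding mean_curvature_def P.tr_def Let_def e'_def[symmetric] ..
qed

section \<open>The normal space and adapted frames\<close>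

lemma subspace_N: "subspace N"
  by (auto simp: normal_vectors_def subspace_def E.G_simps)

lemma sff_N: "sff q a b \<in> N"
  by (simp add: normal_vectors_def sff_normal)

lemma \<xi>_N: "\<xi> (\<iota> q) \<in> N"
  using C_totally_real by (simp add: C_totally_real_def)

text \<open>The image of a tangent frame is orthonormal and extends to an ambient frame; the added
  vectors span the normal space.\<close>

lemma dim_N: "dim N = DIM('e) - DIM('f)"
proof -
  obtain e where e: "onb GM UNIV {1..DIM('f)} e" using P.M.onb_UNIV_exists by blast
  let ?I = "{1..DIM('e)}" and ?J = "{1..DIM('f)}"
  have o: "E.orthonormal_on ?J (\<lambda>i. D q (e i))"
    using e by (simp add: E.orthonormal_on_def onb_def gM_D)
  have le: "DIM('f) \<le> DIM('e)"
    using E.orthonormal_dim[OF o] dim_subset_UNIV[of "span ((\<lambda>i. D q (e i)) ` ?J)"] by simp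
  then obtain b where b: "\<forall>j\<in>?J. b j = D q (e j)" "onb G UNIV ?I b"
    using E.onb_extend[of UNIV ?I ?J "\<lambda>i. D q (e i)"] o by auto
  have "N = {v. \<forall>j\<in>?J. G v (b j) = 0}"
  proof (intro set_eqI iffI)
    fix v assume "v \<in> {v. \<forall>j\<in>?J. G v (b j) = 0}"
    then have z: "G v (D q (e j)) = 0" if "j \<in> ?J" for j using b(1) that by auto
    have "G v (D q a) = 0" for a
    proof -
      have "a = (\<Sum>i\<in>?J. GM a (e i) *\<^sub>R e i)"
        using e by (intro P.M.expand) (auto simp: P.M.onb_iff)
      then have "D q a = D q (\<Sum>i\<in>?J. GM a (e i) *\<^sub>R e i)" by (rule arg_cong)
      also have "\<dots> = (\<Sum>i\<in>?J. GM a (e i) *\<^sub>R D q (e i))"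
        by (simp only: linear_sum[OF linear_D] linear_cmul[OF linear_D])
      finally have "D q a = (\<Sum>i\<in>?J. GM a (e i) *\<^sub>R D q (e i))" .
      then show ?thesis using z by (simp add: E.G_sum_right E.G_simps)
    qed
    then show "v \<in> N" by (simp add: normal_vectors_def)
  qed (use b(1) in \<open>auto simp: normal_vectors_def\<close>)
  also have "\<dots> = span (b ` (?I - ?J))" using b(2) le by (intro E.complement_span) auto
  finally have "dim N = card (?I - ?J)"
    using b(2) E.orthonormal_dim[OF E.orthonormal_on_subset[of ?I b "?I - ?J"]] by (simp add: E.onb_iff)
  then show ?thesis using le by (simp add: card_Diff_subset)
qed

text \<open>Applied to the trace of the second fundamental form: the first normal vector spans its
  direction and the last one is \<open>\<xi>\<close>. All shape operators in between are then
  traceless.\<close>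

lemma normal_frame:
  assumes n: "DIM('f) = n" "DIM('e) = 2 * m + 1" and t: "t \<in> N" "G t (\<xi> (\<iota> q)) = 0"
  shows "n + 1 \<le> 2 * m \<and> (\<exists>b. onb G N {n+1..2*m+1} b \<and> b (2*m+1) = \<xi> (\<iota> q)
    \<and> (\<forall>r\<in>{n+2..2*m+1}. G t (b r) = 0))"
proof -
  have \<xi>1: "G (\<xi> (\<iota> q)) (\<xi> (\<iota> q)) = 1" by (simp add: point(2,3,6))
  obtain w k where w: "w \<in> N" "G w (\<xi> (\<iota> q)) = 0" "G w w = 1" "t = k *\<^sub>R w"
  proof (cases "t = 0")
    \<comment> \<open>With \<open>t = 0\<close> the direction is free, but a unit normal orthogonal
      to \<open>\<xi>\<close> must still be produced: \<open>\<phi>\<close> maps tangent vectors to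
      such normals and preserves length on the kernel of \<open>\<eta>\<close>.\<close>
    case True
    obtain e where e: "onb GM UNIV {1..DIM('f)} e" using P.M.onb_UNIV_exists by blast
    then have e1: "GM (e 1) (e 1) = 1" by (simp add: onb_def)
    show ?thesis
    proof (rule that[of "\<phi> (\<iota> q) (D q (e 1))" 0])
      show "\<phi> (\<iota> q) (D q (e 1)) \<in> N"
        using \<phi>_tangent E.commute by (simp add: normal_vectors_def) 
      show "G (\<phi> (\<iota> q) (D q (e 1))) (\<xi> (\<iota> q)) = 0" by (simp add: point(2,3,6))
      show "G (\<phi> (\<iota> q) (D q (e 1))) (\<phi> (\<iota> q) (D q (e 1))) = 1"
        using point(5)[of "\<iota> q" "D q (e 1)" "D q (e 1)"] e1 by (simp add: gM_D \<eta>_differential)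
    qed (simp add: True)
  next
    case False
    then have p: "G t t > 0" by (rule E.pos)
    show ?thesis
      by (rule that[of "(1 / sqrt (G t t)) *\<^sub>R t" "sqrt (G t t)"])
        (use p t subspace_N in \<open>auto simp: E.G_simps subspace_scale\<close>)
  qed
  define p where "p i = (if i = 0 then w else \<xi> (\<iota> q))" for i :: nat
  have "E.orthonormal_on {0, 1} p"
    using w \<xi>1 E.commute[of "\<xi> (\<iota> q)" w] by (auto simp: E.orthonormal_on_def p_def)
  moreover have "p ` {0, 1} = {w, \<xi> (\<iota> q)}" by (auto simp: p_def)
  ultimately have "dim (span {w, \<xi> (\<iota> q)}) = card {0, 1::nat}" using E.orthonormal_dim[of "{0, 1}" p] by simp
  then have "dim (span {w, \<xi> (\<iota> q)}) = 2" by (simp add: numeral_2_eq_2)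
  moreover have "span {w, \<xi> (\<iota> q)} \<subseteq> N" using w \<xi>_N subspace_N by (intro span_minimal) auto
  \<comment> \<open>Two orthonormal normals leave room for both prescribed slots: \<open>n+1\<close>
    and \<open>2*m+1\<close> are different indices.\<close>
  ultimately have "2 \<le> dim N" by (metis dim_subset)
  then have nm: "n + 1 \<le> 2 * m" using dim_N n by simp
  define b0 where "b0 r = (if r = n + 1 then w else \<xi> (\<iota> q))" for r
  have "E.orthonormal_on {n+1, 2*m+1} b0"
    using w \<xi>1 nm E.commute[of "\<xi> (\<iota> q)" w] by (auto simp: E.orthonormal_on_def b0_def)
  moreover have "card {n+1..2*m+1} = dim N" using dim_N n by simp
  moreover have "b0 ` {n+1, 2*m+1} \<subseteq> N" using w \<xi>_N by (auto simp: b0_def)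
  moreover have "{n+1, 2*m+1} \<subseteq> {n+1..2*m+1}" using nm by auto
  ultimately obtain b where b: "\<forall>r\<in>{n+1, 2*m+1}. b r = b0 r" "onb G N {n+1..2*m+1} b"
    using E.onb_extend[OF subspace_N] by (metis finite_atLeastAtMost)
  have b': "b (n + 1) = w" "b (2*m+1) = \<xi> (\<iota> q)" using b(1) nm by (auto simp: b0_def)
  have "G t (b r) = 0" if "r \<in> {n+2..2*m+1}" for r
    using b(2) that nm by (auto simp: onb_def w(4) E.G_simps simp flip: b'(1))
  then show ?thesis using nm b(2) b'(2) by blast
qed

lemma shape_operator: "GM (shape_operator B A \<iota> g q \<nu> a) b = G (sff q a b) \<nu>"
proof -
  have "linear (\<lambda>b. G (sff q a b) \<nu>)"
    using linear_compose[OF linear_sff[of q a] E.lin_left] by (simp add: o_def)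
  then show ?thesis
    unfolding shape_operator_def by (rule P.M.representable[THEN theI', THEN spec])
qed

lemma matrix_form_iff:
  assumes e: "onb GM UNIV {1..n} e"
  shows "matrix_form n e (shape_operator B A \<iota> g q \<nu>) Q \<longleftrightarrow>
    (\<forall>j\<in>{1..n}. \<forall>i\<in>{1..n}. G (sff q (e i) (e j)) \<nu> = Q i j)"
proof -
  have o: "P.M.orthonormal_on {1..n} e" using e by (simp add: P.M.onb_iff)
  have "shape_operator B A \<iota> g q \<nu> (e j) = (\<Sum>i\<in>{1..n}. Q i j *\<^sub>R e i) \<longleftrightarrow>
      (\<forall>i\<in>{1..n}. G (sff q (e i) (e j)) \<nu> = Q i j)" for j
  proof
    assume s: "shape_operator B A \<iota> g q \<nu> (e j) = (\<Sum>i\<in>{1..n}. Q i j *\<^sub>R e i)"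
    show "\<forall>i\<in>{1..n}. G (sff q (e i) (e j)) \<nu> = Q i j"
    proof
      fix i assume i: "i \<in> {1..n}"
      have "GM (shape_operator B A \<iota> g q \<nu> (e j)) (e i) = Q i j"
        unfolding s using P.M.coeff_sum[OF o _ i, of "\<lambda>i. Q i j"] by simp
      then show "G (sff q (e i) (e j)) \<nu> = Q i j" by (simp add: shape_operator sff_commute[of q "e j"])
    qed
  next
    assume a: "\<forall>i\<in>{1..n}. G (sff q (e i) (e j)) \<nu> = Q i j"
    have "shape_operator B A \<iota> g q \<nu> (e j) = (\<Sum>i\<in>{1..n}. GM (shape_operator B A \<iota> g q \<nu> (e j)) (e i) *\<^sub>R e i)"
      using e by (intro P.M.expand) (auto simp: P.M.onb_iff)
    also have "\<dots> = (\<Sum>i\<in>{1..n}. Q i j *\<^sub>R e i)"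
      using a by (intro sum.cong refl) (simp add: shape_operator sff_commute[of q "e j"])
    finally show "shape_operator B A \<iota> g q \<nu> (e j) = (\<Sum>i\<in>{1..n}. Q i j *\<^sub>R e i)" .
  qed
  then show ?thesis by (simp add: matrix_form_def)
qed

text \<open>The frames are adapted before anything is assumed about equality. A single identity,
  \<open>gap\<close>, then yields the inequality because defects are nonnegative, and the matrix
  forms because they vanish one by one.\<close>

theorem chen_inequality:
  assumes n: "n \<ge> 3" "DIM('f) = n" "DIM('e) = 2 * m + 1"
  defines "H \<equiv> mean_curvature B A \<iota> g q" and "SO \<equiv> shape_operator B A \<iota> g q"
    and "bound \<equiv> (real n)\<^sup>2 * (real n - 2) / (2 * (real n - 1)) * G (mean_curvature B A \<iota> g q) (mean_curvature B A \<iota> g q)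
      + (real n + 1) * (real n - 2) / 2 * f1 (\<iota> q)"
  shows "delta_invariant B gM q \<le> bound" (is ?le)
    and "delta_invariant B gM q = bound \<longleftrightarrow>
       (\<exists>\<pi> e E a b c d. plane_section \<pi> \<and> onb GM UNIV {1..n} e \<and> onb G N {n+1..2*m+1} E \<and>
          E (2*m+1) = \<xi> (\<iota> q) \<and> \<pi> = span {e 1, e 2} \<and>
          matrix_form n e (SO (E (n+1))) (matrix_ab a b) \<and>
          (\<forall>r\<in>{n+2..2*m}. matrix_form n e (SO (E r)) (matrix_cd (c r) (d r))) \<and>
          (\<forall>v. SO (\<xi> (\<iota> q)) v = 0))" (is "_ \<longleftrightarrow> ?R")
proof -
  define x where "x e b r i j = G (sff q (e i) (e j)) (b r)" for e :: "nat \<Rightarrow> 'f" and b :: "nat \<Rightarrow> 'e" and r i j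
  \<comment> \<open>The frames need not be adapted: the last bracket measures how far the plane of
    \<open>e 1\<close>, \<open>e 2\<close> is from the comparison pair \<open>u\<close>,
    \<open>v\<close>. The converse direction uses this for a frame about which only the matrix forms
    are known.\<close>
  have \<delta>: "bound - delta_invariant B gM q = (\<Sum>r\<in>{n+1..2*m+1}. chen_defect n (x e b r)) - (P.K (e 1) (e 2) - P.K u v)"
    if "onb GM UNIV {1..n} e" "onb G N {n+1..2*m+1} b" "delta_invariant B gM q = P.\<tau> e - P.K u v" for e b u v
  proof -
    have e: "onb GM UNIV {1..DIM('f)} e" using that(1) n(2) by simp
    have "bound = (real n - 2) / (2 * (real n - 1)) * G (P.tr e) (P.tr e) + (real n + 1) * (real n - 2) / 2 * f1 (\<iota> q)"
      using n by (simp add: bound_def mean_curvature_eq[OF e] E.G_simps field_simps power2_eq_square)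
    then show ?thesis
      using P.defect_sum[OF e _ that(2) _ sff_N] n that(3) by (simp add: x_def[abs_def])
  qed
  obtain e0 where e0: "onb GM UNIV {1..n} e0" using P.M.onb_UNIV_exists n by auto
  have tN: "P.tr e \<in> N" for e unfolding P.tr_def using subspace_N sff_N by (intro subspace_sum) auto
  have t\<xi>: "G (P.tr e) (\<xi> (\<iota> q)) = 0" for e by (simp add: P.tr_def E.G_sum_left sff_\<xi>)
  obtain b where nm: "n + 1 \<le> 2 * m" and b: "onb G N {n+1..2*m+1} b" "b (2*m+1) = \<xi> (\<iota> q)"
    "\<And>r. r \<in> {n+2..2*m+1} \<Longrightarrow> G (P.tr e0) (b r) = 0"
    using normal_frame[OF n(2,3) tN t\<xi>, of e0] by blast
  obtain u v where uv: "P.orthonormal_pair u v" "\<And>a b. P.orthonormal_pair a b \<Longrightarrow> P.K u v \<le> P.K a b"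
    "delta_invariant B gM q = P.\<tau> e0 - P.K u v"
    using delta_eq e0 n by metis
  have \<delta>e: "delta_invariant B gM q = P.\<tau> e - P.K u v" if "onb GM UNIV {1..n} e" for e
    using uv(3) P.\<tau>_eq[of e0 e] e0 that n by simp
  have o: "P.orthonormal_pair (e 1) (e 2)" if "onb GM UNIV {1..n} e" for e
    using that n by (simp add: onb_def P.orthonormal_pair_def)
  \<comment> \<open>Rotating inside the minimizing plane keeps \<open>K\<close> and makes the upper
    left block of the shape operator of \<open>b (n+1)\<close> diagonal.\<close>
  obtain p r where pr: "P.orthonormal_pair p r" "p \<in> span {u, v}" "r \<in> span {u, v}" "G (sff q p r) (b (n+1)) = 0"
    using P.rotate_pair[OF uv(1)] by blast
  have Kpr: "P.K p r = P.K u v" using P.K_eq_of_span[OF uv(1) pr(1-3)] .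
  obtain e where e: "onb GM UNIV {1..n} e" "e 1 = p" "e 2 = r"
    using P.pair_extend[OF pr(1)] n by auto
  have gap: "bound - delta_invariant B gM q = (\<Sum>s\<in>{n+1..2*m+1}. chen_defect n (x e b s))"
    using \<delta>[OF e(1) b(1) \<delta>e[OF e(1)]] e Kpr by simp
  then show le: ?le using chen_defect_nonneg[OF n(1)] by (metis diff_ge_0_iff_ge sum_nonneg)
  show "delta_invariant B gM q = bound \<longleftrightarrow> ?R"
  proof
    assume "delta_invariant B gM q = bound"
    then have "(\<Sum>s\<in>{n+1..2*m+1}. chen_defect n (x e b s)) = 0" using gap by simp
    then have "\<forall>s\<in>{n+1..2*m+1}. chen_defect n (x e b s) = 0"
      by (subst (asm) sum_nonneg_eq_0_iff) (auto intro: chen_defect_nonneg[OF n(1)])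
    then have shape: "(\<forall>i\<in>{3..n}. x e b s i i = x e b s 1 1 + x e b s 2 2) \<and>
        (\<forall>j\<in>{1..n}. \<forall>i\<in>{1..<j}. (i, j) \<noteq> (1, 2) \<longrightarrow> x e b s i j = 0)" if "s \<in> {n+1..2*m+1}" for s
      using that chen_defect_eq_0_iff[OF n(1)] by blast
    have sym: "x e b s i j = x e b s j i" for s i j by (simp add: x_def sff_commute[of q "e i"])
    have diag: "x e b s i i = x e b s 1 1 + x e b s 2 2" if "s \<in> {n+1..2*m+1}" "i \<in> {3..n}" for s i
      using shape that by blast
    have off: "x e b s i j = 0" if "s \<in> {n+1..2*m+1}" "i \<in> {1..n}" "j \<in> {1..n}" "i \<noteq> j"
      "(i, j) \<noteq> (1, 2)" "(i, j) \<noteq> (2, 1)" for s i j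
    proof (cases "i < j")
      case True then show ?thesis using shape[OF that(1)] that by auto
    next
      case False then have "x e b s j i = 0" using shape[OF that(1)] that by auto
      then show ?thesis by (simp add: sym[of s i])
    qed
    \<comment> \<open>\<open>b s\<close> is orthogonal to the trace of the second fundamental form.
      With vanishing defect that trace contributes \<open>n - 1\<close> copies of
      \<open>x 1 1 + x 2 2\<close>, one from the block and \<open>n - 2\<close> from the other
      diagonal entries.\<close>
    have traceless: "x e b s 2 2 = - x e b s 1 1" if s: "s \<in> {n+2..2*m}" for s
    proof -
      have s': "s \<in> {n+1..2*m+1}" using s by auto
      have "P.tr e = P.tr e0" using P.tr_eq[of e e0] e(1) e0 n(2) by simp
      then have "G (P.tr e) (b s) = 0" using b(3)[of s] s by simp
      then have "(\<Sum>i\<in>{1..n}. x e b s i i) = 0" using n(2) by (simp add: P.tr_def E.G_sum_left x_def)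
      also have "(\<Sum>i\<in>{1..n}. x e b s i i) = x e b s 1 1 + x e b s 2 2 + (\<Sum>i\<in>{3..n}. x e b s i i)"
        using n by (intro sum_split_two) simp
      also have "(\<Sum>i\<in>{3..n}. x e b s i i) = (\<Sum>i\<in>{3..n}. x e b s 1 1 + x e b s 2 2)"
        by (intro sum.cong refl diag[OF s'])
      also have "\<dots> = (real n - 2) * (x e b s 1 1 + x e b s 2 2)" using n by (simp add: of_nat_diff)
      finally have "(real n - 1) * (x e b s 1 1 + x e b s 2 2) = 0" by (simp add: algebra_simps)
      moreover have "real n - 1 \<noteq> 0" using n by simp
      ultimately have "x e b s 1 1 + x e b s 2 2 = 0" by (simp only: mult_eq_0_iff) simp
      then show ?thesis by linarith
    qed
    show ?R
    proof (intro exI conjI ballI allI)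
      show "plane_section (span {e 1, e 2})" using P.plane_section_orthonormal o[OF e(1)] by blast
      show "onb GM UNIV {1..n} e" "onb G N {n+1..2*m+1} b" "b (2*m+1) = \<xi> (\<iota> q)" by fact+
      show "span {e 1, e 2} = span {e 1, e 2}" ..
      have z: "x e b (n+1) 1 2 = 0" using pr(4) e by (simp add: x_def)
      show "matrix_form n e (SO (b (n+1))) (matrix_ab (x e b (n+1) 1 1) (x e b (n+1) 2 2))"
        unfolding SO_def matrix_form_iff[OF e(1)] x_def[symmetric]
      proof (intro ballI)
        fix j i assume ij: "j \<in> {1..n}" "i \<in> {1..n}"
        have s: "n + 1 \<in> {n+1..2*m+1}" using nm by simp
        show "x e b (n+1) i j = matrix_ab (x e b (n+1) 1 1) (x e b (n+1) 2 2) i j"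
        proof (cases "i = j")
          case True
          then consider "i = 1" | "i = 2" | "i \<in> {3..n}" using ij by force
          then show ?thesis using True diag[OF s] by cases (auto simp: matrix_ab_def)
        next
          case False
          then show ?thesis using off[OF s ij(2,1)] z sym[of "n+1" 2 1] by (auto simp: matrix_ab_def)
        qed
      qed
      fix s assume s: "s \<in> {n+2..2*m}"
      then have s': "s \<in> {n+1..2*m+1}" by auto
      show "matrix_form n e (SO (b s)) (matrix_cd (x e b s 1 1) (x e b s 1 2))"
        unfolding SO_def matrix_form_iff[OF e(1)] x_def[symmetric]
      proof (intro ballI)
        fix j i assume ij: "j \<in> {1..n}" "i \<in> {1..n}"
        show "x e b s i j = matrix_cd (x e b s 1 1) (x e b s 1 2) i j"
        proof (cases "i = j")
          case True
          then consider "i = 1" | "i = 2" | "i \<in> {3..n}" using ij by force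
          then show ?thesis using True diag[OF s'] traceless[OF s] by cases (auto simp: matrix_cd_def)
        next
          case False
          then show ?thesis using off[OF s' ij(2,1)] sym[of s 2 1] by (auto simp: matrix_cd_def)
        qed
      qed
    next
      fix v
      have "GM (SO (\<xi> (\<iota> q)) v) w = GM 0 w" for w
        unfolding SO_def by (simp add: shape_operator sff_\<xi> P.M.G_simps)
      then show "SO (\<xi> (\<iota> q)) v = 0" by (rule P.M.nondeg)
    qed
  next
    assume ?R
    then obtain e E a b c d where e: "onb GM UNIV {1..n} e" and E: "onb G N {n+1..2*m+1} E" "E (2*m+1) = \<xi> (\<iota> q)"
      and ab: "matrix_form n e (SO (E (n+1))) (matrix_ab a b)"
      and cd: "\<And>r. r \<in> {n+2..2*m} \<Longrightarrow> matrix_form n e (SO (E r)) (matrix_cd (c r) (d r))"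
      by blast
    have "chen_defect n (x e E r) = 0" if r: "r \<in> {n+1..2*m+1}" for r
    proof -
      consider "r = n + 1" | "r \<in> {n+2..2*m}" | "r = 2*m+1" using r by force
      then show ?thesis
      proof cases
        case 1
        then have "x e E r i j = matrix_ab a b i j" if "i \<in> {1..n}" "j \<in> {1..n}" for i j
          using ab that unfolding SO_def matrix_form_iff[OF e] by (simp add: x_def)
        then show ?thesis using n unfolding chen_defect_eq_0_iff[OF n(1)] by (auto simp: matrix_ab_def)
      next
        case 2
        then have "x e E r i j = matrix_cd (c r) (d r) i j" if "i \<in> {1..n}" "j \<in> {1..n}" for i j
          using cd that unfolding SO_def matrix_form_iff[OF e] by (simp add: x_def)
        then show ?thesis using n unfolding chen_defect_eq_0_iff[OF n(1)] by (auto simp: matrix_cd_def)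
      next
        case 3
        have "x e E r i j = 0" for i j unfolding x_def 3 E(2) by (rule sff_\<xi>)
        then show ?thesis unfolding chen_defect_eq_0_iff[OF n(1)] by simp
      qed
    qed
    \<comment> \<open>The given plane is not known to minimize \<open>K\<close>. Its excess over the
      minimum has the wrong sign here, so the inequality just proved forces it to vanish.\<close>
    then have "bound - delta_invariant B gM q = - (P.K (e 1) (e 2) - P.K u v)"
      using \<delta>[OF e E(1) \<delta>e[OF e]] by simp
    moreover have "P.K u v \<le> P.K (e 1) (e 2)" using uv(2) o[OF e] by blast
    ultimately show "delta_invariant B gM q = bound" using le by simp
  qed
qed

end

end

theorem theorem6p1:
  fixes A :: "('p::{t2_space, second_countable_topology}, 'e::euclidean_space) chart set"
    and B :: "('q::{t2_space, second_countable_topology}, 'f::euclidean_space) chart set"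
    and \<iota> :: "'q \<Rightarrow> 'p"
    and \<phi> :: "'p \<Rightarrow> 'e \<Rightarrow> 'e" and \<xi> :: "'p \<Rightarrow> 'e" and \<eta> :: "'p \<Rightarrow> 'e \<Rightarrow> real"
    and g :: "'p \<Rightarrow> 'e \<Rightarrow> 'e \<Rightarrow> real"
    and f1 f2 f3 f4 f5 f6 :: "'p \<Rightarrow> real"
    and n m :: nat
  assumes "n \<ge> 3" and "DIM('f) = n" and "DIM('e) = 2 * m + 1"
    and "smooth_atlas A" and "smooth_atlas B"
    and "gen_km_contact_space_form A \<phi> \<xi> \<eta> g f1 f2 f3 f4 f5 f6"
    and "\<forall>p. f3 p = f1 p - 1"
    and "immersion B A \<iota>"
    and "C_totally_real B A \<iota> g \<xi>"
  shows "\<forall>q.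
    let gM = induced_metric B A \<iota> g q;
        H = mean_curvature B A \<iota> g q;
        S = shape_operator B A \<iota> g q;
        \<delta> = delta_invariant B (induced_metric B A \<iota> g) q;
        bound = (real n)\<^sup>2 * (real n - 2) / (2 * (real n - 1)) * g (\<iota> q) H H
                + (real n + 1) * (real n - 2) / 2 * f1 (\<iota> q)
    in \<delta> \<le> bound \<and>
       (\<delta> = bound \<longleftrightarrow>
         (\<exists>(\<pi> :: 'f set) (e :: nat \<Rightarrow> 'f) (E :: nat \<Rightarrow> 'e) (a :: real) (b :: real)
            (c :: nat \<Rightarrow> real) (d :: nat \<Rightarrow> real).
            plane_section \<pi> \<and>
            onb gM UNIV {1..n} e \<and>
            onb (g (\<iota> q)) (normal_vectors B A \<iota> g q) {n+1..2*m+1} E \<and>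
            E (2*m+1) = \<xi> (\<iota> q) \<and>
            \<pi> = span {e 1, e 2} \<and>
            matrix_form n e (S (E (n+1))) (matrix_ab a b) \<and>
            (\<forall>r\<in>{n+2..2*m}. matrix_form n e (S (E r)) (matrix_cd (c r) (d r))) \<and>
            (\<forall>v. S (\<xi> (\<iota> q)) v = 0)))"
proof -
  interpret space_form_submanifold A B \<iota> \<phi> \<xi> \<eta> g f1 f2 f3 f4 f5 f6
    using assms(4-9) by unfold_locales (auto simp: gen_km_contact_space_form_def)
  show ?thesis
    unfolding Let_def using chen_inequality[OF assms(1-3)] by blast
qed

end
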